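(* The category $\mathbf{CTS}$ of cubical transition systems is a coreflective locally finitely presentable subcategory of $\mathbf{WHDTS}$.
   Context: Fix a nonempty set $\Sigma$ (of labels). A weak higher dimensional transition system (weak HDTS) is a triple $(S,\mu:L\to\Sigma,T=\bigcup_{n\ge 1}T_n)$ where $S$ is a set (states), $L$ a set (actions), $\mu$ a set map (labelling map), $T_n\subset S\times L^n\times S$ (the $n$-transitions) such that: (Multiset axiom) if $(\alpha,u_1,\dots,u_n,\beta)\in T$, $n\ge 2$, then $(\alpha,u_{\sigma(1)},\dots,u_{\sigma(n)},\beta)\in T$ for every permutation $\sigma$; (Coherence axiom) for $n\ge 3$, $p,q\ge 1$, $p+q<n$, if $(\alpha,u_1,\dots,u_n,\beta)$, $(\alpha,u_1,\dots,u_p,\nu_1)$, $(\nu_1,u_{p+1},\dots,u_n,\beta)$, $(\alpha,u_1,\dots,u_{p+q},\nu_2)$, $(\nu_2,u_{p+q+1},\dots,u_n,\beta)$ are all transitions, then $(\nu_1,u_{p+1},\dots,u_{p+q},\nu_2)$ is a transition. A map $f$ of weak HDTS consists of a map $f_0$ on states and a label-preserving map $\widetilde f$ on actions carrying transitions to transitions. The category is $\mathbf{WHDTS}$. For $n\ge 0$ and $x_1,\dots,x_n\in\Sigma$, the $n$-cube $C_n[x_1,\dots,x_n]$ has states $\{0,1\}^n$, actions $\{(x_1,1),\dots,(x_n,n)\}$ with $\mu(x_i,i)=x_i$, and transitions all tuples $((\epsilon_1,\dots,\epsilon_n),(x_{i_1},i_1),\dots,(x_{i_d},i_d),(\epsilon'_1,\dots,\epsilon'_n))$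 with $d\geq 1$, $i_1,\dots,i_d$ pairwise distinct, $\epsilon_i\le\epsilon'_i$ for all $i$, and $\epsilon_i\ne\epsilon'_i$ iff $i\in\{i_1,\dots,i_d\}$. A subcube of $X$ is the image (smallest subobject of $X$ through which the map factors) of a map $C_n[x_1,\dots,x_n]\to X$. Every family of subobjects of a weak HDTS has a union (least upper bound among subobjects). A weak HDTS is a cubical transition system if it equals the union of its subcubes. $\mathbf{CTS}\subset\mathbf{WHDTS}$ is the full subcategory of cubical transition systems. A coreflective subcategory is a full isomorphism-closed subcategory whose inclusion functor has a right adjoint. *)

theory Defs
  imports Main "HOL-Library.FuncSet" "HOL-Combinatorics.Permutations"
begin

unbundle cardinal_syntax

section \<open>Size\<close>

text \<open>
  The type \<open>'u\<close> plays the role of a universe: a set, of any type, is small if its cardinality is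
  less than that of \<open>'u\<close>. The cardinality of \<open>'u\<close> is only required to be regular and uncountable.
  If it is moreover a strong limit, i.e. inaccessible, the small sets are, up to bijection, exactly
  the members of a Grothendieck universe.
\<close>

definition universe :: "'u itself \<Rightarrow> bool" where
  "universe _ \<longleftrightarrow> regularCard |UNIV :: 'u set| \<and> natLeq <o |UNIV :: 'u set|"

definition small :: "'u itself \<Rightarrow> 'b set \<Rightarrow> bool" where
  "small _ A \<longleftrightarrow> |A| <o |UNIV :: 'u set|"


section \<open>Categories\<close>

record ('o, 'a) cat =
  Obj :: "'o set"
  Arr :: "'a set"
  Dom :: "'a \<Rightarrow> 'o"
  Cod :: "'a \<Rightarrow> 'o"
  Ident :: "'o \<Rightarrow> 'a"
  Comp :: "'a \<Rightarrow> 'a \<Rightarrow> 'a"  \<comment> \<open>\<open>Comp C g f\<close> is \<open>g\<close> after \<open>f\<close>\<close>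

definition hom :: "('o, 'a) cat \<Rightarrow> 'o \<Rightarrow> 'o \<Rightarrow> 'a set" where
  "hom C x y = {f \<in> Arr C. Dom C f = x \<and> Cod C f = y}"

definition category :: "('o, 'a) cat \<Rightarrow> bool" where
  "category C \<longleftrightarrow>
     (\<forall>f \<in> Arr C. Dom C f \<in> Obj C \<and> Cod C f \<in> Obj C) \<and>
     (\<forall>x \<in> Obj C. Ident C x \<in> hom C x x) \<and>
     (\<forall>f \<in> Arr C. \<forall>g \<in> Arr C. Cod C f = Dom C g \<longrightarrow>
        Comp C g f \<in> hom C (Dom C f) (Cod C g)) \<and>
     (\<forall>f \<in> Arr C. Comp C f (Ident C (Dom C f)) = f \<and> Comp C (Ident C (Cod C f)) f = f) \<and>
     (\<forall>f \<in> Arr C. \<forall>g \<in> Arr C. \<forall>h \<in> Arr C. Cod C f = Dom C g \<longrightarrow> Cod C g = Dom C h \<longrightarrow>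
        Comp C h (Comp C g f) = Comp C (Comp C h g) f)"

definition small_category :: "'u itself \<Rightarrow> ('o, 'a) cat \<Rightarrow> bool" where
  "small_category U C \<longleftrightarrow> category C \<and> small U (Obj C) \<and> small U (Arr C)"

definition isomorphic :: "('o, 'a) cat \<Rightarrow> 'o \<Rightarrow> 'o \<Rightarrow> bool" where
  "isomorphic C x y \<longleftrightarrow>
     (\<exists>f \<in> hom C x y. \<exists>g \<in> hom C y x. Comp C g f = Ident C x \<and> Comp C f g = Ident C y)"

record ('o, 'a, 'p, 'b) cat_functor =
  fobj :: "'o \<Rightarrow> 'p"
  farr :: "'a \<Rightarrow> 'b"

definition is_functor ::
  "('o, 'a) cat \<Rightarrow> ('p, 'b) cat \<Rightarrow> ('o, 'a, 'p, 'b) cat_functor \<Rightarrow> bool" where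
  "is_functor C D F \<longleftrightarrow>
     (\<forall>x \<in> Obj C. fobj F x \<in> Obj D) \<and>
     (\<forall>f \<in> Arr C. farr F f \<in> hom D (fobj F (Dom C f)) (fobj F (Cod C f))) \<and>
     (\<forall>x \<in> Obj C. farr F (Ident C x) = Ident D (fobj F x)) \<and>
     (\<forall>f \<in> Arr C. \<forall>g \<in> Arr C. Cod C f = Dom C g \<longrightarrow>
        farr F (Comp C g f) = Comp D (farr F g) (farr F f))"

definition functor_comp ::
  "('p, 'b, 'q, 'c) cat_functor \<Rightarrow> ('o, 'a, 'p, 'b) cat_functor \<Rightarrow> ('o, 'a, 'q, 'c) cat_functor" where
  "functor_comp G F = \<lparr>fobj = fobj G \<circ> fobj F, farr = farr G \<circ> farr F\<rparr>"


subsection \<open>Coreflective subcategories\<close>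

definition full_subcat :: "('o, 'a) cat \<Rightarrow> 'o set \<Rightarrow> ('o, 'a) cat" where
  "full_subcat C P =
     C\<lparr>Obj := Obj C \<inter> P, Arr := {f \<in> Arr C. Dom C f \<in> Obj C \<inter> P \<and> Cod C f \<in> Obj C \<inter> P}\<rparr>"

definition iso_closed :: "('o, 'a) cat \<Rightarrow> 'o set \<Rightarrow> bool" where
  "iso_closed C P \<longleftrightarrow> (\<forall>x \<in> P. \<forall>y \<in> Obj C. isomorphic C x y \<longrightarrow> y \<in> P)"

definition right_adjoint ::
  "('p, 'b) cat \<Rightarrow> ('o, 'a) cat \<Rightarrow> ('p, 'b, 'o, 'a) cat_functor \<Rightarrow> ('o, 'a, 'p, 'b) cat_functor \<Rightarrow> bool"
  where
  "right_adjoint D C F G \<longleftrightarrow> is_functor D C F \<and> is_functor C D G \<and>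
     (\<exists>\<phi>. (\<forall>d \<in> Obj D. \<forall>c \<in> Obj C.
              bij_betw (\<phi> d c) (hom C (fobj F d) c) (hom D d (fobj G c))) \<and>
          (\<forall>d \<in> Obj D. \<forall>d' \<in> Obj D. \<forall>c \<in> Obj C. \<forall>c' \<in> Obj C.
             \<forall>h \<in> hom C (fobj F d) c. \<forall>l \<in> hom D d' d. \<forall>k \<in> hom C c c'.
               \<phi> d' c' (Comp C k (Comp C h (farr F l))) =
               Comp D (farr G k) (Comp D (\<phi> d c h) l)))"

definition inclusion :: "('o, 'a, 'o, 'a) cat_functor" where
  "inclusion = \<lparr>fobj = \<lambda>x. x, farr = \<lambda>f. f\<rparr>"

definition coreflective_subcategory :: "('o, 'a) cat \<Rightarrow> ('o, 'a) cat \<Rightarrow> bool" where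
  "coreflective_subcategory D C \<longleftrightarrow> category C \<and>
     Obj D \<subseteq> Obj C \<and> D = full_subcat C (Obj D) \<and> iso_closed C (Obj D) \<and>
     (\<exists>R. right_adjoint D C inclusion R)"


subsection \<open>Colimits\<close>

definition is_cocone ::
  "('j, 'k) cat \<Rightarrow> ('o, 'a) cat \<Rightarrow> ('j, 'k, 'o, 'a) cat_functor \<Rightarrow> 'o \<Rightarrow> ('j \<Rightarrow> 'a) \<Rightarrow> bool" where
  "is_cocone J C D c \<iota> \<longleftrightarrow> c \<in> Obj C \<and>
     (\<forall>j \<in> Obj J. \<iota> j \<in> hom C (fobj D j) c) \<and>
     (\<forall>f \<in> Arr J. Comp C (\<iota> (Cod J f)) (farr D f) = \<iota> (Dom J f))"

definition is_colimit ::
  "('j, 'k) cat \<Rightarrow> ('o, 'a) cat \<Rightarrow> ('j, 'k, 'o, 'a) cat_functor \<Rightarrow> 'o \<Rightarrow> ('j \<Rightarrow> 'a) \<Rightarrow> bool" where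
  "is_colimit J C D c \<iota> \<longleftrightarrow> is_cocone J C D c \<iota> \<and>
     (\<forall>c' \<iota>'. is_cocone J C D c' \<iota>' \<longrightarrow>
        (\<exists>!h. h \<in> hom C c c' \<and> (\<forall>j \<in> Obj J. Comp C h (\<iota> j) = \<iota>' j)))"

definition cocomplete :: "'u itself \<Rightarrow> ('o, 'a) cat \<Rightarrow> bool" where
  "cocomplete U C \<longleftrightarrow>
     (\<forall>(J :: ('u, 'u) cat) D. small_category U J \<longrightarrow> is_functor J C D \<longrightarrow>
        (\<exists>c \<iota>. is_colimit J C D c \<iota>))"


subsection \<open>Locally finitely presentable categories\<close>

definition directed_poset :: "'i set \<Rightarrow> ('i \<times> 'i) set \<Rightarrow> bool" where
  "directed_poset I r \<longleftrightarrow> r \<subseteq> I \<times> I \<and> refl_on I r \<and> trans r \<and> antisym r \<and>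
     I \<noteq> {} \<and> (\<forall>i \<in> I. \<forall>j \<in> I. \<exists>k \<in> I. (i, k) \<in> r \<and> (j, k) \<in> r)"

definition poset_cat :: "'i set \<Rightarrow> ('i \<times> 'i) set \<Rightarrow> ('i, 'i \<times> 'i) cat" where
  "poset_cat I r = \<lparr>Obj = I, Arr = r, Dom = fst, Cod = snd,
     Ident = (\<lambda>i. (i, i)), Comp = (\<lambda>g f. (fst f, snd g))\<rparr>"

text \<open>All sets of elements of \<open>'a\<close>; an arrow is a triple of source, extensional function and target.\<close>

definition Set_cat :: "('a set, 'a set \<times> ('a \<Rightarrow> 'a) \<times> 'a set) cat" where
  "Set_cat = \<lparr>Obj = UNIV, Arr = {(A, f, B). f \<in> A \<rightarrow>\<^sub>E B},
     Dom = (\<lambda>(A, f, B). A), Cod = (\<lambda>(A, f, B). B),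
     Ident = (\<lambda>A. (A, \<lambda>x \<in> A. x, A)),
     Comp = (\<lambda>(B, g, E) (A, f, B'). (A, compose A g f, E))\<rparr>"

definition hom_functor ::
  "('o, 'a) cat \<Rightarrow> 'o \<Rightarrow> ('o, 'a, 'a set, 'a set \<times> ('a \<Rightarrow> 'a) \<times> 'a set) cat_functor" where
  "hom_functor C K =
     \<lparr>fobj = hom C K,
      farr = (\<lambda>g. (hom C K (Dom C g), \<lambda>f \<in> hom C K (Dom C g). Comp C g f, hom C K (Cod C g)))\<rparr>"

text \<open>
  An object \<open>K\<close> is finitely presentable if \<open>hom(K, -)\<close> preserves small directed colimits.
  This is used for categories whose type of arrows is at least as large as \<open>'u\<close>, so that
  \<open>Set_cat\<close> contains a copy of the colimit, computed in the category of sets, of every small diagram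
  of hom-sets.
\<close>

definition finitely_presentable :: "'u itself \<Rightarrow> ('o, 'a) cat \<Rightarrow> 'o \<Rightarrow> bool" where
  "finitely_presentable U C K \<longleftrightarrow> K \<in> Obj C \<and>
     (\<forall>(I :: 'u set) r D c \<iota>.
        small U I \<longrightarrow> directed_poset I r \<longrightarrow> is_functor (poset_cat I r) C D \<longrightarrow>
        is_colimit (poset_cat I r) C D c \<iota> \<longrightarrow>
        is_colimit (poset_cat I r) Set_cat (functor_comp (hom_functor C K) D)
          (fobj (hom_functor C K) c) (\<lambda>i. farr (hom_functor C K) (\<iota> i)))"

definition locally_finitely_presentable :: "'u itself \<Rightarrow> ('o, 'a) cat \<Rightarrow> bool" where
  "locally_finitely_presentable U C \<longleftrightarrow> category C \<and> cocomplete U C \<and>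
     (\<exists>G. small U G \<and> (\<forall>K \<in> G. finitely_presentable U C K) \<and>
        (\<forall>x \<in> Obj C. \<exists>(I :: 'u set) r D \<iota>.
           small U I \<and> directed_poset I r \<and> is_functor (poset_cat I r) C D \<and>
           (\<forall>i \<in> I. fobj D i \<in> G) \<and> is_colimit (poset_cat I r) C D x \<iota>))"


subsection \<open>Subobjects\<close>

text \<open>
  A subobject of \<open>x\<close> is represented by a monomorphism into \<open>x\<close>; two of them represent the
  same subobject iff each is below the other for \<open>sub_le\<close>.
\<close>

definition monic :: "('o, 'a) cat \<Rightarrow> 'a \<Rightarrow> bool" where
  "monic C m \<longleftrightarrow> m \<in> Arr C \<and>
     (\<forall>f \<in> Arr C. \<forall>g \<in> Arr C. Dom C f = Dom C g \<longrightarrow> Cod C f = Dom C m \<longrightarrow> Cod C g = Dom C m \<longrightarrow>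
        Comp C m f = Comp C m g \<longrightarrow> f = g)"

definition subobjects :: "('o, 'a) cat \<Rightarrow> 'o \<Rightarrow> 'a set" where
  "subobjects C x = {m. monic C m \<and> Cod C m = x}"

definition sub_le :: "('o, 'a) cat \<Rightarrow> 'a \<Rightarrow> 'a \<Rightarrow> bool" where
  "sub_le C m m' \<longleftrightarrow> (\<exists>k \<in> hom C (Dom C m) (Dom C m'). Comp C m' k = m)"

definition is_sub_union :: "('o, 'a) cat \<Rightarrow> 'o \<Rightarrow> 'a set \<Rightarrow> 'a \<Rightarrow> bool" where
  "is_sub_union C x M u \<longleftrightarrow> u \<in> subobjects C x \<and> (\<forall>m \<in> M. sub_le C m u) \<and>
     (\<forall>w \<in> subobjects C x. (\<forall>m \<in> M. sub_le C m w) \<longrightarrow> sub_le C u w)"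


section \<open>Weak higher dimensional transition systems\<close>

text \<open>An \<open>n\<close>-transition is a triple whose middle component is a list of length \<open>n\<close>.\<close>

record ('s, 'l, 'x) whdts =
  states :: "'s set"
  actions :: "'l set"
  label :: "'l \<Rightarrow> 'x"
  transitions :: "('s \<times> 'l list \<times> 's) set"

definition weak_hdts :: "'x set \<Rightarrow> ('s, 'l, 'x) whdts \<Rightarrow> bool" where
  "weak_hdts \<Sigma> X \<longleftrightarrow>
     label X \<in> actions X \<rightarrow>\<^sub>E \<Sigma> \<and>
     (\<forall>(\<alpha>, us, \<beta>) \<in> transitions X.
        \<alpha> \<in> states X \<and> \<beta> \<in> states X \<and> set us \<subseteq> actions X \<and> length us \<ge> 1) \<and>
     \<comment> \<open>multiset axiom\<close>
     (\<forall>\<alpha> us \<beta> \<sigma>. (\<alpha>, us, \<beta>) \<in> transitions X \<longrightarrow> length us \<ge> 2 \<longrightarrow> \<sigma> permutes {..<length us} \<longrightarrow>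
        (\<alpha>, permute_list \<sigma> us, \<beta>) \<in> transitions X) \<and>
     \<comment> \<open>coherence axiom\<close>
     (\<forall>\<alpha> us \<beta> \<nu>1 \<nu>2 p q. length us \<ge> 3 \<longrightarrow> p \<ge> 1 \<longrightarrow> q \<ge> 1 \<longrightarrow> p + q < length us \<longrightarrow>
        (\<alpha>, us, \<beta>) \<in> transitions X \<longrightarrow>
        (\<alpha>, take p us, \<nu>1) \<in> transitions X \<longrightarrow> (\<nu>1, drop p us, \<beta>) \<in> transitions X \<longrightarrow>
        (\<alpha>, take (p + q) us, \<nu>2) \<in> transitions X \<longrightarrow> (\<nu>2, drop (p + q) us, \<beta>) \<in> transitions X \<longrightarrow>
        (\<nu>1, take q (drop p us), \<nu>2) \<in> transitions X)"

definition whdts_map ::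
  "('s, 'l, 'x) whdts \<Rightarrow> ('t, 'k, 'x) whdts \<Rightarrow> ('s \<Rightarrow> 't) \<Rightarrow> ('l \<Rightarrow> 'k) \<Rightarrow> bool" where
  "whdts_map X Y f0 f1 \<longleftrightarrow>
     f0 \<in> states X \<rightarrow>\<^sub>E states Y \<and> f1 \<in> actions X \<rightarrow>\<^sub>E actions Y \<and>
     (\<forall>u \<in> actions X. label Y (f1 u) = label X u) \<and>
     (\<forall>(\<alpha>, us, \<beta>) \<in> transitions X. (f0 \<alpha>, map f1 us, f0 \<beta>) \<in> transitions Y)"

record ('s, 'l, 'x) whdts_arr =
  src :: "('s, 'l, 'x) whdts"
  tgt :: "('s, 'l, 'x) whdts"
  on_states :: "'s \<Rightarrow> 's"
  on_actions :: "'l \<Rightarrow> 'l"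

type_synonym ('u, 'x) whdts_cat = "(('u, 'u, 'x) whdts, ('u, 'u, 'x) whdts_arr) cat"

definition WHDTS :: "'x set \<Rightarrow> ('u, 'x) whdts_cat" where
  "WHDTS \<Sigma> =
     (let ob = {X. weak_hdts \<Sigma> X \<and> small TYPE('u) (states X) \<and> small TYPE('u) (actions X)} in
      \<lparr>Obj = ob,
       Arr = {f. src f \<in> ob \<and> tgt f \<in> ob \<and> whdts_map (src f) (tgt f) (on_states f) (on_actions f)},
       Dom = src,
       Cod = tgt,
       Ident = (\<lambda>X. \<lparr>src = X, tgt = X,
                     on_states = (\<lambda>s \<in> states X. s), on_actions = (\<lambda>u \<in> actions X. u)\<rparr>),
       Comp = (\<lambda>g f. \<lparr>src = src f, tgt = tgt g,
                      on_states = compose (states (src f)) (on_states g) (on_states f),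
                      on_actions = compose (actions (src f)) (on_actions g) (on_actions f)\<rparr>)\<rparr>)"


subsection \<open>Cubes and cubical transition systems\<close>

text \<open>
  States of \<open>C\<^sub>n[x\<^sub>1,\<dots>,x\<^sub>n]\<close> are Boolean lists of length \<open>n\<close> (with \<open>False \<le> True\<close> for \<open>0 \<le> 1\<close>);
  positions in lists are counted from 0, directions of the cube from 1.
\<close>

definition cube :: "'x list \<Rightarrow> (bool list, 'x \<times> nat, 'x) whdts" where
  "cube xs =
     (let n = length xs; A = {(xs ! i, Suc i) | i. i < n} in
      \<lparr>states = {e. length e = n},
       actions = A,
       label = (\<lambda>u \<in> A. fst u),
       transitions = {(e, us, e'). length e = n \<and> length e' = n \<and>
                  length us \<ge> 1 \<and> set us \<subseteq> A \<and> distinct (map snd us) \<and>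
                  (\<forall>i < n. e ! i \<le> e' ! i) \<and>
                  (\<forall>i < n. e ! i \<noteq> e' ! i \<longleftrightarrow> Suc i \<in> snd ` set us)}\<rparr>)"

text \<open>
  A cube does not live on the type \<open>'u\<close>, so a map out of a cube is given by its two components
  instead of by an arrow of \<open>WHDTS\<close>.
\<close>

definition factors_through ::
  "('s, 'l, 'x) whdts \<Rightarrow> ('s \<Rightarrow> 'u) \<Rightarrow> ('l \<Rightarrow> 'u) \<Rightarrow> ('u, 'u, 'x) whdts_arr \<Rightarrow> bool" where
  "factors_through Q f0 f1 m \<longleftrightarrow>
     (\<exists>g0 g1. whdts_map Q (src m) g0 g1 \<and>
        f0 = compose (states Q) (on_states m) g0 \<and> f1 = compose (actions Q) (on_actions m) g1)"

definition is_image ::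
  "'x set \<Rightarrow> ('s, 'l, 'x) whdts \<Rightarrow> ('u, 'u, 'x) whdts \<Rightarrow> ('s \<Rightarrow> 'u) \<Rightarrow> ('l \<Rightarrow> 'u) \<Rightarrow>
     ('u, 'u, 'x) whdts_arr \<Rightarrow> bool" where
  "is_image \<Sigma> Q X f0 f1 m \<longleftrightarrow> m \<in> subobjects (WHDTS \<Sigma>) X \<and> factors_through Q f0 f1 m \<and>
     (\<forall>m' \<in> subobjects (WHDTS \<Sigma>) X. factors_through Q f0 f1 m' \<longrightarrow> sub_le (WHDTS \<Sigma>) m m')"

definition subcubes :: "'x set \<Rightarrow> ('u, 'u, 'x) whdts \<Rightarrow> ('u, 'u, 'x) whdts_arr set" where
  "subcubes \<Sigma> X =
     {m. \<exists>xs f0 f1. set xs \<subseteq> \<Sigma> \<and> whdts_map (cube xs) X f0 f1 \<and> is_image \<Sigma> (cube xs) X f0 f1 m}"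

definition cubical :: "'x set \<Rightarrow> ('u, 'u, 'x) whdts \<Rightarrow> bool" where
  "cubical \<Sigma> X \<longleftrightarrow> is_sub_union (WHDTS \<Sigma>) X (subcubes \<Sigma> X) (Ident (WHDTS \<Sigma>) X)"

definition CTS :: "'x set \<Rightarrow> ('u, 'x) whdts_cat" where
  "CTS \<Sigma> = full_subcat (WHDTS \<Sigma>) {X. cubical \<Sigma> X}"

end

(*
  The category of weak HDTS is topological over sets of states and labelled sets of actions, so
  monomorphisms are the injective maps, and the image of a map of which only the transitions are
  known is found by closing these under the multiset and coherence axioms. Hence X is cubical iff
  every action of X occurs in a cube and the transitions of X are the closure of the transitions
  of its cubes. Keeping only these actions and transitions of an arbitrary X is the coreflection.
  Colimits are computed on states and actions, with the closure of the images of the transitions.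
  For a directed diagram no closure is needed, since an instance of the coherence axiom involves
  finitely many elements and so lives at one stage. Therefore a system with finitely many states
  and actions and transitions generated by a finite set is finitely presentable. Every cube is
  finite, so each cubical system is the directed union of such systems which are cubical.
*)
theory Submission
  imports Defs "HOL.Hull"
begin

section \<open>Small sets\<close>

text \<open>Everything has to live on the one type \<open>'u\<close>. A colimit is a quotient of
  pairs (object, element), so a class is named by a chosen pair, coded in \<open>'u\<close> by an
  injection of pairs. Index posets of finite data are coded in \<open>'u\<close> by smallness. A
  generating family must itself be small, while \<open>'u\<close> has too many finite subsets;
  finite systems are therefore renamed onto one fixed countable set of names. The delicate point is
  the passage to one stage of a directed colimit. Representatives chosen for states, for actions and
  for transitions need not fit together. They do so only at a later stage whose map into the colimit
  is injective on the finitely many elements involved. This lifting serves twice: for the coherence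
  axiom in the colimit, and for maps out of finitely generated systems. Finite presentability speaks
  of arbitrary colimit cocones, not of constructed ones, so colimits get an elementwise description
  that is carried over to every colimit by comparison.\<close>

lemma small_mono: "small U B \<Longrightarrow> A \<subseteq> B \<Longrightarrow> small U A"
  unfolding small_def using card_of_mono1 ordLeq_ordLess_trans by blast

lemma small_image: "small U A \<Longrightarrow> small U (f ` A)"
  unfolding small_def using card_of_image ordLeq_ordLess_trans by blast

lemma universe_infinite:
  assumes "universe TYPE('u)"
  shows "infinite (UNIV :: 'u set)"
  using assms ordLess_imp_ordLeq infinite_iff_natLeq_ordLeq unfolding universe_def by blast

text \<open>Regularity enters here: a regular infinite cardinal is stable, that is, sums of fewer
  than that many sets below it stay below it.\<close>

lemma small_Sigma:
  assumes "universe TYPE('u)" and "small TYPE('u) A" and "\<And>a. a \<in> A \<Longrightarrow> small TYPE('u) (B a)"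
  shows "small TYPE('u) (Sigma A B)"
proof -
  have "stable |UNIV :: 'u set|"
    using universe_infinite[OF assms(1)] assms(1)
    unfolding universe_def by (metis Field_card_of card_of_Card_order regularCard_stable)
  then show ?thesis
    using stable_elim[of "|UNIV :: 'u set|" A B] assms(2,3) unfolding small_def by blast
qed

lemma small_UNION:
  assumes "universe TYPE('u)" and "small TYPE('u) A" and "\<And>a. a \<in> A \<Longrightarrow> small TYPE('u) (B a)"
  shows "small TYPE('u) (\<Union>a\<in>A. B a)"
proof -
  have "(\<Union>a\<in>A. B a) = snd ` Sigma A B" by force
  then show ?thesis using small_image[OF small_Sigma[OF assms]] by simp
qed

lemma small_finite:
  assumes "universe TYPE('u)" and "finite A"
  shows "small TYPE('u) A"
  using assms(2) universe_infinite[OF assms(1)]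
  unfolding small_def by (metis Field_card_of card_of_Well_order finite_ordLess_infinite)

text \<open>Uncountability enters here; it keeps the lists over a small set, and with them its
  finite subsets, small.\<close>

lemma small_nat:
  assumes "universe TYPE('u)"
  shows "small TYPE('u) (UNIV :: nat set)"
  using assms card_of_nat ordIso_ordLess_trans unfolding universe_def small_def by blast

lemma small_lists:
  assumes U: "universe TYPE('u)" and "small TYPE('u) A"
  shows "small TYPE('u) (lists A)"
proof -
  have len: "small TYPE('u) {xs \<in> lists A. length xs = n}" for n
  proof (induction n)
    case 0
    have "{xs \<in> lists A. length xs = 0} \<subseteq> {[]}" by auto
    then show ?case using small_finite[OF U] finite_subset by blast
  next
    case (Suc n)
    have "{xs \<in> lists A. length xs = Suc n} \<subseteq>
        (\<lambda>(x, xs). x # xs) ` (A \<times> {xs \<in> lists A. length xs = n})"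
      by (auto simp: length_Suc_conv image_iff)
    then show ?case
      using small_mono[OF small_image[OF small_Sigma[OF U assms(2) Suc]]] by blast
  qed
  have "small TYPE('u) (\<Union>n. {xs \<in> lists A. length xs = n})"
    by (rule small_UNION[OF U small_nat[OF U] len])
  moreover have "lists A = (\<Union>n. {xs \<in> lists A. length xs = n})" by auto
  ultimately show ?thesis by metis
qed

lemma small_Fpow:
  assumes "universe TYPE('u)" and "small TYPE('u) A"
  shows "small TYPE('u) (Fpow A)"
proof -
  have "Fpow A \<subseteq> set ` lists A"
    unfolding Fpow_def using finite_list by (fastforce simp: image_iff)
  then show ?thesis by (rule small_mono[OF small_image[OF small_lists[OF assms]]])
qed

lemma small_imp_inj:
  assumes "small TYPE('u) A"
  obtains e :: "'a \<Rightarrow> 'u" where "inj_on e A"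
  using assms card_of_ordLeq[of A "UNIV :: 'u set"] ordLess_imp_ordLeq unfolding small_def by blast

text \<open>An infinite set is equinumerous with its square. The injection later codes the pairs
  from which colimits are formed.\<close>

lemma universe_pairing:
  assumes "universe TYPE('u)"
  obtains e :: "'u \<times> 'u \<Rightarrow> 'u" where "inj e"
proof -
  have "|(UNIV :: 'u set) \<times> (UNIV :: 'u set)| =o |UNIV :: 'u set|"
    by (rule card_of_Times_same_infinite[OF universe_infinite[OF assms]])
  then have "|UNIV :: ('u \<times> 'u) set| \<le>o |UNIV :: 'u set|"
    unfolding UNIV_Times_UNIV by (rule ordIso_imp_ordLeq)
  then show thesis using card_of_ordLeq[of "UNIV :: ('u \<times> 'u) set" "UNIV :: 'u set"] that by auto
qed


section \<open>Closed sets of transitions\<close>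

type_synonym ('s, 'l) trans = "'s \<times> 'l list \<times> 's"

text \<open>The two axioms as a property of the transition set alone, without carriers, so that
  \<open>hull\<close> applies to them.\<close>

definition hdts_closed :: "('s, 'l) trans set \<Rightarrow> bool" where
  "hdts_closed T \<longleftrightarrow>
     (\<forall>\<alpha> us \<beta> \<sigma>. (\<alpha>, us, \<beta>) \<in> T \<longrightarrow> length us \<ge> 2 \<longrightarrow> \<sigma> permutes {..<length us} \<longrightarrow>
        (\<alpha>, permute_list \<sigma> us, \<beta>) \<in> T) \<and>
     (\<forall>\<alpha> us \<beta> \<nu>1 \<nu>2 p q. length us \<ge> 3 \<longrightarrow> p \<ge> 1 \<longrightarrow> q \<ge> 1 \<longrightarrow> p + q < length us \<longrightarrow>
        (\<alpha>, us, \<beta>) \<in> T \<longrightarrow>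
        (\<alpha>, take p us, \<nu>1) \<in> T \<longrightarrow> (\<nu>1, drop p us, \<beta>) \<in> T \<longrightarrow>
        (\<alpha>, take (p + q) us, \<nu>2) \<in> T \<longrightarrow> (\<nu>2, drop (p + q) us, \<beta>) \<in> T \<longrightarrow>
        (\<nu>1, take q (drop p us), \<nu>2) \<in> T)"

definition transitions_on :: "'s set \<Rightarrow> 'l set \<Rightarrow> ('s, 'l) trans set" where
  "transitions_on S L = {(\<alpha>, us, \<beta>). \<alpha> \<in> S \<and> \<beta> \<in> S \<and> set us \<subseteq> L \<and> length us \<ge> 1}"

definition tmap :: "('s \<Rightarrow> 't) \<Rightarrow> ('l \<Rightarrow> 'k) \<Rightarrow> ('s, 'l) trans \<Rightarrow> ('t, 'k) trans" where
  "tmap f0 f1 = (\<lambda>(\<alpha>, us, \<beta>). (f0 \<alpha>, map f1 us, f0 \<beta>))"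

lemma tmap_simp [simp]: "tmap f0 f1 (\<alpha>, us, \<beta>) = (f0 \<alpha>, map f1 us, f0 \<beta>)"
  by (simp add: tmap_def)

lemma tmap_tmap: "tmap g0 g1 (tmap f0 f1 t) = tmap (\<lambda>x. g0 (f0 x)) (\<lambda>x. g1 (f1 x)) t"
  by (cases t) auto

lemma tmap_cong:
  assumes "t \<in> transitions_on S L" and "\<And>x. x \<in> S \<Longrightarrow> f0 x = g0 x" and "\<And>x. x \<in> L \<Longrightarrow> f1 x = g1 x"
  shows "tmap f0 f1 t = tmap g0 g1 t"
  using assms by (cases t) (auto simp: transitions_on_def)

lemma tmap_ident:
  assumes "t \<in> transitions_on S L" and "\<And>x. x \<in> S \<Longrightarrow> f0 x = x" and "\<And>x. x \<in> L \<Longrightarrow> f1 x = x"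
  shows "tmap f0 f1 t = t"
  using assms by (cases t) (auto simp: transitions_on_def intro: map_idI)

lemma tmap_in_transitions_on:
  assumes "t \<in> transitions_on S L" and "f0 ` S \<subseteq> S'" and "f1 ` L \<subseteq> L'"
  shows "tmap f0 f1 t \<in> transitions_on S' L'"
  using assms by (cases t) (auto simp: transitions_on_def)

lemma transitions_on_mono: "S \<subseteq> S' \<Longrightarrow> L \<subseteq> L' \<Longrightarrow> transitions_on S L \<subseteq> transitions_on S' L'"
  by (auto simp: transitions_on_def)

lemma tmap_inj:
  assumes "inj_on f0 S" and "inj_on f1 L" and "t \<in> transitions_on S L" "t' \<in> transitions_on S L"
    and "tmap f0 f1 t = tmap f0 f1 t'"
  shows "t = t'"
proof -
  obtain a us b a' us' b' where t: "t = (a, us, b)" "t' = (a', us', b')" by (metis prod_cases3)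
  have "inj_on f1 (set us \<union> set us')"
    using assms(2-4) t by (auto simp: transitions_on_def intro: inj_on_subset)
  then have "us = us'" using map_inj_on[of f1 us us'] assms(5) t by simp
  then show ?thesis using assms t by (auto simp: transitions_on_def dest: inj_onD)
qed

lemma hdts_closed_permute:
  "hdts_closed T \<Longrightarrow> (\<alpha>, us, \<beta>) \<in> T \<Longrightarrow> length us \<ge> 2 \<Longrightarrow> \<sigma> permutes {..<length us} \<Longrightarrow>
     (\<alpha>, permute_list \<sigma> us, \<beta>) \<in> T"
  unfolding hdts_closed_def by meson

lemma hdts_closed_coherence:
  "hdts_closed T \<Longrightarrow> length us \<ge> 3 \<Longrightarrow> p \<ge> 1 \<Longrightarrow> q \<ge> 1 \<Longrightarrow> p + q < length us \<Longrightarrow>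
     (\<alpha>, us, \<beta>) \<in> T \<Longrightarrow> (\<alpha>, take p us, \<nu>1) \<in> T \<Longrightarrow> (\<nu>1, drop p us, \<beta>) \<in> T \<Longrightarrow>
     (\<alpha>, take (p + q) us, \<nu>2) \<in> T \<Longrightarrow> (\<nu>2, drop (p + q) us, \<beta>) \<in> T \<Longrightarrow>
     (\<nu>1, take q (drop p us), \<nu>2) \<in> T"
  unfolding hdts_closed_def by meson

lemma hdts_closed_Inter:
  assumes "\<And>T. T \<in> \<T> \<Longrightarrow> hdts_closed T"
  shows "hdts_closed (\<Inter>\<T>)"
  unfolding hdts_closed_def
proof (intro conjI allI impI InterI)
  fix \<alpha> us \<beta> \<sigma> T
  assume "(\<alpha>, us, \<beta>) \<in> \<Inter>\<T>" "length us \<ge> 2" "\<sigma> permutes {..<length us}" "T \<in> \<T>"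
  then show "(\<alpha>, permute_list \<sigma> us, \<beta>) \<in> T"
    using hdts_closed_permute[OF assms, of T] by blast
next
  fix \<alpha> us \<beta> \<nu>1 \<nu>2 p q T
  assume "3 \<le> length us" "1 \<le> p" "1 \<le> q" "p + q < length us" "T \<in> \<T>"
    "(\<alpha>, us, \<beta>) \<in> \<Inter>\<T>" "(\<alpha>, take p us, \<nu>1) \<in> \<Inter>\<T>" "(\<nu>1, drop p us, \<beta>) \<in> \<Inter>\<T>"
    "(\<alpha>, take (p + q) us, \<nu>2) \<in> \<Inter>\<T>" "(\<nu>2, drop (p + q) us, \<beta>) \<in> \<Inter>\<T>"
  then show "(\<nu>1, take q (drop p us), \<nu>2) \<in> T"
    by (intro hdts_closed_coherence[OF assms, of T us p q \<alpha> \<beta>]) simp_all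
qed

lemma hdts_closed_hull: "hdts_closed (hdts_closed hull T)"
  by (rule hull_in) (simp add: hdts_closed_Inter)

text \<open>Permuting, \<open>take\<close> and \<open>drop\<close> commute with \<open>map\<close>,
  so both axioms may be checked after applying the two functions. Through this, inclusions about
  images of hulls reduce to the generators.\<close>

lemma hdts_closed_vimage:
  assumes "hdts_closed T"
  shows "hdts_closed (tmap f0 f1 -` T)"
  unfolding hdts_closed_def vimage_eq tmap_simp
proof (intro conjI allI impI)
  fix \<alpha> us \<beta> \<sigma>
  assume "(f0 \<alpha>, map f1 us, f0 \<beta>) \<in> T" "length us \<ge> 2" "\<sigma> permutes {..<length us}"
  then show "(f0 \<alpha>, map f1 (permute_list \<sigma> us), f0 \<beta>) \<in> T"
    using hdts_closed_permute[OF assms, of _ "map f1 us"] by (simp flip: permute_list_map)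
next
  fix \<alpha> us \<beta> \<nu>1 \<nu>2 p q
  assume "3 \<le> length us" "1 \<le> p" "1 \<le> q" "p + q < length us"
    "(f0 \<alpha>, map f1 us, f0 \<beta>) \<in> T" "(f0 \<alpha>, map f1 (take p us), f0 \<nu>1) \<in> T"
    "(f0 \<nu>1, map f1 (drop p us), f0 \<beta>) \<in> T" "(f0 \<alpha>, map f1 (take (p + q) us), f0 \<nu>2) \<in> T"
    "(f0 \<nu>2, map f1 (drop (p + q) us), f0 \<beta>) \<in> T"
  then show "(f0 \<nu>1, map f1 (take q (drop p us)), f0 \<nu>2) \<in> T"
    using hdts_closed_coherence[OF assms, of "map f1 us" p q] by (simp add: take_map drop_map)
qed

text \<open>The letters and end states of a coherent consequence occur in its premises, and the
  bounds on \<open>p\<close> and \<open>q\<close> make its word nonempty. Hence a hull never leaves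
  the carriers of its generators.\<close>

lemma hdts_closed_transitions_on: "hdts_closed (transitions_on S L)"
  unfolding hdts_closed_def
proof (intro conjI allI impI)
  fix \<alpha> us \<beta> \<sigma>
  assume "(\<alpha>, us, \<beta>) \<in> transitions_on S L" "\<sigma> permutes {..<length us}"
  then show "(\<alpha>, permute_list \<sigma> us, \<beta>) \<in> transitions_on S L"
    by (simp add: transitions_on_def)
next
  fix \<alpha> us \<beta> \<nu>1 \<nu>2 p q
  assume "1 \<le> q" "p + q < length us" "(\<alpha>, us, \<beta>) \<in> transitions_on S L"
    "(\<alpha>, take p us, \<nu>1) \<in> transitions_on S L" "(\<nu>2, drop (p + q) us, \<beta>) \<in> transitions_on S L"
  then show "(\<nu>1, take q (drop p us), \<nu>2) \<in> transitions_on S L"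
    using order_trans[OF order_trans[OF set_take_subset[of q "drop p us"] set_drop_subset[of p us]],
        of L]
    by (simp add: transitions_on_def)
qed

lemma hull_tmap:
  assumes "tmap f0 f1 ` T \<subseteq> hdts_closed hull T'"
  shows "tmap f0 f1 ` (hdts_closed hull T) \<subseteq> hdts_closed hull T'"
  using hull_minimal[of T "tmap f0 f1 -` (hdts_closed hull T')" hdts_closed]
    hdts_closed_vimage[OF hdts_closed_hull] assms by blast

lemma hull_tmap_closed:
  assumes "tmap f0 f1 ` T \<subseteq> T'" and "hdts_closed T'"
  shows "tmap f0 f1 ` (hdts_closed hull T) \<subseteq> T'"
  using hull_tmap[of f0 f1 T T'] hull_same[of hdts_closed T'] assms by simp

lemma hull_transitions_on:
  "T \<subseteq> transitions_on S L \<Longrightarrow> hdts_closed hull T \<subseteq> transitions_on S L"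
  using hull_minimal hdts_closed_transitions_on by metis

lemma weak_hdts_iff:
  "weak_hdts \<Sigma> X \<longleftrightarrow> label X \<in> actions X \<rightarrow>\<^sub>E \<Sigma> \<and>
     transitions X \<subseteq> transitions_on (states X) (actions X) \<and> hdts_closed (transitions X)"
proof -
  have "transitions X \<subseteq> transitions_on (states X) (actions X) \<longleftrightarrow>
      (\<forall>(\<alpha>, us, \<beta>) \<in> transitions X.
        \<alpha> \<in> states X \<and> \<beta> \<in> states X \<and> set us \<subseteq> actions X \<and> length us \<ge> 1)"
    unfolding transitions_on_def by blast
  then show ?thesis unfolding weak_hdts_def hdts_closed_def by simp
qed

lemma whdts_map_iff:
  "whdts_map X Y f0 f1 \<longleftrightarrow>
     f0 \<in> states X \<rightarrow>\<^sub>E states Y \<and> f1 \<in> actions X \<rightarrow>\<^sub>E actions Y \<and>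
     (\<forall>u \<in> actions X. label Y (f1 u) = label X u) \<and>
     tmap f0 f1 ` transitions X \<subseteq> transitions Y"
  unfolding whdts_map_def tmap_def by (auto simp: image_subset_iff split: prod.splits)

lemma whdts_mapD:
  assumes "whdts_map X Y f0 f1"
  shows "f0 \<in> states X \<rightarrow>\<^sub>E states Y" "f1 \<in> actions X \<rightarrow>\<^sub>E actions Y"
    and "\<And>s. s \<in> states X \<Longrightarrow> f0 s \<in> states Y"
    and "\<And>u. u \<in> actions X \<Longrightarrow> f1 u \<in> actions Y"
    and "\<And>u. u \<in> actions X \<Longrightarrow> label Y (f1 u) = label X u"
    and "\<And>t. t \<in> transitions X \<Longrightarrow> tmap f0 f1 t \<in> transitions Y"
  using assms unfolding whdts_map_iff image_subset_iff by (auto simp: PiE_mem)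

section \<open>Systems generated by a set of transitions\<close>

definition generated ::
  "'s set \<Rightarrow> 'l set \<Rightarrow> ('l \<Rightarrow> 'x) \<Rightarrow> ('s, 'l) trans set \<Rightarrow> ('s, 'l, 'x) whdts" where
  "generated S L l T =
     \<lparr>states = S, actions = L, label = restrict l L, transitions = hdts_closed hull T\<rparr>"

lemma generated_simps [simp]:
  "states (generated S L l T) = S" "actions (generated S L l T) = L"
  "label (generated S L l T) = restrict l L" "transitions (generated S L l T) = hdts_closed hull T"
  by (simp_all add: generated_def)

lemma weak_hdts_generated:
  assumes "l ` L \<subseteq> \<Sigma>" and "T \<subseteq> transitions_on S L"
  shows "weak_hdts \<Sigma> (generated S L l T)"
  using assms hull_transitions_on[OF assms(2)] hdts_closed_hull[of T]
      by (simp add: weak_hdts_iff image_subset_iff)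

text \<open>The preimage of the closed set \<open>transitions Y\<close> is closed, so it contains
  the hull as soon as it contains the generators.\<close>

lemma whdts_map_generated:
  assumes "weak_hdts \<Sigma> Y" and "f0 \<in> S \<rightarrow>\<^sub>E states Y" and "f1 \<in> L \<rightarrow>\<^sub>E actions Y"
    and "\<And>u. u \<in> L \<Longrightarrow> label Y (f1 u) = l u" and "tmap f0 f1 ` T \<subseteq> transitions Y"
  shows "whdts_map (generated S L l T) Y f0 f1"
  using assms hull_tmap_closed[of f0 f1 T "transitions Y"] by (auto simp: whdts_map_iff weak_hdts_iff)

lemma whdts_map_compose:
  assumes "transitions X \<subseteq> transitions_on (states X) (actions X)"
    and "whdts_map X Y f0 f1" and "whdts_map Y Z g0 g1"
  shows "whdts_map X Z (compose (states X) g0 f0) (compose (actions X) g1 f1)"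
proof -
  have "tmap (compose (states X) g0 f0) (compose (actions X) g1 f1) t = tmap g0 g1 (tmap f0 f1 t)"
    if "t \<in> transitions X" for t
    unfolding tmap_tmap using assms(1) that by (intro tmap_cong) (auto simp: compose_eq)
  then have "tmap (compose (states X) g0 f0) (compose (actions X) g1 f1) ` transitions X \<subseteq> transitions Z"
    using whdts_mapD(6)[OF assms(2)] whdts_mapD(6)[OF assms(3)] by (simp add: image_subset_iff)
  then show ?thesis
    using whdts_mapD(3-5)[OF assms(2)] whdts_mapD(3-5)[OF assms(3)]
    unfolding whdts_map_iff by (simp add: compose_def)
qed

lemma whdts_map_ident:
  assumes "transitions X \<subseteq> transitions_on (states X) (actions X)"
  shows "whdts_map X X (\<lambda>s\<in>states X. s) (\<lambda>u\<in>actions X. u)"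
proof -
  have "tmap (\<lambda>s\<in>states X. s) (\<lambda>u\<in>actions X. u) t = t" if "t \<in> transitions X" for t
    using that assms by (intro tmap_ident) auto
  then show ?thesis by (auto simp: whdts_map_iff)
qed

section \<open>The category of weak higher dimensional transition systems\<close>

lemma Obj_WHDTS:
  "X \<in> Obj (WHDTS \<Sigma> :: ('u, 'x) whdts_cat) \<longleftrightarrow>
     weak_hdts \<Sigma> X \<and> small TYPE('u) (states X) \<and> small TYPE('u) (actions X)"
  by (simp add: WHDTS_def Let_def)

lemma Arr_WHDTS:
  "f \<in> Arr (WHDTS \<Sigma>) \<longleftrightarrow> src f \<in> Obj (WHDTS \<Sigma>) \<and> tgt f \<in> Obj (WHDTS \<Sigma>) \<and>
     whdts_map (src f) (tgt f) (on_states f) (on_actions f)"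
  by (simp add: WHDTS_def Let_def)

lemma WHDTS_simps [simp]:
  "Dom (WHDTS \<Sigma>) = src" "Cod (WHDTS \<Sigma>) = tgt"
  "Ident (WHDTS \<Sigma>) X = \<lparr>src = X, tgt = X,
     on_states = (\<lambda>s \<in> states X. s), on_actions = (\<lambda>u \<in> actions X. u)\<rparr>"
  "Comp (WHDTS \<Sigma>) g f = \<lparr>src = src f, tgt = tgt g,
     on_states = compose (states (src f)) (on_states g) (on_states f),
     on_actions = compose (actions (src f)) (on_actions g) (on_actions f)\<rparr>"
  by (simp_all add: WHDTS_def Let_def)

lemma hom_WHDTS:
  "f \<in> hom (WHDTS \<Sigma>) X Y \<longleftrightarrow> X \<in> Obj (WHDTS \<Sigma>) \<and> Y \<in> Obj (WHDTS \<Sigma>) \<and> src f = X \<and> tgt f = Y \<and>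
     whdts_map X Y (on_states f) (on_actions f)"
  by (auto simp: hom_def Arr_WHDTS)

lemma whdts_arr_eqI:
  fixes f g :: "('s, 'l, 'x) whdts_arr"
  assumes "src f = src g" "tgt f = tgt g" "on_states f = on_states g" "on_actions f = on_actions g"
  shows "f = g"
  using assms by (cases f, cases g) simp

lemma WHDTS_transitions_on:
  "X \<in> Obj (WHDTS \<Sigma>) \<Longrightarrow> transitions X \<subseteq> transitions_on (states X) (actions X)"
  by (simp add: Obj_WHDTS weak_hdts_iff)

lemma WHDTS_closed: "X \<in> Obj (WHDTS \<Sigma>) \<Longrightarrow> hdts_closed (transitions X)"
  by (simp add: Obj_WHDTS weak_hdts_iff)

lemma WHDTS_label: "X \<in> Obj (WHDTS \<Sigma>) \<Longrightarrow> label X \<in> actions X \<rightarrow>\<^sub>E \<Sigma>"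
  by (simp add: Obj_WHDTS weak_hdts_iff)

lemma whdts_map_ext:
  assumes "whdts_map X Y f0 f1" "whdts_map X Z g0 g1"
    and "\<And>s. s \<in> states X \<Longrightarrow> f0 s = g0 s" "\<And>u. u \<in> actions X \<Longrightarrow> f1 u = g1 u"
  shows "f0 = g0" "f1 = g1"
  using PiE_ext[of f0 "states X" "\<lambda>_. states Y \<union> states Z" g0]
    PiE_ext[of f1 "actions X" "\<lambda>_. actions Y \<union> actions Z" g1]
    whdts_mapD(1,2)[OF assms(1)] whdts_mapD(1,2)[OF assms(2)] assms(3,4)
  by (auto simp: PiE_iff)

lemma category_WHDTS: "category (WHDTS \<Sigma> :: ('u, 'x) whdts_cat)"
  unfolding category_def
proof (intro conjI ballI impI)
  fix f :: "('u, 'u, 'x) whdts_arr"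
  assume f: "f \<in> Arr (WHDTS \<Sigma>)"
  then show "Dom (WHDTS \<Sigma>) f \<in> Obj (WHDTS \<Sigma>)" "Cod (WHDTS \<Sigma>) f \<in> Obj (WHDTS \<Sigma>)"
    by (simp_all add: Arr_WHDTS)
  have "on_states f \<in> states (src f) \<rightarrow>\<^sub>E states (tgt f)"
      "on_actions f \<in> actions (src f) \<rightarrow>\<^sub>E actions (tgt f)"
    using f by (simp_all add: Arr_WHDTS whdts_map_iff)
  then show "Comp (WHDTS \<Sigma>) f (Ident (WHDTS \<Sigma>) (Dom (WHDTS \<Sigma>) f)) = f"
    "Comp (WHDTS \<Sigma>) (Ident (WHDTS \<Sigma>) (Cod (WHDTS \<Sigma>) f)) f = f"
    by (auto intro!: whdts_arr_eqI simp: PiE_def Pi_iff compose_Id Id_compose)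
  fix g
  assume g: "g \<in> Arr (WHDTS \<Sigma>)" and fg: "Cod (WHDTS \<Sigma>) f = Dom (WHDTS \<Sigma>) g"
  then show "Comp (WHDTS \<Sigma>) g f \<in> hom (WHDTS \<Sigma>) (Dom (WHDTS \<Sigma>) f) (Cod (WHDTS \<Sigma>) g)"
    using f whdts_map_compose[OF WHDTS_transitions_on, of "src f" \<Sigma> "tgt f" _ _ "tgt g"]
    by (simp add: hom_WHDTS Arr_WHDTS)
  fix h
  assume h: "h \<in> Arr (WHDTS \<Sigma>)" and gh: "Cod (WHDTS \<Sigma>) g = Dom (WHDTS \<Sigma>) h"
  have "on_states f \<in> states (src f) \<rightarrow> states (src g)" "on_actions f \<in> actions (src f) \<rightarrow> actions (src g)"
    using f fg by (auto simp: Arr_WHDTS whdts_map_iff)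
  then show "Comp (WHDTS \<Sigma>) h (Comp (WHDTS \<Sigma>) g f) = Comp (WHDTS \<Sigma>) (Comp (WHDTS \<Sigma>) h g) f"
    by (simp add: compose_assoc)
next
  fix X :: "('u, 'u, 'x) whdts"
  assume "X \<in> Obj (WHDTS \<Sigma>)"
  then show "Ident (WHDTS \<Sigma>) X \<in> hom (WHDTS \<Sigma>) X X"
    using whdts_map_ident[OF WHDTS_transitions_on] by (simp add: hom_WHDTS)
qed

lemma category_full_subcat:
  assumes "category C"
  shows "category (full_subcat C P)"
  using assms unfolding category_def full_subcat_def hom_def by (auto 0 3)

lemma generated_in_WHDTS:
  fixes S L :: "'u set"
  assumes "l ` L \<subseteq> \<Sigma>" "T \<subseteq> transitions_on S L" "small TYPE('u) S" "small TYPE('u) L"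
  shows "generated S L l T \<in> Obj (WHDTS \<Sigma>)"
  using assms weak_hdts_generated by (simp add: Obj_WHDTS)

text \<open>Injective maps cancel pointwise. Conversely, single states and single actions are
  represented by test objects, and cancelling maps out of these gives injectivity.\<close>

lemma monic_WHDTS_iff:
  fixes m :: "('u, 'u, 'x) whdts_arr"
  assumes U: "universe TYPE('u)" and m: "m \<in> Arr (WHDTS \<Sigma>)"
  shows "monic (WHDTS \<Sigma>) m \<longleftrightarrow>
    inj_on (on_states m) (states (src m)) \<and> inj_on (on_actions m) (actions (src m))"
proof (intro iffI conjI inj_onI)
  have M: "src m \<in> Obj (WHDTS \<Sigma>)" "tgt m \<in> Obj (WHDTS \<Sigma>)"
    "whdts_map (src m) (tgt m) (on_states m) (on_actions m)"
    using m by (auto simp: Arr_WHDTS)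
  assume mon: "monic (WHDTS \<Sigma>) m"
  have cancel: "f = g" if "f \<in> hom (WHDTS \<Sigma>) X (src m)" "g \<in> hom (WHDTS \<Sigma>) X (src m)"
    "Comp (WHDTS \<Sigma>) m f = Comp (WHDTS \<Sigma>) m g" for f g X
    using mon that unfolding monic_def hom_def WHDTS_simps mem_Collect_eq by metis
  {
    fix s s'
    assume s: "s \<in> states (src m)" "s' \<in> states (src m)" "on_states m s = on_states m s'"
    \<comment> \<open>One state without actions: maps from it to a system are the states of that
      system.\<close>
    define P :: "('u, 'u, 'x) whdts" where "P = generated {s} {} undefined {}"
    have P: "P \<in> Obj (WHDTS \<Sigma>)"
      unfolding P_def by (rule generated_in_WHDTS) (auto intro: small_finite[OF U])
    define pt where "pt x = \<lparr>src = P, tgt = src m, on_states = (\<lambda>_\<in>{s}. x),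
      on_actions = (\<lambda>_\<in>{}. undefined)\<rparr>" for x
    have pt: "pt x \<in> hom (WHDTS \<Sigma>) P (src m)" if "x \<in> states (src m)" for x
      using P M(1) that unfolding pt_def hom_WHDTS
      by (auto simp: P_def Obj_WHDTS intro!: whdts_map_generated split: if_splits)
    have "pt s = pt s'"
      using s by (intro cancel[OF pt pt]) (auto simp: pt_def P_def compose_def)
    then have "on_states (pt s) s = on_states (pt s') s" by simp
    then show "s = s'" by (simp add: pt_def)
  next
    fix u u'
    assume u: "u \<in> actions (src m)" "u' \<in> actions (src m)" "on_actions m u = on_actions m u'"
    \<comment> \<open>An action may exist without any state. Maps from this system pick out the
      actions with the label of \<open>u\<close>.\<close>
    define P :: "('u, 'u, 'x) whdts" where "P = generated {} {u} (label (src m)) {}"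
    have P: "P \<in> Obj (WHDTS \<Sigma>)"
      unfolding P_def using WHDTS_label[OF M(1)] u
      by (intro generated_in_WHDTS) (auto intro: small_finite[OF U])
    define pt where "pt x = \<lparr>src = P, tgt = src m, on_states = (\<lambda>_\<in>{}. undefined),
      on_actions = (\<lambda>_\<in>{u}. x)\<rparr>" for x
    \<comment> \<open>Since \<open>m\<close> preserves labels, \<open>u'\<close> has the label of
      \<open>u\<close> and is picked out by a map from the same test object.\<close>
    have lab: "label (src m) u = label (src m) u'"
      using whdts_mapD(5)[OF M(3)] u by metis
    have pt: "pt x \<in> hom (WHDTS \<Sigma>) P (src m)" if "x \<in> {u, u'}" for x
      using P M(1) that u(1,2) lab unfolding pt_def hom_WHDTS
      by (auto simp: P_def Obj_WHDTS intro!: whdts_map_generated split: if_splits)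
    have "pt u = pt u'"
      using u by (intro cancel[OF pt pt]) (auto simp: pt_def P_def compose_def)
    then have "on_actions (pt u) u = on_actions (pt u') u" by simp
    then show "u = u'" by (simp add: pt_def)
  }
next
  assume inj: "inj_on (on_states m) (states (src m)) \<and> inj_on (on_actions m) (actions (src m))"
  have "f = g" if f: "f \<in> Arr (WHDTS \<Sigma>)" "g \<in> Arr (WHDTS \<Sigma>)" "src f = src g"
    "tgt f = src m" "tgt g = src m" "Comp (WHDTS \<Sigma>) m f = Comp (WHDTS \<Sigma>) m g" for f g
  proof -
    have maps: "whdts_map (src f) (src m) (on_states f) (on_actions f)"
      "whdts_map (src f) (src m) (on_states g) (on_actions g)"
      using f by (auto simp: Arr_WHDTS)
    have c: "compose (states (src f)) (on_states m) (on_states f) s =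
        compose (states (src f)) (on_states m) (on_states g) s"
      "compose (actions (src f)) (on_actions m) (on_actions f) s =
        compose (actions (src f)) (on_actions m) (on_actions g) s" for s
      using f(3,6) by auto
    have "on_states f s = on_states g s" if "s \<in> states (src f)" for s
      using c(1)[of s] inj whdts_mapD(3)[OF maps(1) that] whdts_mapD(3)[OF maps(2) that] that
      by (auto simp: compose_eq dest: inj_onD)
    moreover have "on_actions f s = on_actions g s" if "s \<in> actions (src f)" for s
      using c(2)[of s] inj whdts_mapD(4)[OF maps(1) that] whdts_mapD(4)[OF maps(2) that] that
      by (auto simp: compose_eq dest: inj_onD)
    ultimately show "f = g"
      using f whdts_map_ext[OF maps] by (intro whdts_arr_eqI) auto
  qed
  then show "monic (WHDTS \<Sigma>) m" using m by (simp add: monic_def)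
qed

section \<open>Subobjects spanned by given carriers and transitions\<close>

definition incl :: "('s, 'l, 'x) whdts \<Rightarrow> ('s, 'l, 'x) whdts \<Rightarrow> ('s, 'l, 'x) whdts_arr" where
  "incl Y X = \<lparr>src = Y, tgt = X, on_states = (\<lambda>s\<in>states Y. s), on_actions = (\<lambda>u\<in>actions Y. u)\<rparr>"

lemma incl_simps [simp]:
  "src (incl Y X) = Y" "tgt (incl Y X) = X"
  "on_states (incl Y X) = (\<lambda>s\<in>states Y. s)" "on_actions (incl Y X) = (\<lambda>u\<in>actions Y. u)"
  by (simp_all add: incl_def)

lemma whdts_map_generated_incl:
  assumes X: "X \<in> Obj (WHDTS \<Sigma>)" and "S \<subseteq> states X" "L \<subseteq> actions X"
    and "T \<subseteq> transitions X" "T \<subseteq> transitions_on S L"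
  shows "whdts_map (generated S L (label X) T) X (\<lambda>s\<in>S. s) (\<lambda>u\<in>L. u)"
proof (rule whdts_map_generated[of \<Sigma>])
  have "tmap (\<lambda>s\<in>S. s) (\<lambda>u\<in>L. u) t = t" if "t \<in> T" for t
    using assms(5) that by (intro tmap_ident) auto
  then show "tmap (\<lambda>s\<in>S. s) (\<lambda>u\<in>L. u) ` T \<subseteq> transitions X" using assms(4) by auto
qed (use assms in \<open>auto simp: Obj_WHDTS\<close>)

lemma generated_sub_in_WHDTS:
  assumes X: "X \<in> Obj (WHDTS \<Sigma>)" and "S \<subseteq> states X" "L \<subseteq> actions X" "T \<subseteq> transitions_on S L"
  shows "generated S L (label X) T \<in> Obj (WHDTS \<Sigma>)"
  using assms WHDTS_label[OF X]
  by (intro generated_in_WHDTS) (auto simp: Obj_WHDTS intro: small_mono)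

lemma incl_generated_subobject:
  fixes X :: "('u, 'u, 'x) whdts"
  assumes U: "universe TYPE('u)" and X: "X \<in> Obj (WHDTS \<Sigma>)" and "S \<subseteq> states X" "L \<subseteq> actions X"
    and "T \<subseteq> transitions X" "T \<subseteq> transitions_on S L"
  shows "incl (generated S L (label X) T) X \<in> subobjects (WHDTS \<Sigma>) X"
proof -
  have "incl (generated S L (label X) T) X \<in> Arr (WHDTS \<Sigma>)"
    using whdts_map_generated_incl[OF assms(2-)] generated_sub_in_WHDTS[OF assms(2-4,6)] X
    by (simp add: Arr_WHDTS)
  then show ?thesis
    using monic_WHDTS_iff[OF U, of "incl (generated S L (label X) T) X"]
    by (simp add: subobjects_def inj_on_def)
qed


section \<open>Cubical transition systems as the systems generated by their cubes\<close>

definition cube_map ::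
  "'x set \<Rightarrow> ('s, 'l, 'x) whdts \<Rightarrow> 'x list \<Rightarrow> (bool list \<Rightarrow> 's) \<Rightarrow> ('x \<times> nat \<Rightarrow> 'l) \<Rightarrow> bool" where
  "cube_map \<Sigma> X xs f0 f1 \<longleftrightarrow> set xs \<subseteq> \<Sigma> \<and> whdts_map (cube xs) X f0 f1"

definition cube_acts :: "'x set \<Rightarrow> ('s, 'l, 'x) whdts \<Rightarrow> 'l set" where
  "cube_acts \<Sigma> X = {f1 u | xs f0 f1 u. cube_map \<Sigma> X xs f0 f1 \<and> u \<in> actions (cube xs)}"

definition cube_trans :: "'x set \<Rightarrow> ('s, 'l, 'x) whdts \<Rightarrow> ('s, 'l) trans set" where
  "cube_trans \<Sigma> X = {tmap f0 f1 t | xs f0 f1 t. cube_map \<Sigma> X xs f0 f1 \<and> t \<in> transitions (cube xs)}"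

text \<open>States carry no condition because each of them is the image of a 0-cube. Unlike
  \<open>cubical\<close>, this makes sense for carriers of any type, in particular for the cubes
  themselves.\<close>

definition cube_generated :: "'x set \<Rightarrow> ('s, 'l, 'x) whdts \<Rightarrow> bool" where
  "cube_generated \<Sigma> X \<longleftrightarrow>
     actions X \<subseteq> cube_acts \<Sigma> X \<and> transitions X \<subseteq> hdts_closed hull cube_trans \<Sigma> X"

definition core :: "'x set \<Rightarrow> ('s, 'l, 'x) whdts \<Rightarrow> ('s, 'l, 'x) whdts" where
  "core \<Sigma> X = generated (states X) (cube_acts \<Sigma> X) (label X) (cube_trans \<Sigma> X)"

lemma core_simps [simp]:
  "states (core \<Sigma> X) = states X" "actions (core \<Sigma> X) = cube_acts \<Sigma> X"
  "label (core \<Sigma> X) = restrict (label X) (cube_acts \<Sigma> X)"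
  "transitions (core \<Sigma> X) = hdts_closed hull cube_trans \<Sigma> X"
  by (simp_all add: core_def)

lemma cube_simps:
  "states (cube xs) = {e. length e = length xs}"
  "actions (cube xs) = {(xs ! i, Suc i) | i. i < length xs}"
  by (simp_all add: cube_def Let_def)

lemma cube_transitions_on: "transitions (cube xs) \<subseteq>
    transitions_on (states (cube xs)) (actions (cube xs))"
  by (auto simp: cube_def Let_def transitions_on_def)

lemma cube_acts_subset: "cube_acts \<Sigma> X \<subseteq> actions X"
  by (auto simp: cube_acts_def cube_map_def dest: whdts_mapD(4))

lemma cube_trans_subset: "cube_trans \<Sigma> X \<subseteq> transitions X"
  by (auto simp: cube_trans_def cube_map_def dest: whdts_mapD(6))

lemma cube_trans_on: "cube_trans \<Sigma> X \<subseteq> transitions_on (states X) (cube_acts \<Sigma> X)"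
proof
  fix t assume "t \<in> cube_trans \<Sigma> X"
  then obtain xs f0 f1 t' where t: "cube_map \<Sigma> X xs f0 f1" "t' \<in> transitions (cube xs)"
      "t = tmap f0 f1 t'"
    unfolding cube_trans_def by blast
  have "f1 ` actions (cube xs) \<subseteq> cube_acts \<Sigma> X" using t(1) unfolding cube_acts_def by blast
  moreover have "f0 ` states (cube xs) \<subseteq> states X"
    using t(1) by (auto simp: cube_map_def dest: whdts_mapD(3))
  ultimately show "t \<in> transitions_on (states X) (cube_acts \<Sigma> X)"
    using tmap_in_transitions_on[OF subsetD[OF cube_transitions_on t(2)]] by (simp add: t(3))
qed

lemma cube_map_compose:
  assumes "cube_map \<Sigma> X xs f0 f1" "whdts_map X Y g0 g1"
  shows "cube_map \<Sigma> Y xs (compose (states (cube xs)) g0 f0) (compose (actions (cube xs)) g1 f1)"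
  using assms(1) whdts_map_compose[OF cube_transitions_on _ assms(2)] by (simp add: cube_map_def)

lemma cube_acts_image:
  assumes "whdts_map X Y g0 g1"
  shows "g1 ` cube_acts \<Sigma> X \<subseteq> cube_acts \<Sigma> Y"
proof (rule image_subsetI)
  fix v assume "v \<in> cube_acts \<Sigma> X"
  then obtain xs f0 f1 u where u: "cube_map \<Sigma> X xs f0 f1" "u \<in> actions (cube xs)" "v = f1 u"
    unfolding cube_acts_def by blast
  then have "g1 v = compose (actions (cube xs)) g1 f1 u" by (simp add: compose_eq)
  then show "g1 v \<in> cube_acts \<Sigma> Y"
    using cube_map_compose[OF u(1) assms] u(2) unfolding cube_acts_def by blast
qed

lemma cube_trans_image:
  assumes "whdts_map X Y g0 g1"
  shows "tmap g0 g1 ` cube_trans \<Sigma> X \<subseteq> cube_trans \<Sigma> Y"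
proof (rule image_subsetI)
  fix v assume "v \<in> cube_trans \<Sigma> X"
  then obtain xs f0 f1 t where t: "cube_map \<Sigma> X xs f0 f1" "t \<in> transitions (cube xs)" "v = tmap f0 f1 t"
    unfolding cube_trans_def by blast
  then have "tmap g0 g1 v =
      tmap (compose (states (cube xs)) g0 f0) (compose (actions (cube xs)) g1 f1) t"
    unfolding t(3) tmap_tmap using subsetD[OF cube_transitions_on t(2)]
    by (intro tmap_cong) (auto simp: compose_eq)
  then show "tmap g0 g1 v \<in> cube_trans \<Sigma> Y"
    using cube_map_compose[OF t(1) assms] t(2) unfolding cube_trans_def by blast
qed

lemma core_trans_image:
  assumes "whdts_map X Y g0 g1"
  shows "tmap g0 g1 ` (hdts_closed hull cube_trans \<Sigma> X) \<subseteq> hdts_closed hull cube_trans \<Sigma> Y"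
  by (rule hull_tmap) (meson cube_trans_image[OF assms] hull_subset order_trans)

text \<open>Maps carry cubes to cubes, so a system generated by its cubes is sent into what the core
  keeps. This is the universal property of the core.\<close>

lemma whdts_map_into_core:
  assumes "cube_generated \<Sigma> Z" and "whdts_map Z X f0 f1"
  shows "whdts_map Z (core \<Sigma> X) f0 f1"
proof -
  have "f1 u \<in> cube_acts \<Sigma> X" if "u \<in> actions Z" for u
    using assms(1) cube_acts_image[OF assms(2), of \<Sigma>] that unfolding cube_generated_def by blast
  moreover have "tmap f0 f1 ` transitions Z \<subseteq> hdts_closed hull cube_trans \<Sigma> X"
    using order_trans[OF image_mono core_trans_image[OF assms(2)]] assms(1)
    unfolding cube_generated_def by simp
  ultimately show ?thesis
    using assms(2) unfolding whdts_map_iff by (auto simp: PiE_iff)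
qed

lemma cube_generated_cube:
  assumes "set xs \<subseteq> \<Sigma>"
  shows "cube_generated \<Sigma> (cube xs)"
proof -
  let ?i = "\<lambda>e\<in>states (cube xs). e" and ?j = "\<lambda>u\<in>actions (cube xs). u"
  have m: "cube_map \<Sigma> (cube xs) xs ?i ?j"
    using assms whdts_map_ident[OF cube_transitions_on] by (simp add: cube_map_def)
  have "u \<in> cube_acts \<Sigma> (cube xs)" if "u \<in> actions (cube xs)" for u
  proof -
    have "u = ?j u" using that by simp
    then show ?thesis using m that unfolding cube_acts_def by blast
  qed
  moreover have "t \<in> cube_trans \<Sigma> (cube xs)" if "t \<in> transitions (cube xs)" for t
  proof -
    have "t = tmap ?i ?j t"
      using subsetD[OF cube_transitions_on that] by (intro tmap_ident[symmetric]) auto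
    then show ?thesis using m that unfolding cube_trans_def by blast
  qed
  ultimately show ?thesis unfolding cube_generated_def by (meson hull_inc subsetI)
qed

text \<open>Cubes of a covering system become cubes of \<open>X\<close>, so generation by cubes
  passes along joint covers; for transitions it is enough to cover generators. The covering systems
  have free types, because a cube does not live on the type of \<open>X\<close>. Cores, colimits,
  unions and renamed copies are all handled through this criterion.\<close>

lemma cube_generated_if_covered:
  assumes act: "\<And>u. u \<in> actions X \<Longrightarrow>
      \<exists>(Z :: ('a, 'b, 'x) whdts) f0 f1. whdts_map Z X f0 f1 \<and> cube_generated \<Sigma> Z \<and> u \<in> f1 ` actions Z"
    and tr: "transitions X \<subseteq> hdts_closed hull T"
    and cov: "\<And>t. t \<in> T \<Longrightarrow>
      \<exists>(Z :: ('c, 'd, 'x) whdts) f0 f1. whdts_map Z X f0 f1 \<and> cube_generated \<Sigma> Z \<and>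
          t \<in> tmap f0 f1 ` transitions Z"
  shows "cube_generated \<Sigma> X"
proof -
  have "actions X \<subseteq> cube_acts \<Sigma> X"
  proof
    fix u assume "u \<in> actions X"
    then obtain Z :: "('a, 'b, 'x) whdts" and f0 f1
      where "whdts_map Z X f0 f1" "cube_generated \<Sigma> Z" "u \<in> f1 ` actions Z"
      using act by blast
    then show "u \<in> cube_acts \<Sigma> X"
      using cube_acts_image[of Z X f0 f1 \<Sigma>] unfolding cube_generated_def by auto
  qed
  moreover have "T \<subseteq> hdts_closed hull cube_trans \<Sigma> X"
  proof
    fix t assume "t \<in> T"
    then obtain Z :: "('c, 'd, 'x) whdts" and f0 f1
      where "whdts_map Z X f0 f1" "cube_generated \<Sigma> Z" "t \<in> tmap f0 f1 ` transitions Z"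
      using cov by blast
    then show "t \<in> hdts_closed hull cube_trans \<Sigma> X"
      using order_trans[OF image_mono core_trans_image, of "transitions Z" \<Sigma> Z X f0 f1]
      by (auto simp only: cube_generated_def subset_iff)
  qed
  then have "hdts_closed hull T \<subseteq> hdts_closed hull cube_trans \<Sigma> X"
    using hull_minimal hdts_closed_hull by metis
  ultimately show ?thesis using tr unfolding cube_generated_def by (simp add: subset_trans)
qed

lemma core_in_WHDTS: "X \<in> Obj (WHDTS \<Sigma>) \<Longrightarrow> core \<Sigma> X \<in> Obj (WHDTS \<Sigma>)"
  unfolding core_def
  by (rule generated_sub_in_WHDTS) (simp_all add: cube_acts_subset cube_trans_on)

text \<open>Every cube of \<open>X\<close> factors through the core, so no cube is lost and the core
  is covered by the cubes of \<open>X\<close>.\<close>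

lemma cube_generated_core:
  fixes X :: "('u, 'u, 'x) whdts"
  assumes "X \<in> Obj (WHDTS \<Sigma>)"
  shows "cube_generated \<Sigma> (core \<Sigma> X)"
proof -
  have map: "whdts_map (cube xs) (core \<Sigma> X) f0 f1" if "cube_map \<Sigma> X xs f0 f1" for xs f0 f1
    using that whdts_map_into_core cube_generated_cube unfolding cube_map_def by blast
  show ?thesis
  proof (rule cube_generated_if_covered[where T = "cube_trans \<Sigma> X"])
    fix u assume "u \<in> actions (core \<Sigma> X)"
    then obtain xs f0 f1 u' where "cube_map \<Sigma> X xs f0 f1" "u' \<in> actions (cube xs)" "u = f1 u'"
      unfolding core_simps cube_acts_def by blast
    then show "\<exists>(Z :: (bool list, 'x \<times> nat, 'x) whdts) f0 f1.
        whdts_map Z (core \<Sigma> X) f0 f1 \<and> cube_generated \<Sigma> Z \<and> u \<in> f1 ` actions Z"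
      using map cube_generated_cube
      by (intro exI[of _ "cube xs"] exI[of _ f0] exI[of _ f1]) (auto simp: cube_map_def)
  next
    fix t assume "t \<in> cube_trans \<Sigma> X"
    then obtain xs f0 f1 t' where "cube_map \<Sigma> X xs f0 f1" "t' \<in> transitions (cube xs)"
        "t = tmap f0 f1 t'"
      unfolding cube_trans_def by blast
    then show "\<exists>(Z :: (bool list, 'x \<times> nat, 'x) whdts) f0 f1.
        whdts_map Z (core \<Sigma> X) f0 f1 \<and> cube_generated \<Sigma> Z \<and> t \<in> tmap f0 f1 ` transitions Z"
      using map[of xs f0 f1] cube_generated_cube[of xs \<Sigma>]
      by (intro exI[of _ "cube xs"] exI[of _ f0] exI[of _ f1]) (simp add: cube_map_def)
  qed simp
qed

section \<open>Images, and the agreement of the two descriptions of cubical systems\<close>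

text \<open>The plain image of the transitions need not satisfy the axioms, so the candidate carries
  its closure. It is least: a subobject through which the map factors is injective, hence has a
  partial inverse on the image, and its closed transition set absorbs the closure.\<close>

lemma ex_image:
  fixes X :: "('u, 'u, 'x) whdts"
  assumes U: "universe TYPE('u)" and X: "X \<in> Obj (WHDTS \<Sigma>)"
    and Q: "transitions Q \<subseteq> transitions_on (states Q) (actions Q)" and f: "whdts_map Q X f0 f1"
  shows "\<exists>m. is_image \<Sigma> Q X f0 f1 m"
proof -
  define S L T where "S = f0 ` states Q" and "L = f1 ` actions Q" and "T = tmap f0 f1 ` transitions Q"
  define Y where "Y = generated S L (label X) T"
  have S: "S \<subseteq> states X" and L: "L \<subseteq> actions X" and T: "T \<subseteq> transitions X"
    unfolding S_def L_def T_def using whdts_mapD(3,4,6)[OF f] by auto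
  have TSL: "T \<subseteq> transitions_on S L"
    unfolding T_def S_def L_def by (rule image_subsetI,
        rule tmap_in_transitions_on[OF subsetD[OF Q]]) simp_all
  have Y: "Y \<in> Obj (WHDTS \<Sigma>)" unfolding Y_def by (rule generated_sub_in_WHDTS[OF X S L TSL])
  have "tmap f0 f1 ` transitions Q \<subseteq> hdts_closed hull T"
    unfolding T_def by (rule hull_subset)
  then have "whdts_map Q Y f0 f1"
    using f unfolding whdts_map_iff Y_def by (auto simp: PiE_iff S_def L_def)
  moreover have "f0 = compose (states Q) (\<lambda>s\<in>S. s) f0" "f1 = compose (actions Q) (\<lambda>s\<in>L. s) f1"
    using Id_compose[of f0 "states Q" S] Id_compose[of f1 "actions Q" L] whdts_mapD(1,2)[OF f]
    by (auto simp: S_def L_def PiE_def)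
  ultimately have "factors_through Q f0 f1 (incl Y X)"
    unfolding factors_through_def by (auto simp: Y_def)
  moreover have "sub_le (WHDTS \<Sigma>) (incl Y X) m"
    if m: "m \<in> subobjects (WHDTS \<Sigma>) X" and fac: "factors_through Q f0 f1 m" for m
  proof -
    obtain g0 g1 where g: "whdts_map Q (src m) g0 g1" "f0 = compose (states Q) (on_states m) g0"
      "f1 = compose (actions Q) (on_actions m) g1"
      using fac unfolding factors_through_def by blast
    have m': "m \<in> Arr (WHDTS \<Sigma>)" "tgt m = X" using m by (simp_all add: subobjects_def monic_def)
    then have inj: "inj_on (on_states m) (states (src m))" "inj_on (on_actions m) (actions (src m))"
      using monic_WHDTS_iff[OF U m'(1)] m by (simp_all add: subobjects_def)
    have W: "src m \<in> Obj (WHDTS \<Sigma>)" "whdts_map (src m) X (on_states m) (on_actions m)"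
      using m' by (auto simp: Arr_WHDTS)
    \<comment> \<open>Partial inverse of the monomorphism \<open>m\<close> on the image carriers. As
      \<open>f0\<close> is \<open>on_states m\<close> after \<open>g0\<close>, it sends
      \<open>f0 e\<close> to \<open>g0 e\<close>; likewise for actions.\<close>
    define k0 where "k0 = (\<lambda>s\<in>S. inv_into (states (src m)) (on_states m) s)"
    define k1 where "k1 = (\<lambda>u\<in>L. inv_into (actions (src m)) (on_actions m) u)"
    have k0: "k0 (f0 e) = g0 e" if "e \<in> states Q" for e
      using that inj(1) whdts_mapD(3)[OF g(1) that]
      by (simp add: k0_def S_def) (simp add: g(2) compose_eq)
    have k1: "k1 (f1 e) = g1 e" if "e \<in> actions Q" for e
      using that inj(2) whdts_mapD(4)[OF g(1) that]
      by (simp add: k1_def L_def) (simp add: g(3) compose_eq)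
    have mk0: "on_states m (k0 s) = s" "k0 s \<in> states (src m)" if s: "s \<in> S" for s
    proof -
      obtain e where "e \<in> states Q" "s = f0 e" using s unfolding S_def by blast
      then show "on_states m (k0 s) = s" "k0 s \<in> states (src m)"
        using k0[of e] whdts_mapD(3)[OF g(1)] by (simp_all add: g(2) compose_eq)
    qed
    have mk1: "on_actions m (k1 s) = s" "k1 s \<in> actions (src m)" if s: "s \<in> L" for s
    proof -
      obtain e where "e \<in> actions Q" "s = f1 e" using s unfolding L_def by blast
      then show "on_actions m (k1 s) = s" "k1 s \<in> actions (src m)"
        using k1[of e] whdts_mapD(4)[OF g(1)] by (simp_all add: g(3) compose_eq)
    qed
    have "whdts_map Y (src m) k0 k1"
      unfolding Y_def
    proof (rule whdts_map_generated[of \<Sigma>])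
      show "weak_hdts \<Sigma> (src m)" using W by (simp add: Obj_WHDTS)
      show "k0 \<in> S \<rightarrow>\<^sub>E states (src m)" "k1 \<in> L \<rightarrow>\<^sub>E actions (src m)"
        using mk0(2) mk1(2) by (auto simp: k0_def k1_def)
      show "label (src m) (k1 u) = label X u" if "u \<in> L" for u
        using mk1[OF that] whdts_mapD(5)[OF W(2), of "k1 u"] by simp
      have "tmap k0 k1 (tmap f0 f1 t) = tmap g0 g1 t" if "t \<in> transitions Q" for t
        unfolding tmap_tmap using subsetD[OF Q that] k0 k1 by (intro tmap_cong) auto
      then show "tmap k0 k1 ` T \<subseteq> transitions (src m)"
        unfolding T_def using whdts_mapD(6)[OF g(1)] by (simp add: image_subset_iff)
    qed
    moreover have "Comp (WHDTS \<Sigma>) m \<lparr>src = Y, tgt = src m, on_states = k0, on_actions = k1\<rparr> = incl Y X"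
      using mk0(1) mk1(1) m'(2) by (auto simp: Y_def incl_def compose_def restrict_def fun_eq_iff)
    ultimately show ?thesis
      unfolding sub_le_def using Y W(1)
      by (intro bexI[of _ "\<lparr>src = Y, tgt = src m, on_states = k0, on_actions = k1\<rparr>"])
        (simp_all add: hom_WHDTS)
  qed
  ultimately show ?thesis
    using incl_generated_subobject[OF U X S L T TSL] unfolding is_image_def Y_def by blast
qed

text \<open>The inclusion of the core is a subobject through which every cube factors, hence an
  upper bound of the subcubes. Being cubical puts the identity below it, so the core exhausts
  \<open>X\<close>.\<close>

lemma cubical_imp_cube_generated:
  fixes X :: "('u, 'u, 'x) whdts"
  assumes U: "universe TYPE('u)" and X: "X \<in> Obj (WHDTS \<Sigma>)" and cub: "cubical \<Sigma> X"
  shows "cube_generated \<Sigma> X"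
proof -
  let ?w = "incl (core \<Sigma> X) X"
  have w: "?w \<in> subobjects (WHDTS \<Sigma>) X"
    unfolding core_def
    by (rule incl_generated_subobject[OF U X])
      (simp_all add: cube_acts_subset cube_trans_on cube_trans_subset)
  have "sub_le (WHDTS \<Sigma>) m ?w" if m: "m \<in> subcubes \<Sigma> X" for m
  proof -
    obtain xs f0 f1 where f: "set xs \<subseteq> \<Sigma>" "whdts_map (cube xs) X f0 f1"
      "is_image \<Sigma> (cube xs) X f0 f1 m"
      using m unfolding subcubes_def by blast
    have g: "whdts_map (cube xs) (core \<Sigma> X) f0 f1"
      using whdts_map_into_core[OF cube_generated_cube[OF f(1)] f(2)] .
    have "factors_through (cube xs) f0 f1 ?w"
      unfolding factors_through_def
      using g Id_compose[of f0 "states (cube xs)" "states X"] whdts_mapD(1,2)[OF g]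
        Id_compose[of f1 "actions (cube xs)" "cube_acts \<Sigma> X"]
      by (intro exI[of _ f0] exI[of _ f1]) (auto simp: PiE_def)
    then show ?thesis using f(3) w unfolding is_image_def by blast
  qed
  then have "sub_le (WHDTS \<Sigma>) (Ident (WHDTS \<Sigma>) X) ?w"
    using cub w unfolding cubical_def is_sub_union_def by blast
  then obtain k where k: "k \<in> hom (WHDTS \<Sigma>) X (core \<Sigma> X)"
    "Comp (WHDTS \<Sigma>) ?w k = Ident (WHDTS \<Sigma>) X"
    unfolding sub_le_def by auto
  have map: "whdts_map X (core \<Sigma> X) (on_states k) (on_actions k)" and src: "src k = X"
    using k(1) by (simp_all add: hom_WHDTS)
  have c: "compose (states X) (\<lambda>s\<in>states X. s) (on_states k) s = (\<lambda>s\<in>states X. s) s"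
    "compose (actions X) (\<lambda>s\<in>cube_acts \<Sigma> X. s) (on_actions k) u = (\<lambda>s\<in>actions X. s) u" for s u
    using k(2) src by simp_all
  \<comment> \<open>The factorization of the identity through an inclusion acts as the identity, so
    the actions and transitions of \<open>X\<close> already lie in the core.\<close>
  have k0: "on_states k s = s" if "s \<in> states X" for s
    using c(1)[of s] that whdts_mapD(3)[OF map that] by (simp add: compose_eq)
  have k1: "on_actions k u = u" "u \<in> cube_acts \<Sigma> X" if "u \<in> actions X" for u
    using c(2)[of u] that whdts_mapD(4)[OF map that] by (simp_all add: compose_eq)
  have "t \<in> hdts_closed hull cube_trans \<Sigma> X" if "t \<in> transitions X" for t
    using whdts_mapD(6)[OF map that] k0 k1
      tmap_ident[OF subsetD[OF WHDTS_transitions_on[OF X] that], of "on_states k" "on_actions k"]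
    by simp
  then show ?thesis using k1(2) by (auto simp: cube_generated_def)
qed

text \<open>The 0-cube has one state, no action and no transition, so its maps to \<open>X\<close>
  are the states of \<open>X\<close>. This is why the subcubes reach every state.\<close>

lemma cube_Nil_map:
  assumes "s \<in> states X"
  shows "cube_map \<Sigma> X [] (\<lambda>_\<in>{[]}. s) (\<lambda>_\<in>{}. undefined)"
  using assms unfolding cube_map_def whdts_map_iff
  by (auto simp: cube_def Let_def split: if_splits)

text \<open>A subobject \<open>w\<close> above all subcubes is injective and hits every state and
  action. Its inverse respects transitions because it sends the generating cube transitions into the
  closed transition set of the source of \<open>w\<close>.\<close>

lemma cube_generated_imp_cubical:
  fixes X :: "('u, 'u, 'x) whdts"
  assumes U: "universe TYPE('u)" and X: "X \<in> Obj (WHDTS \<Sigma>)" and gen: "cube_generated \<Sigma> X"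
  shows "cubical \<Sigma> X"
  unfolding cubical_def is_sub_union_def
proof (intro conjI ballI impI)
  have "Ident (WHDTS \<Sigma>) X \<in> Arr (WHDTS \<Sigma>)"
    using category_WHDTS X unfolding category_def hom_def by blast
  then show id: "Ident (WHDTS \<Sigma>) X \<in> subobjects (WHDTS \<Sigma>) X"
    using monic_WHDTS_iff[OF U, of "Ident (WHDTS \<Sigma>) X"] by (simp add: subobjects_def inj_on_def)
  fix m assume "m \<in> subcubes \<Sigma> X"
  then have m: "m \<in> Arr (WHDTS \<Sigma>)" "tgt m = X"
    by (auto simp: subcubes_def is_image_def subobjects_def monic_def)
  then have "m \<in> hom (WHDTS \<Sigma>) (src m) X" "Comp (WHDTS \<Sigma>) (Ident (WHDTS \<Sigma>) (Cod (WHDTS \<Sigma>) m)) m = m"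
    using category_WHDTS[of \<Sigma>] unfolding category_def by (auto simp: hom_def)
  then show "sub_le (WHDTS \<Sigma>) m (Ident (WHDTS \<Sigma>) X)"
    unfolding sub_le_def using m(2) by auto
next
  fix w assume w: "w \<in> subobjects (WHDTS \<Sigma>) X" and le: "\<forall>m\<in>subcubes \<Sigma> X. sub_le (WHDTS \<Sigma>) m w"
  have w': "w \<in> Arr (WHDTS \<Sigma>)" "tgt w = X" using w by (simp_all add: subobjects_def monic_def)
  then have W: "src w \<in> Obj (WHDTS \<Sigma>)" "whdts_map (src w) X (on_states w) (on_actions w)"
    by (auto simp: Arr_WHDTS)
  have inj: "inj_on (on_states w) (states (src w))" "inj_on (on_actions w) (actions (src w))"
    using monic_WHDTS_iff[OF U w'(1)] w by (simp_all add: subobjects_def)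
  \<comment> \<open>A cube factors through its image \<open>m\<close>, which lies below
    \<open>w\<close>; composing with the comparison \<open>k\<close> factors the cube through
    \<open>w\<close>.\<close>
  have factor: "\<exists>g0 g1. whdts_map (cube xs) (src w) g0 g1 \<and>
      (\<forall>e\<in>states (cube xs). f0 e = on_states w (g0 e)) \<and>
      (\<forall>e\<in>actions (cube xs). f1 e = on_actions w (g1 e))"
    if f: "cube_map \<Sigma> X xs f0 f1" for xs f0 f1
  proof -
    obtain m where m: "is_image \<Sigma> (cube xs) X f0 f1 m"
      using ex_image[OF U X cube_transitions_on] f unfolding cube_map_def by blast
    then have "m \<in> subcubes \<Sigma> X" using f unfolding subcubes_def cube_map_def by blast
    then obtain k where k: "k \<in> hom (WHDTS \<Sigma>) (src m) (src w)" "Comp (WHDTS \<Sigma>) w k = m"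
      using le unfolding sub_le_def by auto
    obtain g0 g1 where g: "whdts_map (cube xs) (src m) g0 g1"
      "f0 = compose (states (cube xs)) (on_states m) g0"
      "f1 = compose (actions (cube xs)) (on_actions m) g1"
      using m unfolding is_image_def factors_through_def by blast
    have mk: "on_states m = compose (states (src m)) (on_states w) (on_states k)"
      "on_actions m = compose (actions (src m)) (on_actions w) (on_actions k)"
      using k(1) arg_cong[OF k(2), of on_states] arg_cong[OF k(2), of on_actions]
      by (simp_all add: hom_WHDTS)
    have "whdts_map (src m) (src w) (on_states k) (on_actions k)" using k by (simp add: hom_WHDTS)
    from whdts_map_compose[OF cube_transitions_on g(1) this]
    show ?thesis
      using whdts_mapD(3,4)[OF g(1)]
      by (intro exI[of _ "compose (states (cube xs)) (on_states k) g0"]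
          exI[of _ "compose (actions (cube xs)) (on_actions k) g1"])
        (simp add: g(2,3) mk compose_eq)
  qed
  have surj0: "s \<in> on_states w ` states (src w)" if s: "s \<in> states X" for s
    using factor[OF cube_Nil_map[OF s]] by (auto simp: cube_simps dest: whdts_mapD(3))
  have surj1: "u \<in> on_actions w ` actions (src w)" if u: "u \<in> actions X" for u
  proof -
    have "u \<in> cube_acts \<Sigma> X" using u gen unfolding cube_generated_def by blast
    then show ?thesis unfolding cube_acts_def using factor by (force dest: whdts_mapD(4))
  qed
  define k0 where "k0 = (\<lambda>s\<in>states X. inv_into (states (src w)) (on_states w) s)"
  define k1 where "k1 = (\<lambda>u\<in>actions X. inv_into (actions (src w)) (on_actions w) u)"
  have k0: "k0 (on_states w s) = s" if "s \<in> states (src w)" for s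
    using that inj whdts_mapD(3)[OF W(2)] by (simp add: k0_def)
  have k1: "k1 (on_actions w s) = s" if "s \<in> actions (src w)" for s
    using that inj whdts_mapD(4)[OF W(2)] by (simp add: k1_def)
  have wk0: "k0 s \<in> states (src w)" "on_states w (k0 s) = s" if "s \<in> states X" for s
    using surj0[OF that] that by (simp_all add: k0_def inv_into_into f_inv_into_f)
  have wk1: "k1 s \<in> actions (src w)" "on_actions w (k1 s) = s" if "s \<in> actions X" for s
    using surj1[OF that] that by (simp_all add: k1_def inv_into_into f_inv_into_f)
  have "tmap k0 k1 ` cube_trans \<Sigma> X \<subseteq> transitions (src w)"
  proof (rule image_subsetI)
    fix t assume "t \<in> cube_trans \<Sigma> X"
    then obtain xs f0 f1 t' where t: "cube_map \<Sigma> X xs f0 f1" "t' \<in> transitions (cube xs)"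
        "t = tmap f0 f1 t'"
      unfolding cube_trans_def by blast
    obtain g0 g1 where g: "whdts_map (cube xs) (src w) g0 g1"
      "\<And>e. e \<in> states (cube xs) \<Longrightarrow> f0 e = on_states w (g0 e)"
      "\<And>e. e \<in> actions (cube xs) \<Longrightarrow> f1 e = on_actions w (g1 e)"
      using factor[OF t(1)] by blast
    have "tmap k0 k1 t = tmap g0 g1 t'"
      unfolding t(3) tmap_tmap
      by (rule tmap_cong[OF subsetD[OF cube_transitions_on t(2)]])
        (simp_all add: g(2,3) k0 k1 whdts_mapD(3,4)[OF g(1)])
    then show "tmap k0 k1 t \<in> transitions (src w)"
      using whdts_mapD(6)[OF g(1) t(2)] by simp
  qed
  then have "tmap k0 k1 ` (hdts_closed hull cube_trans \<Sigma> X) \<subseteq> transitions (src w)"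
    by (rule hull_tmap_closed) (rule WHDTS_closed[OF W(1)])
  then have "tmap k0 k1 ` transitions X \<subseteq> transitions (src w)"
    using order_trans[OF image_mono] gen unfolding cube_generated_def by blast
  moreover have "label (src w) (k1 u) = label X u" if "u \<in> actions X" for u
    using whdts_mapD(5)[OF W(2) wk1(1)[OF that]] wk1(2)[OF that] by simp
  ultimately have "whdts_map X (src w) k0 k1"
    using wk0(1) wk1(1) unfolding whdts_map_iff by (auto simp: k0_def k1_def)
  moreover have "Comp (WHDTS \<Sigma>) w \<lparr>src = X, tgt = src w, on_states = k0, on_actions = k1\<rparr> =
      Ident (WHDTS \<Sigma>) X"
    using wk0(2) wk1(2) w'(2) by (auto simp: compose_def restrict_def fun_eq_iff)
  ultimately show "sub_le (WHDTS \<Sigma>) (Ident (WHDTS \<Sigma>) X) w"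
    unfolding sub_le_def using X W(1)
    by (intro bexI[of _ "\<lparr>src = X, tgt = src w, on_states = k0, on_actions = k1\<rparr>"])
      (simp_all add: hom_WHDTS)
qed

lemma Obj_CTS:
  fixes X :: "('u, 'u, 'x) whdts"
  assumes "universe TYPE('u)"
  shows "X \<in> Obj (CTS \<Sigma>) \<longleftrightarrow> X \<in> Obj (WHDTS \<Sigma>) \<and> cube_generated \<Sigma> X"
  using cubical_imp_cube_generated[OF assms] cube_generated_imp_cubical[OF assms]
  by (auto simp: CTS_def full_subcat_def)

lemma CTS_simps [simp]:
  "Dom (CTS \<Sigma>) = src" "Cod (CTS \<Sigma>) = tgt"
  "Ident (CTS \<Sigma>) = Ident (WHDTS \<Sigma>)" "Comp (CTS \<Sigma>) = Comp (WHDTS \<Sigma>)"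
  by (simp_all add: CTS_def full_subcat_def)

lemma hom_CTS:
  "f \<in> hom (CTS \<Sigma>) X Y \<longleftrightarrow> X \<in> Obj (CTS \<Sigma>) \<and> Y \<in> Obj (CTS \<Sigma>) \<and> f \<in> hom (WHDTS \<Sigma>) X Y"
  by (auto simp: hom_def CTS_def full_subcat_def)

lemma Arr_CTS:
  "f \<in> Arr (CTS \<Sigma>) \<longleftrightarrow> f \<in> Arr (WHDTS \<Sigma>) \<and> src f \<in> Obj (CTS \<Sigma>) \<and> tgt f \<in> Obj (CTS \<Sigma>)"
  by (auto simp: CTS_def full_subcat_def)

lemma Obj_CTS_WHDTS: "X \<in> Obj (CTS \<Sigma>) \<Longrightarrow> X \<in> Obj (WHDTS \<Sigma>)"
  by (simp add: CTS_def full_subcat_def)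

lemma category_CTS: "category (CTS \<Sigma> :: ('u, 'x) whdts_cat)"
  unfolding CTS_def by (rule category_full_subcat[OF category_WHDTS])

section \<open>The coreflection onto cubical systems\<close>

definition core_arr :: "'x set \<Rightarrow> ('s, 'l, 'x) whdts_arr \<Rightarrow> ('s, 'l, 'x) whdts_arr" where
  "core_arr \<Sigma> f = \<lparr>src = core \<Sigma> (src f), tgt = core \<Sigma> (tgt f), on_states = on_states f,
     on_actions = restrict (on_actions f) (cube_acts \<Sigma> (src f))\<rparr>"

lemma whdts_map_core:
  assumes "whdts_map X Y f0 f1" and "X \<in> Obj (WHDTS \<Sigma>)"
  shows "whdts_map (core \<Sigma> X) (core \<Sigma> Y) f0 (restrict f1 (cube_acts \<Sigma> X))"
proof -
  have "tmap f0 (restrict f1 (cube_acts \<Sigma> X)) t = tmap f0 f1 t"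
    if "t \<in> hdts_closed hull cube_trans \<Sigma> X" for t
    using subsetD[OF hull_transitions_on[OF cube_trans_on] that] by (rule tmap_cong) simp_all
  then have "tmap f0 (restrict f1 (cube_acts \<Sigma> X)) ` transitions (core \<Sigma> X) \<subseteq> transitions (core \<Sigma> Y)"
    using core_trans_image[OF assms(1), of \<Sigma>] by (simp add: image_subset_iff)
  then show ?thesis
    using assms(1) cube_acts_image[OF assms(1), of \<Sigma>] cube_acts_subset[of \<Sigma> X]
    unfolding whdts_map_iff by (auto simp: image_subset_iff)
qed

definition core_functor ::
  "'x set \<Rightarrow> (('u, 'u, 'x) whdts, ('u, 'u, 'x) whdts_arr, ('u, 'u, 'x) whdts, ('u, 'u,
      'x) whdts_arr) cat_functor"
  where "core_functor \<Sigma> = \<lparr>fobj = core \<Sigma>, farr = core_arr \<Sigma>\<rparr>"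

lemma core_in_CTS:
  fixes X :: "('u, 'u, 'x) whdts"
  assumes "universe TYPE('u)" "X \<in> Obj (WHDTS \<Sigma>)"
  shows "core \<Sigma> X \<in> Obj (CTS \<Sigma>)"
  using core_in_WHDTS[OF assms(2)] cube_generated_core[OF assms(2)] by (simp add: Obj_CTS[OF assms(1)])

lemma core_functor_is_functor:
  assumes U: "universe TYPE('u)"
  shows "is_functor (WHDTS \<Sigma> :: ('u, 'x) whdts_cat) (CTS \<Sigma>) (core_functor \<Sigma>)"
  unfolding is_functor_def core_functor_def cat_functor.simps
proof (intro conjI ballI impI)
  fix X :: "('u, 'u, 'x) whdts" assume X: "X \<in> Obj (WHDTS \<Sigma>)"
  then show "core \<Sigma> X \<in> Obj (CTS \<Sigma>)" by (rule core_in_CTS[OF U])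
  have "restrict (\<lambda>u\<in>actions X. u) (cube_acts \<Sigma> X) = (\<lambda>u\<in>cube_acts \<Sigma> X. u)"
    using cube_acts_subset[of \<Sigma> X] by (auto simp: restrict_def fun_eq_iff)
  then show "core_arr \<Sigma> (Ident (WHDTS \<Sigma>) X) = Ident (CTS \<Sigma>) (core \<Sigma> X)"
    by (simp add: core_arr_def)
next
  fix f :: "('u, 'u, 'x) whdts_arr" assume f: "f \<in> Arr (WHDTS \<Sigma>)"
  then show "core_arr \<Sigma> f \<in> hom (CTS \<Sigma>) (core \<Sigma> (Dom (WHDTS \<Sigma>) f)) (core \<Sigma> (Cod (WHDTS \<Sigma>) f))"
    by (simp add: hom_CTS hom_WHDTS Arr_WHDTS core_in_CTS[OF U]
        core_in_WHDTS core_arr_def whdts_map_core)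
  fix g :: "('u, 'u, 'x) whdts_arr"
  assume g: "g \<in> Arr (WHDTS \<Sigma>)" and fg: "Cod (WHDTS \<Sigma>) f = Dom (WHDTS \<Sigma>) g"
  have "on_actions f u \<in> cube_acts \<Sigma> (src g)" if "u \<in> cube_acts \<Sigma> (src f)" for u
    using f fg that cube_acts_image[of "src f" "tgt f" "on_states f" "on_actions f" \<Sigma>]
    by (auto simp: Arr_WHDTS)
  then show "core_arr \<Sigma> (Comp (WHDTS \<Sigma>) g f) = Comp (CTS \<Sigma>) (core_arr \<Sigma> g) (core_arr \<Sigma> f)"
    using cube_acts_subset[of \<Sigma> "src f"] by (auto simp: core_arr_def compose_def restrict_def fun_eq_iff)
qed

lemma inclusion_is_functor: "is_functor (CTS \<Sigma>) (WHDTS \<Sigma>) inclusion"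
  by (auto simp: is_functor_def inclusion_def Arr_CTS Obj_CTS_WHDTS hom_def)

lemma core_right_adjoint:
  assumes U: "universe TYPE('u)"
  shows "right_adjoint (CTS \<Sigma> :: ('u, 'x) whdts_cat) (WHDTS \<Sigma>) inclusion (core_functor \<Sigma>)"
  unfolding right_adjoint_def
proof (intro conjI exI ballI)
  \<comment> \<open>Both hom-sets consist of the same pairs of functions; only the recorded target
    changes.\<close>
  let ?\<phi> = "\<lambda>d c h. h\<lparr>tgt := core \<Sigma> c\<rparr>"
  fix d c :: "('u, 'u, 'x) whdts"
  assume d: "d \<in> Obj (CTS \<Sigma>)" and c: "c \<in> Obj (WHDTS \<Sigma>)"
  have dgen: "cube_generated \<Sigma> d" "d \<in> Obj (WHDTS \<Sigma>)" using d by (simp_all add: Obj_CTS[OF U])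
  \<comment> \<open>The core lies inside \<open>c\<close>: the closed set of transitions of
    \<open>c\<close> contains its cube transitions and hence their hull.\<close>
  have coreD: "whdts_map d c f0 f1" if map: "whdts_map d (core \<Sigma> c) f0 f1" for f0 f1
    using map cube_acts_subset[of \<Sigma> c] hull_minimal[of _ _ hdts_closed,
        OF cube_trans_subset WHDTS_closed[OF c], of \<Sigma>]
      order_trans[of "tmap f0 f1 ` transitions d" _ "transitions c"]
    unfolding whdts_map_iff by (auto simp: PiE_iff subset_iff)
  show "bij_betw (?\<phi> d c) (hom (WHDTS \<Sigma>) (fobj inclusion d) c) (hom (CTS \<Sigma>) d (fobj (core_functor \<Sigma>) c))"
  proof (rule bij_betw_byWitness[where f' = "\<lambda>h. h\<lparr>tgt := c\<rparr>"])
    show "?\<phi> d c ` hom (WHDTS \<Sigma>) (fobj inclusion d) c \<subseteq> hom (CTS \<Sigma>) d (fobj (core_functor \<Sigma>) c)"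
      using whdts_map_into_core[OF dgen(1)]
      by (auto simp: hom_CTS hom_WHDTS inclusion_def core_functor_def d c core_in_CTS[OF U]
          core_in_WHDTS)
    show "(\<lambda>h. h\<lparr>tgt := c\<rparr>) ` hom (CTS \<Sigma>) d (fobj (core_functor \<Sigma>) c) \<subseteq>
        hom (WHDTS \<Sigma>) (fobj inclusion d) c"
      using coreD by (auto simp: hom_CTS hom_WHDTS inclusion_def core_functor_def c)
  qed (auto simp: hom_CTS hom_WHDTS inclusion_def core_functor_def)
  fix d' c' h l k
  assume "d' \<in> Obj (CTS \<Sigma>)" "c' \<in> Obj (WHDTS \<Sigma>)" "h \<in> hom (WHDTS \<Sigma>) (fobj inclusion d) c"
    "l \<in> hom (CTS \<Sigma>) d' d" "k \<in> hom (WHDTS \<Sigma>) c c'"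
  then have h: "src h = d" "tgt h = c" "whdts_map d c (on_states h) (on_actions h)"
    and l: "src l = d'" "tgt l = d" "whdts_map d' d (on_states l) (on_actions l)"
    and k: "src k = c" "tgt k = c'" "whdts_map c c' (on_states k) (on_actions k)"
    by (simp_all add: hom_CTS hom_WHDTS inclusion_def)
  have "on_actions h (on_actions l u) \<in> cube_acts \<Sigma> c" if "u \<in> actions d'" for u
    using whdts_mapD(4)[OF whdts_map_into_core[OF dgen(1) h(3)]] whdts_mapD(4)[OF l(3) that] by simp
  then show "?\<phi> d' c' (Comp (WHDTS \<Sigma>) k (Comp (WHDTS \<Sigma>) h (farr inclusion l))) =
      Comp (CTS \<Sigma>) (farr (core_functor \<Sigma>) k) (Comp (CTS \<Sigma>) (?\<phi> d c h) l)"
    by (auto simp: h l k inclusion_def core_functor_def core_arr_def compose_def fun_eq_iff)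
qed (use inclusion_is_functor core_functor_is_functor[OF U] in auto)

text \<open>The map \<open>f\<close> covers \<open>Y\<close>, because \<open>f\<close> after
  \<open>g\<close> is the identity of \<open>Y\<close>; so generation by cubes passes from
  \<open>X\<close> to \<open>Y\<close>.\<close>

lemma iso_closed_CTS:
  assumes U: "universe TYPE('u)"
  shows "iso_closed (WHDTS \<Sigma> :: ('u, 'x) whdts_cat) (Obj (CTS \<Sigma>))"
  unfolding iso_closed_def isomorphic_def
proof (intro ballI impI)
  fix X Y :: "('u, 'u, 'x) whdts"
  assume X: "X \<in> Obj (CTS \<Sigma>)" and Y: "Y \<in> Obj (WHDTS \<Sigma>)"
    and "\<exists>f\<in>hom (WHDTS \<Sigma>) X Y. \<exists>g\<in>hom (WHDTS \<Sigma>) Y X.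
      Comp (WHDTS \<Sigma>) g f = Ident (WHDTS \<Sigma>) X \<and> Comp (WHDTS \<Sigma>) f g = Ident (WHDTS \<Sigma>) Y"
  then obtain f g where f: "f \<in> hom (WHDTS \<Sigma>) X Y" and g: "g \<in> hom (WHDTS \<Sigma>) Y X"
    and fg: "Comp (WHDTS \<Sigma>) f g = Ident (WHDTS \<Sigma>) Y" by blast
  have fm: "whdts_map X Y (on_states f) (on_actions f)"
      and gm: "whdts_map Y X (on_states g) (on_actions g)"
    and src: "src g = Y"
    using f g by (simp_all add: hom_WHDTS)
  have c: "compose (states Y) (on_states f) (on_states g) s = (\<lambda>s\<in>states Y. s) s"
    "compose (actions Y) (on_actions f) (on_actions g) u = (\<lambda>s\<in>actions Y. s) u" for s u
    using fg src by simp_all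
  have k0: "on_states f (on_states g s) = s" if "s \<in> states Y" for s
    using c(1)[of s] that by (simp add: compose_eq)
  have k1: "on_actions f (on_actions g s) = s" if "s \<in> actions Y" for s
    using c(2)[of s] that by (simp add: compose_eq)
  have gen: "cube_generated \<Sigma> X" using X by (simp add: Obj_CTS[OF U])
  have "cube_generated \<Sigma> Y"
  proof (rule cube_generated_if_covered[where T = "transitions Y"])
    fix u assume u: "u \<in> actions Y"
    have "u \<in> on_actions f ` actions X"
      using k1[OF u] whdts_mapD(4)[OF gm u] by (metis imageI)
    then show "\<exists>(Z :: ('u, 'u, 'x) whdts) f0 f1. whdts_map Z Y f0 f1 \<and> cube_generated \<Sigma> Z \<and>
        u \<in> f1 ` actions Z"
      using fm gen by blast
  next
    fix t assume t: "t \<in> transitions Y"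
    have "tmap (on_states f) (on_actions f) (tmap (on_states g) (on_actions g) t) = t"
      unfolding tmap_tmap using subsetD[OF WHDTS_transitions_on[OF Y] t] k0 k1 by (rule tmap_ident)
    then have "t \<in> tmap (on_states f) (on_actions f) ` transitions X"
      using whdts_mapD(6)[OF gm t] by (metis imageI)
    then show "\<exists>(Z :: ('u, 'u, 'x) whdts) f0 f1.
        whdts_map Z Y f0 f1 \<and> cube_generated \<Sigma> Z \<and> t \<in> tmap f0 f1 ` transitions Z"
      using fm gen by (intro exI conjI)
  qed (rule hull_subset)
  then show "Y \<in> Obj (CTS \<Sigma>)" using Y by (simp add: Obj_CTS[OF U])
qed

lemma coreflective_CTS:
  assumes U: "universe TYPE('u)"
  shows "coreflective_subcategory (CTS \<Sigma> :: ('u, 'x) whdts_cat) (WHDTS \<Sigma>)"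
  unfolding coreflective_subcategory_def
  using category_WHDTS iso_closed_CTS[OF U] core_right_adjoint[OF U] Obj_CTS_WHDTS
  by (auto simp: CTS_def full_subcat_def)

section \<open>Colimits of cubical transition systems\<close>

definition diagram_rel ::
  "('j, 'k) cat \<Rightarrow> ('j \<Rightarrow> 's set) \<Rightarrow> ('k \<Rightarrow> 's \<Rightarrow> 's) \<Rightarrow> (('j \<times> 's) \<times> ('j \<times> 's)) set" where
  "diagram_rel J S F = {((Dom J f, s), (Cod J f, F f s)) | f s. f \<in> Arr J \<and> s \<in> S (Dom J f)}"

text \<open>Zigzags along the arrows of a diagram; their classes form the colimit of sets. The
  closure is reflexive on all pairs, also those outside the diagram, so representatives can be
  chosen without side conditions.\<close>

definition diagram_eq ::
  "('j, 'k) cat \<Rightarrow> ('j \<Rightarrow> 's set) \<Rightarrow> ('k \<Rightarrow> 's \<Rightarrow> 's) \<Rightarrow> (('j \<times> 's) \<times> ('j \<times> 's)) set" where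
  "diagram_eq J S F = (diagram_rel J S F \<union> (diagram_rel J S F)\<inverse>)\<^sup>*"

lemma sym_diagram_eq: "sym (diagram_eq J S F)"
  unfolding diagram_eq_def by (intro sym_rtrancl sym_Un_converse)

lemma trans_diagram_eq: "trans (diagram_eq J S F)"
  unfolding diagram_eq_def by (rule trans_rtrancl)

lemma diagram_eq_step:
  "f \<in> Arr J \<Longrightarrow> s \<in> S (Dom J f) \<Longrightarrow> ((Dom J f, s), (Cod J f, F f s)) \<in> diagram_eq J S F"
  unfolding diagram_eq_def diagram_rel_def by (intro r_into_rtrancl) blast

lemma diagram_eq_cocone:
  assumes "((i, s), (j, s')) \<in> diagram_eq J S F"
    and "\<And>f s. f \<in> Arr J \<Longrightarrow> s \<in> S (Dom J f) \<Longrightarrow> \<kappa> (Cod J f) (F f s) = \<kappa> (Dom J f) s"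
  shows "\<kappa> i s = \<kappa> j s'"
proof -
  have "case_prod \<kappa> p = case_prod \<kappa> q" if "(p, q) \<in> diagram_eq J S F" for p q
    using that unfolding diagram_eq_def
    by (induction rule: rtrancl_induct) (auto simp: diagram_rel_def assms(2))
  from this[OF assms(1)] show ?thesis by simp
qed

text \<open>Naming a class by a representative pair and coding that pair in \<open>'u\<close> keeps
  the colimit of sets on the type of its members. Distinct classes receive distinct names.\<close>

lemma ex_set_colimit:
  fixes J :: "('u, 'k) cat" and S :: "'u \<Rightarrow> 'u set"
  assumes "universe TYPE('u)"
  shows "\<exists>\<iota> :: 'u \<Rightarrow> 'u \<Rightarrow> 'u.
    (\<forall>f\<in>Arr J. \<forall>s\<in>S (Dom J f). \<iota> (Cod J f) (F f s) = \<iota> (Dom J f) s) \<and>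
    (\<forall>i s j s'. \<iota> i s = \<iota> j s' \<longrightarrow> ((i, s), (j, s')) \<in> diagram_eq J S F)"
proof -
  obtain e :: "'u \<times> 'u \<Rightarrow> 'u" where e: "inj e" using universe_pairing[OF assms] .
  define E where "E = diagram_eq J S F"
  \<comment> \<open>Equivalent pairs give \<open>SOME\<close> the same predicate, hence the same
    representative.\<close>
  define rep where "rep p = (SOME q. (p, q) \<in> E)" for p
  have rep: "(p, rep p) \<in> E" for p
    unfolding rep_def by (rule someI[of _ p]) (simp add: E_def diagram_eq_def)
  have st: "sym E" "trans E" unfolding E_def by (rule sym_diagram_eq, rule trans_diagram_eq)
  have "rep p = rep q" if "(p, q) \<in> E" for p q
  proof -
    have "(p, x) \<in> E \<longleftrightarrow> (q, x) \<in> E" for x using that st by (meson symD transD)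
    then show ?thesis unfolding rep_def by simp
  qed
  moreover have "(p, q) \<in> E" if "rep p = rep q" for p q
    using rep[of p] rep[of q] that st by (metis symD transD)
  moreover have "((Dom J f, s), (Cod J f, F f s)) \<in> E" if "f \<in> Arr J" "s \<in> S (Dom J f)" for f s
    unfolding E_def by (rule diagram_eq_step) (fact that)+
  ultimately show ?thesis
    unfolding E_def[symmetric]
    by (intro exI[of _ "\<lambda>j s. e (rep (j, s))"]) (metis injD[OF e])
qed

text \<open>Functions that are constant on the fibres of \<open>\<iota>\<close> descend along it,
  and choice picks the common value. The result is extensional, as components of maps have to
  be.\<close>

lemma ex_descend:
  assumes "C \<subseteq> (\<Union>j\<in>Ob. \<iota> j ` S j)"
    and "\<And>i s j s'. i \<in> Ob \<Longrightarrow> s \<in> S i \<Longrightarrow> j \<in> Ob \<Longrightarrow> s' \<in> S j \<Longrightarrow> \<iota> i s = \<iota> j s' \<Longrightarrow> \<kappa> i s = \<kappa> j s'"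
  shows "\<exists>h. (\<forall>j\<in>Ob. \<forall>s\<in>S j. \<iota> j s \<in> C \<longrightarrow> h (\<iota> j s) = \<kappa> j s) \<and> h \<in> extensional C"
proof -
  define h where "h = (\<lambda>x\<in>C. SOME y. \<exists>j\<in>Ob. \<exists>s\<in>S j. x = \<iota> j s \<and> y = \<kappa> j s)"
  have "h (\<iota> j s) = \<kappa> j s" if j: "j \<in> Ob" "s \<in> S j" "\<iota> j s \<in> C" for j s
  proof -
    have "(SOME y. \<exists>j'\<in>Ob. \<exists>s'\<in>S j'. \<iota> j s = \<iota> j' s' \<and> y = \<kappa> j' s') = \<kappa> j s"
    proof (rule some_equality)
      show "\<exists>j'\<in>Ob. \<exists>s'\<in>S j'. \<iota> j s = \<iota> j' s' \<and> \<kappa> j s = \<kappa> j' s'" using j by blast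
      show "y = \<kappa> j s" if "\<exists>j'\<in>Ob. \<exists>s'\<in>S j'. \<iota> j s = \<iota> j' s' \<and> y = \<kappa> j' s'" for y
        using that assms(2) j by metis
    qed
    then show ?thesis using j by (simp add: h_def)
  qed
  moreover have "h \<in> extensional C" unfolding h_def by simp
  ultimately show ?thesis by blast
qed

lemma compose_eqD: "compose A g f = h \<Longrightarrow> x \<in> A \<Longrightarrow> g (f x) = h x"
  by (auto simp: compose_eq)

locale cts_diagram =
  fixes \<Sigma> :: "'x set" and J :: "('u, 'k) cat"
    and D :: "('u, 'k, ('u, 'u, 'x) whdts, ('u, 'u, 'x) whdts_arr) cat_functor"
  assumes U: "universe TYPE('u)" and J: "category J" and D: "is_functor J (CTS \<Sigma>) D"
begin

abbreviation "S j \<equiv> states (fobj D j)"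
abbreviation "L j \<equiv> actions (fobj D j)"
abbreviation "T j \<equiv> transitions (fobj D j)"
abbreviation "D0 f \<equiv> on_states (farr D f)"
abbreviation "D1 f \<equiv> on_actions (farr D f)"

lemma DomCod: "f \<in> Arr J \<Longrightarrow> Dom J f \<in> Obj J" "f \<in> Arr J \<Longrightarrow> Cod J f \<in> Obj J"
  using J by (simp_all add: category_def)

lemma D_obj: "j \<in> Obj J \<Longrightarrow> fobj D j \<in> Obj (CTS \<Sigma>)"
  using D by (simp add: is_functor_def)

lemma D_obj_WHDTS: "j \<in> Obj J \<Longrightarrow> fobj D j \<in> Obj (WHDTS \<Sigma>)"
  using D_obj Obj_CTS_WHDTS by blast

lemma D_arr:
  assumes "f \<in> Arr J"
  shows "src (farr D f) = fobj D (Dom J f)" "tgt (farr D f) = fobj D (Cod J f)"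
    and "whdts_map (fobj D (Dom J f)) (fobj D (Cod J f)) (D0 f) (D1 f)"
  using D assms by (simp_all add: is_functor_def hom_CTS hom_WHDTS)

text \<open>Extensional maps out of one system are equal once they agree on its carriers, so
  equations between arrows turn into equations between values.\<close>

lemma is_cocone_iff:
  "is_cocone J (CTS \<Sigma>) D c \<iota> \<longleftrightarrow> c \<in> Obj (CTS \<Sigma>) \<and>
     (\<forall>j\<in>Obj J. src (\<iota> j) = fobj D j \<and> tgt (\<iota> j) = c \<and>
        whdts_map (fobj D j) c (on_states (\<iota> j)) (on_actions (\<iota> j))) \<and>
     (\<forall>f\<in>Arr J. (\<forall>s\<in>S (Dom J f). on_states (\<iota> (Cod J f)) (D0 f s) = on_states (\<iota> (Dom J f)) s) \<and>
        (\<forall>u\<in>L (Dom J f). on_actions (\<iota> (Cod J f)) (D1 f u) = on_actions (\<iota> (Dom J f)) u))"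
  (is "_ \<longleftrightarrow> ?c \<and> ?maps \<and> ?compat")
proof -
  have maps: "(\<forall>j\<in>Obj J. \<iota> j \<in> hom (CTS \<Sigma>) (fobj D j) c) \<longleftrightarrow> ?maps" if ?c
    using that D_obj D_obj_WHDTS Obj_CTS_WHDTS[OF that] by (simp add: hom_CTS hom_WHDTS)
  have "Comp (CTS \<Sigma>) (\<iota> (Cod J f)) (farr D f) = \<iota> (Dom J f) \<longleftrightarrow>
      (\<forall>s\<in>S (Dom J f). on_states (\<iota> (Cod J f)) (D0 f s) = on_states (\<iota> (Dom J f)) s) \<and>
      (\<forall>u\<in>L (Dom J f). on_actions (\<iota> (Cod J f)) (D1 f u) = on_actions (\<iota> (Dom J f)) u)"
    (is "?lhs \<longleftrightarrow> ?rhs") if m: ?maps and f: "f \<in> Arr J" for f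
  proof
    assume eq: ?lhs
    have c: "compose (S (Dom J f)) (on_states (\<iota> (Cod J f))) (D0 f) = on_states (\<iota> (Dom J f))"
      "compose (L (Dom J f)) (on_actions (\<iota> (Cod J f))) (D1 f) = on_actions (\<iota> (Dom J f))"
      using arg_cong[OF eq, of on_states] arg_cong[OF eq, of on_actions] D_arr[OF f] by simp_all
    show ?rhs using compose_eqD[OF c(1)] compose_eqD[OF c(2)] by blast
  next
    assume rhs: ?rhs
    have m1: "whdts_map (fobj D (Dom J f)) c (on_states (\<iota> (Dom J f))) (on_actions (\<iota> (Dom J f)))"
      "whdts_map (fobj D (Cod J f)) c (on_states (\<iota> (Cod J f))) (on_actions (\<iota> (Cod J f)))"
      using m f DomCod by auto
    have "whdts_map (fobj D (Dom J f)) c (compose (S (Dom J f)) (on_states (\<iota> (Cod J f))) (D0 f))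
        (compose (L (Dom J f)) (on_actions (\<iota> (Cod J f))) (D1 f))"
      using whdts_map_compose[OF WHDTS_transitions_on[OF D_obj_WHDTS[OF DomCod(1)[OF f]]]
          D_arr(3)[OF f] m1(2)] .
    from whdts_map_ext[OF this m1(1)] rhs show ?lhs
      using m f DomCod D_arr[OF f] by (intro whdts_arr_eqI) (simp_all add: compose_eq)
  qed
  then show ?thesis unfolding is_cocone_def using maps by auto
qed

definition joint_trans :: "('u \<Rightarrow> ('u, 'u, 'x) whdts_arr) \<Rightarrow> ('u, 'u) trans set" where
  "joint_trans \<iota> = (\<Union>j\<in>Obj J. tmap (on_states (\<iota> j)) (on_actions (\<iota> j)) ` T j)"

text \<open>Elementwise description of a colimit: \<open>c\<close> contains nothing beyond what the
  stages contribute, and two elements are identified only where a zigzag forces it. The reverse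
  identifications are part of being a cocone.\<close>

definition concrete_colimit :: "('u, 'u, 'x) whdts \<Rightarrow> ('u \<Rightarrow> ('u, 'u, 'x) whdts_arr) \<Rightarrow> bool" where
  "concrete_colimit c \<iota> \<longleftrightarrow> is_cocone J (CTS \<Sigma>) D c \<iota> \<and>
     states c \<subseteq> (\<Union>j\<in>Obj J. on_states (\<iota> j) ` S j) \<and>
     actions c \<subseteq> (\<Union>j\<in>Obj J. on_actions (\<iota> j) ` L j) \<and>
     transitions c \<subseteq> hdts_closed hull joint_trans \<iota> \<and>
     (\<forall>i\<in>Obj J. \<forall>j\<in>Obj J. \<forall>s\<in>S i. \<forall>s'\<in>S j. on_states (\<iota> i) s = on_states (\<iota> j) s' \<longrightarrow>
        ((i, s), (j, s')) \<in> diagram_eq J S D0) \<and>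
     (\<forall>i\<in>Obj J. \<forall>j\<in>Obj J. \<forall>s\<in>L i. \<forall>s'\<in>L j. on_actions (\<iota> i) s = on_actions (\<iota> j) s' \<longrightarrow>
        ((i, s), (j, s')) \<in> diagram_eq J L D1)"

lemma cocone_compat:
  assumes "is_cocone J (CTS \<Sigma>) D c \<iota>" "f \<in> Arr J"
  shows "s \<in> S (Dom J f) \<Longrightarrow> on_states (\<iota> (Cod J f)) (D0 f s) = on_states (\<iota> (Dom J f)) s"
    and "u \<in> L (Dom J f) \<Longrightarrow> on_actions (\<iota> (Cod J f)) (D1 f u) = on_actions (\<iota> (Dom J f)) u"
  using assms unfolding is_cocone_iff by auto

lemma cocone_map:
  assumes "is_cocone J (CTS \<Sigma>) D c \<iota>" "j \<in> Obj J"
  shows "src (\<iota> j) = fobj D j" "tgt (\<iota> j) = c"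
    and "whdts_map (fobj D j) c (on_states (\<iota> j)) (on_actions (\<iota> j))"
  using assms unfolding is_cocone_iff by auto

lemma cocone_obj: "is_cocone J (CTS \<Sigma>) D c \<iota> \<Longrightarrow> c \<in> Obj (CTS \<Sigma>)"
  unfolding is_cocone_iff by simp

lemma tmap_joint_trans:
  assumes "t \<in> joint_trans \<iota>"
    and "\<And>j s. j \<in> Obj J \<Longrightarrow> s \<in> S j \<Longrightarrow> h0 (on_states (\<iota> j) s) = on_states (\<iota>' j) s"
    and "\<And>j s. j \<in> Obj J \<Longrightarrow> s \<in> L j \<Longrightarrow> h1 (on_actions (\<iota> j) s) = on_actions (\<iota>' j) s"
  shows "tmap h0 h1 t \<in> joint_trans \<iota>'"
proof -
  obtain j t' where j: "j \<in> Obj J" "t' \<in> T j" "t = tmap (on_states (\<iota> j)) (on_actions (\<iota> j)) t'"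
    using assms(1) unfolding joint_trans_def by blast
  have "tmap h0 h1 t = tmap (on_states (\<iota>' j)) (on_actions (\<iota>' j)) t'"
    unfolding j(3) tmap_tmap
    using subsetD[OF WHDTS_transitions_on[OF D_obj_WHDTS[OF j(1)]] j(2)] assms(2,3)[OF j(1)]
    by (rule tmap_cong)
  then show ?thesis using j(1,2) unfolding joint_trans_def by blast
qed

lemma joint_trans_subset:
  assumes "is_cocone J (CTS \<Sigma>) D c \<iota>"
  shows "joint_trans \<iota> \<subseteq> transitions c"
  unfolding joint_trans_def using whdts_mapD(6)[OF cocone_map(3)[OF assms]] by auto

text \<open>The comparison map is prescribed on the images of the stages, which cover
  \<open>c\<close>. It is well defined since every cocone is constant along zigzags, and it
  preserves transitions because it does so on the generating ones.\<close>

lemma concrete_colimit_is_colimit: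
  assumes conc: "concrete_colimit c \<iota>"
  shows "is_colimit J (CTS \<Sigma>) D c \<iota>"
  unfolding is_colimit_def
proof (intro conjI allI impI)
  show cocone: "is_cocone J (CTS \<Sigma>) D c \<iota>" using conc by (simp add: concrete_colimit_def)
  fix c' \<iota>' assume c': "is_cocone J (CTS \<Sigma>) D c' \<iota>'"
  note obj = cocone_obj[OF cocone] cocone_obj[OF c']
  have cover: "states c \<subseteq> (\<Union>j\<in>Obj J. on_states (\<iota> j) ` S j)"
    "actions c \<subseteq> (\<Union>j\<in>Obj J. on_actions (\<iota> j) ` L j)"
    using conc by (simp_all add: concrete_colimit_def)
  have ker0: "on_states (\<iota>' i) s = on_states (\<iota>' j) s'"
    if "i \<in> Obj J" "s \<in> S i" "j \<in> Obj J" "s' \<in> S j" "on_states (\<iota> i) s = on_states (\<iota> j) s'" for i s j s'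
    using conc that cocone_compat(1)[OF c'] unfolding concrete_colimit_def
    by (intro diagram_eq_cocone[of i s j s' J S D0 "\<lambda>j. on_states (\<iota>' j)"]) auto
  have "\<exists>h. (\<forall>j\<in>Obj J. \<forall>s\<in>S j. on_states (\<iota> j) s \<in> states c \<longrightarrow>
      h (on_states (\<iota> j) s) = on_states (\<iota>' j) s) \<and>
      h \<in> extensional (states c)"
    by (rule ex_descend[OF cover(1)]) (rule ker0)
  then obtain h0 where
    h0: "\<And>j s. j \<in> Obj J \<Longrightarrow> s \<in> S j \<Longrightarrow> on_states (\<iota> j) s \<in> states c \<Longrightarrow>
        h0 (on_states (\<iota> j) s) = on_states (\<iota>' j) s"
      "h0 \<in> extensional (states c)"
    by blast
  have ker1: "on_actions (\<iota>' i) s = on_actions (\<iota>' j) s'"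
    if "i \<in> Obj J" "s \<in> L i" "j \<in> Obj J" "s' \<in> L j" "on_actions (\<iota> i) s = on_actions (\<iota> j) s'"
        for i s j s'
    using conc that cocone_compat(2)[OF c'] unfolding concrete_colimit_def
    by (intro diagram_eq_cocone[of i s j s' J L D1 "\<lambda>j. on_actions (\<iota>' j)"]) auto
  have "\<exists>h. (\<forall>j\<in>Obj J. \<forall>s\<in>L j. on_actions (\<iota> j) s \<in> actions c \<longrightarrow>
      h (on_actions (\<iota> j) s) = on_actions (\<iota>' j) s) \<and>
      h \<in> extensional (actions c)"
    by (rule ex_descend[OF cover(2)]) (rule ker1)
  then obtain h1 where
    h1: "\<And>j s. j \<in> Obj J \<Longrightarrow> s \<in> L j \<Longrightarrow> on_actions (\<iota> j) s \<in> actions c \<Longrightarrow>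
        h1 (on_actions (\<iota> j) s) = on_actions (\<iota>' j) s"
      "h1 \<in> extensional (actions c)"
    by blast
  note m = whdts_mapD[OF cocone_map(3)[OF cocone]] and m' = whdts_mapD[OF cocone_map(3)[OF c']]
  have h0': "h0 (on_states (\<iota> j) s) = on_states (\<iota>' j) s" if "j \<in> Obj J" "s \<in> S j" for j s
    using h0(1) that m(3) by simp
  have h1': "h1 (on_actions (\<iota> j) s) = on_actions (\<iota>' j) s" if "j \<in> Obj J" "s \<in> L j" for j s
    using h1(1) that m(4) by simp
  have hm: "whdts_map c c' h0 h1"
    unfolding whdts_map_iff
  proof (intro conjI ballI)
    have "h0 x \<in> states c'" if x: "x \<in> states c" for x
    proof -
      obtain j s where "j \<in> Obj J" "s \<in> S j" "x = on_states (\<iota> j) s" using x cover(1) by blast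
      then show ?thesis using h0' m'(3) by simp
    qed
    then show "h0 \<in> states c \<rightarrow>\<^sub>E states c'" using h0(2) by (simp add: PiE_def)
    have act: "h1 x \<in> actions c' \<and> label c' (h1 x) = label c x" if x: "x \<in> actions c" for x
    proof -
      obtain j s where "j \<in> Obj J" "s \<in> L j" "x = on_actions (\<iota> j) s" using x cover(2) by blast
      then show ?thesis using h1' m'(4,5) m(5) by simp
    qed
    then show "h1 \<in> actions c \<rightarrow>\<^sub>E actions c'" using h1(2) by (simp add: PiE_def)
    show "label c' (h1 x) = label c x" if "x \<in> actions c" for x using act that by blast
    have "tmap h0 h1 ` joint_trans \<iota> \<subseteq> transitions c'"
    proof (rule image_subsetI)
      fix t assume "t \<in> joint_trans \<iota>"
      then have "tmap h0 h1 t \<in> joint_trans \<iota>'"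
        by (rule tmap_joint_trans) (simp_all add: h0' h1')
      then show "tmap h0 h1 t \<in> transitions c'" using joint_trans_subset[OF c'] by (rule rev_subsetD)
    qed
    then have "tmap h0 h1 ` (hdts_closed hull joint_trans \<iota>) \<subseteq> transitions c'"
      by (rule hull_tmap_closed) (rule WHDTS_closed[OF Obj_CTS_WHDTS[OF obj(2)]])
    moreover have "transitions c \<subseteq> hdts_closed hull joint_trans \<iota>"
      using conc by (simp add: concrete_colimit_def)
    ultimately show "tmap h0 h1 ` transitions c \<subseteq> transitions c'"
      by (meson image_mono order_trans)
  qed
  then have h: "\<lparr>src = c, tgt = c', on_states = h0, on_actions = h1\<rparr> \<in> hom (CTS \<Sigma>) c c'" (is "?h \<in> _")
    using obj Obj_CTS_WHDTS[OF obj(1)] Obj_CTS_WHDTS[OF obj(2)] by (simp add: hom_CTS hom_WHDTS)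
  moreover have "Comp (CTS \<Sigma>) ?h (\<iota> j) = \<iota>' j" if j: "j \<in> Obj J" for j
  proof -
    have "whdts_map (fobj D j) c' (compose (S j) h0 (on_states (\<iota> j))) (compose (L j) h1 (on_actions
        (\<iota> j)))"
      by (rule whdts_map_compose[OF WHDTS_transitions_on[OF D_obj_WHDTS[OF j]]
          cocone_map(3)[OF cocone j] hm])
    from whdts_map_ext[OF this cocone_map(3)[OF c' j]] show ?thesis
      using cocone_map[OF cocone j] cocone_map[OF c' j] h0'[OF j] h1'[OF j]
      by (intro whdts_arr_eqI) (simp_all add: compose_eq)
  qed
  moreover have "k = ?h"
    if k: "k \<in> hom (CTS \<Sigma>) c c'" "\<And>j. j \<in> Obj J \<Longrightarrow> Comp (CTS \<Sigma>) k (\<iota> j) = \<iota>' j" for k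
  proof -
    have km: "whdts_map c c' (on_states k) (on_actions k)" "src k = c" "tgt k = c'"
      using k(1) by (simp_all add: hom_CTS hom_WHDTS)
    have kc: "compose (S j) (on_states k) (on_states (\<iota> j)) = on_states (\<iota>' j)"
      "compose (L j) (on_actions k) (on_actions (\<iota> j)) = on_actions (\<iota>' j)" if "j \<in> Obj J" for j
      using arg_cong[OF k(2)[OF that], of on_states] arg_cong[OF k(2)[OF that], of on_actions]
        cocone_map(1)[OF cocone that] by simp_all
    have "on_states k x = h0 x" if x: "x \<in> states c" for x
    proof -
      obtain j s where j: "j \<in> Obj J" "s \<in> S j" "x = on_states (\<iota> j) s" using x cover(1) by blast
      then show ?thesis using compose_eqD[OF kc(1)[OF j(1)] j(2)] h0'[OF j(1,2)] by simp
    qed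
    moreover have "on_actions k x = h1 x" if x: "x \<in> actions c" for x
    proof -
      obtain j s where j: "j \<in> Obj J" "s \<in> L j" "x = on_actions (\<iota> j) s" using x cover(2) by blast
      then show ?thesis using compose_eqD[OF kc(2)[OF j(1)] j(2)] h1'[OF j(1,2)] by simp
    qed
    ultimately show ?thesis
      using whdts_map_ext[OF km(1) hm] km(2,3) by (intro whdts_arr_eqI) simp_all
  qed
  ultimately show "\<exists>!h. h \<in> hom (CTS \<Sigma>) c c' \<and> (\<forall>j\<in>Obj J. Comp (CTS \<Sigma>) h (\<iota> j) = \<iota>' j)"
    by (intro ex1I[of _ ?h] conjI ballI) blast+
qed

text \<open>Labels descend to the quotient because every step of a zigzag preserves them. The result
  is covered by the stages, hence again generated by cubes, so the construction stays in
  \<open>CTS\<close>.\<close>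

lemma ex_concrete_colimit:
  assumes sm: "small TYPE('u) (Obj J)"
  shows "\<exists>c \<iota>. concrete_colimit c \<iota>"
proof -
  obtain \<iota>0 :: "'u \<Rightarrow> 'u \<Rightarrow> 'u" where
    \<iota>0: "\<And>f s. f \<in> Arr J \<Longrightarrow> s \<in> S (Dom J f) \<Longrightarrow> \<iota>0 (Cod J f) (D0 f s) = \<iota>0 (Dom J f) s"
      "\<And>i s j s'. \<iota>0 i s = \<iota>0 j s' \<Longrightarrow> ((i, s), (j, s')) \<in> diagram_eq J S D0"
    using ex_set_colimit[OF U, of J S D0] by blast
  obtain \<iota>1 :: "'u \<Rightarrow> 'u \<Rightarrow> 'u" where
    \<iota>1: "\<And>f s. f \<in> Arr J \<Longrightarrow> s \<in> L (Dom J f) \<Longrightarrow> \<iota>1 (Cod J f) (D1 f s) = \<iota>1 (Dom J f) s"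
      "\<And>i s j s'. \<iota>1 i s = \<iota>1 j s' \<Longrightarrow> ((i, s), (j, s')) \<in> diagram_eq J L D1"
    using ex_set_colimit[OF U, of J L D1] by blast
  define Sc where "Sc = (\<Union>j\<in>Obj J. \<iota>0 j ` S j)"
  define Lc where "Lc = (\<Union>j\<in>Obj J. \<iota>1 j ` L j)"
  have ker: "label (fobj D i) s = label (fobj D j) s'"
    if "i \<in> Obj J" "s \<in> L i" "j \<in> Obj J" "s' \<in> L j" "\<iota>1 i s = \<iota>1 j s'" for i s j s'
    using \<iota>1(2)[OF that(5)] whdts_mapD(5)[OF D_arr(3)]
    by (rule diagram_eq_cocone[where \<kappa> = "\<lambda>j. label (fobj D j)"])
  have "\<exists>h. (\<forall>j\<in>Obj J. \<forall>s\<in>L j. \<iota>1 j s \<in> Lc \<longrightarrow> h (\<iota>1 j s) = label (fobj D j) s) \<and> h \<in> extensional Lc"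
    by (rule ex_descend[OF equalityD1[OF Lc_def]]) (rule ker)
  then obtain l where l': "\<And>j s. j \<in> Obj J \<Longrightarrow> s \<in> L j \<Longrightarrow> \<iota>1 j s \<in> Lc \<Longrightarrow> l (\<iota>1 j s) = label (fobj D j) s"
    by blast
  have l: "l (\<iota>1 j s) = label (fobj D j) s" if "j \<in> Obj J" "s \<in> L j" for j s
    using l'[OF that] that unfolding Lc_def by blast
  define Tc where "Tc = (\<Union>j\<in>Obj J. tmap (\<iota>0 j) (\<iota>1 j) ` T j)"
  define c where "c = generated Sc Lc l Tc"
  define \<iota> where "\<iota> j = \<lparr>src = fobj D j, tgt = c, on_states = restrict (\<iota>0 j) (S j),
    on_actions = restrict (\<iota>1 j) (L j)\<rparr>" for j
  have label: "label (fobj D j) u \<in> \<Sigma>" if "j \<in> Obj J" "u \<in> L j" for j u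
    using WHDTS_label[OF D_obj_WHDTS[OF that(1)]] that(2) by auto
  have restr: "tmap (restrict (\<iota>0 j) (S j)) (restrict (\<iota>1 j) (L j)) t = tmap (\<iota>0 j) (\<iota>1 j) t"
    if "j \<in> Obj J" "t \<in> T j" for j t
    using subsetD[OF WHDTS_transitions_on[OF D_obj_WHDTS[OF that(1)]] that(2)]
        by (rule tmap_cong) simp_all
  have Tc: "Tc = joint_trans \<iota>"
    unfolding Tc_def joint_trans_def using restr by (auto simp: \<iota>_def image_iff)
  have cW: "c \<in> Obj (WHDTS \<Sigma>)"
    unfolding c_def
  proof (rule generated_in_WHDTS)
    show "l ` Lc \<subseteq> \<Sigma>" using l label by (auto simp: Lc_def)
    have "tmap (\<iota>0 j) (\<iota>1 j) t \<in> transitions_on Sc Lc" if "j \<in> Obj J" "t \<in> T j" for j t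
      by (rule tmap_in_transitions_on[OF subsetD[OF WHDTS_transitions_on[OF D_obj_WHDTS[OF that(1)]]
          that(2)]])
        (use that(1) in \<open>auto simp: Sc_def Lc_def\<close>)
    then show "Tc \<subseteq> transitions_on Sc Lc" unfolding Tc_def by blast
    show "small TYPE('u) Sc" "small TYPE('u) Lc"
      unfolding Sc_def Lc_def using D_obj_WHDTS
      by (auto intro!: small_UNION[OF U sm] small_image simp: Obj_WHDTS)
  qed
  have map: "whdts_map (fobj D j) c (on_states (\<iota> j)) (on_actions (\<iota> j))" if j: "j \<in> Obj J" for j
  proof -
    have "tmap (on_states (\<iota> j)) (on_actions (\<iota> j)) ` T j \<subseteq> Tc"
      using j unfolding Tc joint_trans_def by blast
    then have "tmap (on_states (\<iota> j)) (on_actions (\<iota> j)) ` T j \<subseteq> hdts_closed hull Tc"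
      by (meson hull_subset order_trans)
    then show ?thesis
      using j l unfolding whdts_map_iff by (auto simp: \<iota>_def c_def Sc_def Lc_def)
  qed
  have gen: "cube_generated \<Sigma> (fobj D j)" if "j \<in> Obj J" for j
    using D_obj[OF that] by (simp add: Obj_CTS[OF U])
  have "cube_generated \<Sigma> c"
  proof (rule cube_generated_if_covered[where T = Tc])
    fix u assume "u \<in> actions c"
    then obtain j where "j \<in> Obj J" "u \<in> on_actions (\<iota> j) ` L j"
      by (auto simp: c_def Lc_def \<iota>_def)
    then show "\<exists>(Z :: ('u, 'u, 'x) whdts) f0 f1. whdts_map Z c f0 f1 \<and> cube_generated \<Sigma> Z \<and>
        u \<in> f1 ` actions Z"
      using map gen by blast
  next
    fix t assume "t \<in> Tc"
    then obtain j where "j \<in> Obj J" "t \<in> tmap (on_states (\<iota> j)) (on_actions (\<iota> j)) ` T j"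
      unfolding Tc joint_trans_def by blast
    then show "\<exists>(Z :: ('u, 'u, 'x) whdts) f0 f1.
        whdts_map Z c f0 f1 \<and> cube_generated \<Sigma> Z \<and> t \<in> tmap f0 f1 ` transitions Z"
      using map gen by (intro exI conjI) auto
  qed (simp add: c_def)
  then have cC: "c \<in> Obj (CTS \<Sigma>)" using cW by (simp add: Obj_CTS[OF U])
  have "is_cocone J (CTS \<Sigma>) D c \<iota>"
    unfolding is_cocone_iff
    using cC map \<iota>0(1) \<iota>1(1) DomCod whdts_mapD(3,4)[OF D_arr(3)] by (simp add: \<iota>_def)
  then have "concrete_colimit c \<iota>"
    unfolding concrete_colimit_def Tc[symmetric] using \<iota>0(2) \<iota>1(2)
    by (auto simp: \<iota>_def c_def Sc_def Lc_def)
  then show ?thesis by blast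
qed

text \<open>Preservation of colimits is stated for an arbitrary colimit cocone. The elementwise
  description is carried over to it from the constructed colimit by comparison maps.\<close>

lemma colimit_is_concrete:
  assumes sm: "small TYPE('u) (Obj J)" and col: "is_colimit J (CTS \<Sigma>) D c \<iota>"
  shows "concrete_colimit c \<iota>"
proof -
  obtain c' \<iota>' where conc: "concrete_colimit c' \<iota>'" using ex_concrete_colimit[OF sm] by blast
  have cocone: "is_cocone J (CTS \<Sigma>) D c \<iota>" using col by (simp add: is_colimit_def)
  have cocone': "is_cocone J (CTS \<Sigma>) D c' \<iota>'" using conc by (simp add: concrete_colimit_def)
  obtain h where h: "h \<in> hom (CTS \<Sigma>) c c'" "\<And>j. j \<in> Obj J \<Longrightarrow> Comp (CTS \<Sigma>) h (\<iota> j) = \<iota>' j"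
    using col cocone' unfolding is_colimit_def by metis
  obtain k where k: "k \<in> hom (CTS \<Sigma>) c' c" "\<And>j. j \<in> Obj J \<Longrightarrow> Comp (CTS \<Sigma>) k (\<iota>' j) = \<iota> j"
    using concrete_colimit_is_colimit[OF conc] cocone unfolding is_colimit_def by metis
  have hm: "whdts_map c c' (on_states h) (on_actions h)" "src h = c"
    and km: "whdts_map c' c (on_states k) (on_actions k)" "src k = c'"
    using h(1) k(1) by (simp_all add: hom_CTS hom_WHDTS)
  have cat: "category (CTS \<Sigma> :: ('u, 'x) whdts_cat)" by (rule category_CTS)
  have arrs: "h \<in> Arr (CTS \<Sigma>)" "k \<in> Arr (CTS \<Sigma>)" "Dom (CTS \<Sigma>) h = c" "Cod (CTS \<Sigma>) h = c'"
    "Dom (CTS \<Sigma>) k = c'" "Cod (CTS \<Sigma>) k = c"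
    using h(1) k(1) unfolding hom_def by auto
  \<comment> \<open>This composite suffices: each element of \<open>c\<close> is \<open>k\<close>
    applied to its image under \<open>h\<close>. Covers and generators come back along
    \<open>k\<close>, while identifications are read off after applying \<open>h\<close>.\<close>
  have "Comp (CTS \<Sigma>) k h = Ident (CTS \<Sigma>) c"
  proof -
    have "Comp (CTS \<Sigma>) k h \<in> hom (CTS \<Sigma>) c c"
      using cat arrs unfolding category_def by metis
    moreover have "Comp (CTS \<Sigma>) (Comp (CTS \<Sigma>) k h) (\<iota> j) = \<iota> j" if j: "j \<in> Obj J" for j
    proof -
      have "\<iota> j \<in> Arr (CTS \<Sigma>)" "Cod (CTS \<Sigma>) (\<iota> j) = c"
        using cocone j by (auto simp: is_cocone_def hom_def)
      then have "Comp (CTS \<Sigma>) (Comp (CTS \<Sigma>) k h) (\<iota> j) = Comp (CTS \<Sigma>) k (Comp (CTS \<Sigma>) h (\<iota> j))"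
        using cat arrs unfolding category_def by metis
      then show ?thesis by (simp only: h(2)[OF j] k(2)[OF j])
    qed
    moreover have "Ident (CTS \<Sigma>) c \<in> hom (CTS \<Sigma>) c c"
      using cat cocone_obj[OF cocone] unfolding category_def by blast
    moreover have "Comp (CTS \<Sigma>) (Ident (CTS \<Sigma>) c) (\<iota> j) = \<iota> j" if j: "j \<in> Obj J" for j
    proof -
      have "\<iota> j \<in> Arr (CTS \<Sigma>)" "Cod (CTS \<Sigma>) (\<iota> j) = c"
        using cocone j by (auto simp: is_cocone_def hom_def)
      then show ?thesis using cat unfolding category_def by metis
    qed
    ultimately show ?thesis using col cocone unfolding is_colimit_def by metis
  qed
  then have kh: "compose (states c) (on_states k) (on_states h) = (\<lambda>s\<in>states c. s)"
    "compose (actions c) (on_actions k) (on_actions h) = (\<lambda>s\<in>actions c. s)"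
    using hm(2) by simp_all
  have kh0: "on_states k (on_states h x) = x" if "x \<in> states c" for x
    using fun_cong[OF kh(1), of x] that by (simp add: compose_eq)
  have kh1: "on_actions k (on_actions h x) = x" if "x \<in> actions c" for x
    using fun_cong[OF kh(2), of x] that by (simp add: compose_eq)
  have c\<iota>: "compose (S j) (on_states h) (on_states (\<iota> j)) = on_states (\<iota>' j)"
    "compose (L j) (on_actions h) (on_actions (\<iota> j)) = on_actions (\<iota>' j)" if "j \<in> Obj J" for j
    using arg_cong[OF h(2)[OF that], of on_states] arg_cong[OF h(2)[OF that], of on_actions]
      cocone_map(1)[OF cocone that] by simp_all
  have h\<iota>: "on_states h (on_states (\<iota> j) s) = on_states (\<iota>' j) s" if "j \<in> Obj J" "s \<in> S j" for j s
    by (rule compose_eqD[OF c\<iota>(1)[OF that(1)] that(2)])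
  have h\<iota>1: "on_actions h (on_actions (\<iota> j) s) = on_actions (\<iota>' j) s" if "j \<in> Obj J" "s \<in> L j" for j s
    by (rule compose_eqD[OF c\<iota>(2)[OF that(1)] that(2)])
  have k\<iota>: "on_states k (on_states (\<iota>' j) s) = on_states (\<iota> j) s" if "j \<in> Obj J" "s \<in> S j" for j s
    using h\<iota>[OF that] kh0[OF whdts_mapD(3)[OF cocone_map(3)[OF cocone that(1)] that(2)]] by simp
  have k\<iota>1: "on_actions k (on_actions (\<iota>' j) s) = on_actions (\<iota> j) s" if "j \<in> Obj J" "s \<in> L j" for j s
    using h\<iota>1[OF that] kh1[OF whdts_mapD(4)[OF cocone_map(3)[OF cocone that(1)] that(2)]] by simp
  show ?thesis
    unfolding concrete_colimit_def
  proof (intro conjI ballI impI subsetI)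
    fix x assume x: "x \<in> states c"
    then obtain j s where "j \<in> Obj J" "s \<in> S j" "on_states h x = on_states (\<iota>' j) s"
      using whdts_mapD(3)[OF hm(1) x] conc unfolding concrete_colimit_def by blast
    then show "x \<in> (\<Union>j\<in>Obj J. on_states (\<iota> j) ` S j)"
      using kh0[OF x] k\<iota> by (auto intro!: bexI[of _ j] image_eqI[of _ _ s])
  next
    fix x assume x: "x \<in> actions c"
    then obtain j s where "j \<in> Obj J" "s \<in> L j" "on_actions h x = on_actions (\<iota>' j) s"
      using whdts_mapD(4)[OF hm(1) x] conc unfolding concrete_colimit_def by blast
    then show "x \<in> (\<Union>j\<in>Obj J. on_actions (\<iota> j) ` L j)"
      using kh1[OF x] k\<iota>1 by (auto intro!: bexI[of _ j] image_eqI[of _ _ s])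
  next
    fix t assume t: "t \<in> transitions c"
    have ht: "tmap (on_states h) (on_actions h) t \<in> hdts_closed hull joint_trans \<iota>'"
      using whdts_mapD(6)[OF hm(1) t] conc unfolding concrete_colimit_def by blast
    have "tmap (on_states k) (on_actions k) ` joint_trans \<iota>' \<subseteq> hdts_closed hull joint_trans \<iota>"
    proof (rule image_subsetI, rule hull_inc)
      fix t assume "t \<in> joint_trans \<iota>'"
      then show "tmap (on_states k) (on_actions k) t \<in> joint_trans \<iota>"
        by (rule tmap_joint_trans) (simp_all add: k\<iota> k\<iota>1)
    qed
    from hull_tmap[OF this] ht have "tmap (on_states k) (on_actions k) (tmap (on_states h)
        (on_actions h) t)
        \<in> hdts_closed hull joint_trans \<iota>"
      by (auto simp only: image_subset_iff)
    moreover have "tmap (on_states k) (on_actions k) (tmap (on_states h) (on_actions h) t) = t"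
      unfolding tmap_tmap
      using subsetD[OF WHDTS_transitions_on[OF Obj_CTS_WHDTS[OF cocone_obj[OF cocone]]] t] kh0 kh1
      by (rule tmap_ident)
    ultimately show "t \<in> hdts_closed hull joint_trans \<iota>" by simp
  next
    fix i j s s' assume *: "i \<in> Obj J" "j \<in> Obj J" "s \<in> S i" "s' \<in> S j"
        "on_states (\<iota> i) s = on_states (\<iota> j) s'"
    then have "on_states (\<iota>' i) s = on_states (\<iota>' j) s'"
      using h\<iota>[of i s] h\<iota>[of j s'] by simp
    with * show "((i, s), (j, s')) \<in> diagram_eq J S D0"
      using conc unfolding concrete_colimit_def by blast
  next
    fix i j s s' assume *: "i \<in> Obj J" "j \<in> Obj J" "s \<in> L i" "s' \<in> L j"
        "on_actions (\<iota> i) s = on_actions (\<iota> j) s'"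
    then have "on_actions (\<iota>' i) s = on_actions (\<iota>' j) s'"
      using h\<iota>1[of i s] h\<iota>1[of j s'] by simp
    with * show "((i, s), (j, s')) \<in> diagram_eq J L D1"
      using conc unfolding concrete_colimit_def by blast
  qed (rule cocone)
qed

end

lemma cocomplete_CTS:
  assumes U: "universe TYPE('u)"
  shows "cocomplete TYPE('u) (CTS \<Sigma> :: ('u, 'x) whdts_cat)"
  unfolding cocomplete_def
proof (intro allI impI)
  fix J :: "('u, 'u) cat" and D
  assume sc: "small_category TYPE('u) J" and "is_functor J (CTS \<Sigma> :: ('u, 'x) whdts_cat) D"
  then interpret cts_diagram \<Sigma> J D
    by unfold_locales (simp_all add: U small_category_def)
  show "\<exists>c \<iota>. is_colimit J (CTS \<Sigma>) D c \<iota>"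
    using ex_concrete_colimit concrete_colimit_is_colimit sc unfolding small_category_def by blast
qed

section \<open>Directed colimits and finite presentability\<close>

lemma poset_cat_simps [simp]:
  "Obj (poset_cat I r) = I" "Arr (poset_cat I r) = r" "Dom (poset_cat I r) = fst"
      "Cod (poset_cat I r) = snd"
  "Ident (poset_cat I r) i = (i, i)" "Comp (poset_cat I r) g f = (fst f, snd g)"
  by (simp_all add: poset_cat_def)

lemma directed_posetD:
  assumes "directed_poset I r"
  shows "(i, j) \<in> r \<Longrightarrow> i \<in> I" "(i, j) \<in> r \<Longrightarrow> j \<in> I" "i \<in> I \<Longrightarrow> (i, i) \<in> r"
    and "(i, j) \<in> r \<Longrightarrow> (j, k) \<in> r \<Longrightarrow> (i, k) \<in> r"
    and "i \<in> I \<Longrightarrow> j \<in> I \<Longrightarrow> \<exists>k\<in>I. (i, k) \<in> r \<and> (j, k) \<in> r"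
    and "I \<noteq> {}"
  using assms unfolding directed_poset_def by (auto dest: refl_onD transD)

lemma category_poset_cat:
  assumes "directed_poset I r"
  shows "category (poset_cat I r)"
  unfolding category_def hom_def using directed_posetD(1-4)[OF assms] by auto

lemma directed_upper_bound:
  assumes dir: "directed_poset I r" and "finite A" "A \<subseteq> I"
  shows "\<exists>k\<in>I. \<forall>i\<in>A. (i, k) \<in> r"
  using assms(2,3)
proof (induction A rule: finite_induct)
  case empty
  then show ?case using directed_posetD(6)[OF dir] by auto
next
  case (insert x A)
  then obtain k where "k \<in> I" "\<forall>i\<in>A. (i, k) \<in> r" by auto
  moreover obtain l where "l \<in> I" "(x, l) \<in> r" "(k, l) \<in> r"
    using directed_posetD(5)[OF dir, of x k] insert.prems \<open>k \<in> I\<close> by auto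
  ultimately show ?case using directed_posetD(4)[OF dir] by (metis insert_iff)
qed

section \<open>Directed cocones of sets\<close>

text \<open>Common frame for the states and for the actions of a directed diagram: a cocone that
  identifies only what zigzags force.\<close>

locale directed_cocone =
  fixes I :: "'i set" and r and S :: "'i \<Rightarrow> 's set" and F :: "'i \<times> 'i \<Rightarrow> 's \<Rightarrow> 's" and \<iota> :: "'i \<Rightarrow> 's \<Rightarrow> 't"
  assumes dir: "directed_poset I r"
    and F_in: "(i, j) \<in> r \<Longrightarrow> s \<in> S i \<Longrightarrow> F (i, j) s \<in> S j"
    and F_comp: "(i, j) \<in> r \<Longrightarrow> (j, k) \<in> r \<Longrightarrow> s \<in> S i \<Longrightarrow> F (j, k) (F (i, j) s) = F (i, k) s"
    and compat: "(i, j) \<in> r \<Longrightarrow> s \<in> S i \<Longrightarrow> \<iota> j (F (i, j) s) = \<iota> i s"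
    and ker: "i \<in> I \<Longrightarrow> j \<in> I \<Longrightarrow> s \<in> S i \<Longrightarrow> s' \<in> S j \<Longrightarrow> \<iota> i s = \<iota> j s' \<Longrightarrow>
      ((i, s), (j, s')) \<in> diagram_eq (poset_cat I r) S F"
begin

text \<open>A zigzag collapses to an equality at one later stage. A forward step is absorbed by
  moving to an upper bound of its target and the stage reached so far; a backward step is absorbed
  by composition.\<close>

lemma eventual:
  assumes "i \<in> I" "j \<in> I" "s \<in> S i" "s' \<in> S j" "\<iota> i s = \<iota> j s'"
  shows "\<exists>k. (i, k) \<in> r \<and> (j, k) \<in> r \<and> F (i, k) s = F (j, k) s'"
proof -
  have "case q of (j, s') \<Rightarrow> j \<in> I \<and> s' \<in> S j \<and> (\<exists>k. (i, k) \<in> r \<and> (j, k) \<in> r \<and> F (i, k) s = F (j, k) s')"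
    if "((i, s), q) \<in> diagram_eq (poset_cat I r) S F" for q
    using that unfolding diagram_eq_def
  proof (induction rule: rtrancl_induct)
    case base
    then show ?case using assms(1,3) directed_posetD(3)[OF dir] by auto
  next
    case (step p q)
    obtain j s' where p: "p = (j, s')" by (cases p)
    with step.IH obtain k where k: "j \<in> I" "s' \<in> S j" "(i, k) \<in> r" "(j, k) \<in> r"
        "F (i, k) s = F (j, k) s'"
      by auto
    from step.hyps(2) consider
      (fwd) l where "q = (l, F (j, l) s')" "(j, l) \<in> r" |
      (bwd) l s'' where "q = (l, s'')" "(l, j) \<in> r" "s'' \<in> S l" "s' = F (l, j) s''"
      unfolding p diagram_rel_def by auto
    then show ?case
    proof cases
      case fwd
      have "l \<in> I" "k \<in> I" using directed_posetD(2)[OF dir] fwd(2) k(3) by auto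
      then obtain m where m: "(l, m) \<in> r" "(k, m) \<in> r" using directed_posetD(5)[OF dir] by blast
      have "F (i, m) s = F (k, m) (F (i, k) s)" using F_comp[OF k(3) m(2) assms(3)] by simp
      also have "\<dots> = F (j, m) s'" using F_comp[OF k(4) m(2) k(2)] k(5) by simp
      also have "\<dots> = F (l, m) (F (j, l) s')" using F_comp[OF fwd(2) m(1) k(2)] by simp
      finally show ?thesis
        using fwd \<open>l \<in> I\<close> m directed_posetD(4)[OF dir k(3) m(2)] F_in[OF fwd(2) k(2)] by auto
    next
      case bwd
      then show ?thesis
        using k F_comp[OF bwd(2) k(4) bwd(3)] directed_posetD(1)[OF dir bwd(2)]
          directed_posetD(4)[OF dir bwd(2) k(4)] by auto
    qed
  qed
  from this[OF ker[OF assms]] show ?thesis by simp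
qed

text \<open>Each pair merges at some stage above \<open>i\<close>, and directedness combines these
  finitely many stages.\<close>

lemma stage_eq:
  assumes i: "i \<in> I" and "finite P" "P \<subseteq> {(x, y). x \<in> S i \<and> y \<in> S i \<and> \<iota> i x = \<iota> i y}"
  shows "\<exists>j. (i, j) \<in> r \<and> (\<forall>(x, y)\<in>P. F (i, j) x = F (i, j) y)"
  using assms(2,3)
proof (induction P rule: finite_induct)
  case empty
  then show ?case using directed_posetD(3)[OF dir i] by auto
next
  case (insert p P)
  then obtain j where j: "(i, j) \<in> r" "\<forall>(x, y)\<in>P. F (i, j) x = F (i, j) y" by auto
  obtain x y where p: "p = (x, y)" by (cases p)
  then have xy: "x \<in> S i" "y \<in> S i" "\<iota> i x = \<iota> i y" using insert.prems by auto
  obtain k where k: "(i, k) \<in> r" "F (i, k) x = F (i, k) y"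
    using eventual[OF i i xy] by auto
  obtain l where l: "(j, l) \<in> r" "(k, l) \<in> r"
    using directed_posetD(5)[OF dir] directed_posetD(2)[OF dir j(1)] directed_posetD(2)[OF dir k(1)]
        by blast
  have "F (i, l) x = F (i, l) y"
    using F_comp[OF k(1) l(2)] xy k(2) by metis
  moreover have "F (i, l) a = F (i, l) b" if ab: "(a, b) \<in> P" for a b
  proof -
    have "a \<in> S i" "b \<in> S i" "F (i, j) a = F (i, j) b" using insert.prems j(2) ab by auto
    then show ?thesis using F_comp[OF j(1) l(1)] by metis
  qed
  ultimately show ?case
    using directed_posetD(4)[OF dir j(1) l(1)] p by (intro exI[of _ l]) auto
qed

text \<open>The merging result is applied to the finitely many pairs from \<open>A\<close> with
  equal image in the colimit. Injectivity is claimed on the image of \<open>A\<close> only; no stage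
  as a whole need embed.\<close>

lemma stage_inj:
  assumes "i \<in> I" "finite A" "A \<subseteq> S i"
  shows "\<exists>j. (i, j) \<in> r \<and> inj_on (\<iota> j) (F (i, j) ` A)"
proof -
  let ?P = "{(x, y) \<in> A \<times> A. \<iota> i x = \<iota> i y}"
  have "finite ?P" by (rule finite_subset[of _ "A \<times> A"]) (use assms(2) in auto)
  then obtain j where j: "(i, j) \<in> r" "\<forall>(x, y)\<in>?P. F (i, j) x = F (i, j) y"
    using stage_eq[OF assms(1), of ?P] assms(3) by blast
  have "inj_on (\<iota> j) (F (i, j) ` A)"
  proof (rule inj_onI)
    fix u v assume "u \<in> F (i, j) ` A" "v \<in> F (i, j) ` A" and uv: "\<iota> j u = \<iota> j v"
    then obtain x y where xy: "x \<in> A" "y \<in> A" "u = F (i, j) x" "v = F (i, j) y" by blast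
    then have "\<iota> i x = \<iota> i y" using uv compat[OF j(1)] subsetD[OF assms(3)] by simp
    then show "u = v" using j(2) xy by blast
  qed
  with j(1) show ?thesis by blast
qed

text \<open>Elements of \<open>A\<close> with equal image in the colimit agree at stage
  \<open>j\<close>, hence at every later one. This allows stages found for states and for actions to
  be combined.\<close>

lemma stage_inj_mono:
  assumes "inj_on (\<iota> j) (F (i, j) ` A)" "A \<subseteq> S i" "(i, j) \<in> r" "(j, k) \<in> r"
  shows "inj_on (\<iota> k) (F (i, k) ` A)"
proof -
  have "F (i, k) x = F (i, k) y" if xy: "x \<in> A" "y \<in> A" "\<iota> k (F (i, k) x) = \<iota> k (F (i, k) y)" for x y
  proof -
    have S: "x \<in> S i" "y \<in> S i" using assms(2) xy by auto
    have "\<iota> j (F (i, j) x) = \<iota> j (F (i, j) y)"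
      using xy(3) compat[OF assms(3)] compat[OF directed_posetD(4)[OF dir assms(3,4)]] S by simp
    then have "F (i, j) x = F (i, j) y" using assms(1) xy(1,2) by (auto dest: inj_onD)
    then show ?thesis using F_comp[OF assms(3,4)] S by metis
  qed
  then show ?thesis by (auto intro!: inj_onI)
qed

lemma image_mono_stage:
  assumes "(i, j) \<in> r"
  shows "\<iota> i ` S i \<subseteq> \<iota> j ` S j"
  using compat[OF assms] F_in[OF assms] by (metis image_eqI image_subsetI)

end

text \<open>Each element of \<open>A\<close> lies in some \<open>B i\<close>; an upper bound of
  these finitely many indices contains them all.\<close>

lemma finite_subset_directed_Union:
  assumes dir: "directed_poset I r" and mono: "\<And>i j. (i, j) \<in> r \<Longrightarrow> B i \<subseteq> B j"
    and "finite A" "A \<subseteq> (\<Union>i\<in>I. B i)"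
  shows "\<exists>i\<in>I. A \<subseteq> B i"
proof -
  obtain f where f: "\<And>a. a \<in> A \<Longrightarrow> f a \<in> I \<and> a \<in> B (f a)"
    using assms(4) by (metis UN_E subsetD)
  then obtain k where "k \<in> I" "\<forall>i\<in>f ` A. (i, k) \<in> r"
    using directed_upper_bound[OF dir, of "f ` A"] assms(3) by auto
  then show ?thesis using f mono by blast
qed

section \<open>Directed colimits of cubical systems\<close>

locale directed_cts =
  fixes \<Sigma> :: "'x set" and I :: "'u set" and r
    and D :: "('u, 'u \<times> 'u, ('u, 'u, 'x) whdts, ('u, 'u, 'x) whdts_arr) cat_functor"
    and c \<iota>
  assumes univ: "universe TYPE('u)" and dir: "directed_poset I r" and sm: "small TYPE('u) I"
    and func: "is_functor (poset_cat I r) (CTS \<Sigma>) D"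
    and col: "is_colimit (poset_cat I r) (CTS \<Sigma>) D c \<iota>"
begin

sublocale cts_diagram \<Sigma> "poset_cat I r" D
  by unfold_locales (rule univ, rule category_poset_cat[OF dir], rule func)

abbreviation "\<iota>0 i \<equiv> on_states (\<iota> i)"
abbreviation "\<iota>1 i \<equiv> on_actions (\<iota> i)"

lemma conc: "concrete_colimit c \<iota>"
  using colimit_is_concrete[OF _ col] sm by simp

lemma cocone: "is_cocone (poset_cat I r) (CTS \<Sigma>) D c \<iota>"
  using conc by (simp add: concrete_colimit_def)

lemma D_map: "(i, j) \<in> r \<Longrightarrow> whdts_map (fobj D i) (fobj D j) (D0 (i, j)) (D1 (i, j))"
  using D_arr(3)[of "(i, j)"] by simp

lemma D_comp:
  assumes "(i, j) \<in> r" "(j, k) \<in> r"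
  shows "s \<in> S i \<Longrightarrow> D0 (j, k) (D0 (i, j) s) = D0 (i, k) s"
    and "u \<in> L i \<Longrightarrow> D1 (j, k) (D1 (i, j) u) = D1 (i, k) u"
proof -
  have "\<forall>f\<in>r. \<forall>g\<in>r. snd f = fst g \<longrightarrow> farr D (fst f, snd g) = Comp (CTS \<Sigma>) (farr D g) (farr D f)"
    using func unfolding is_functor_def poset_cat_simps by blast
  from bspec[OF bspec[OF this assms(1)] assms(2)]
  have eq: "Comp (CTS \<Sigma>) (farr D (j, k)) (farr D (i, j)) = farr D (i, k)"
    by (simp only: fst_conv snd_conv simp_thms)
  have c: "compose (S i) (D0 (j, k)) (D0 (i, j)) = D0 (i, k)"
      "compose (L i) (D1 (j, k)) (D1 (i, j)) = D1 (i, k)"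
    using D_arr(1)[of "(i, j)"] assms(1) arg_cong[OF eq, of on_states] arg_cong[OF eq, of on_actions]
    by simp_all
  show "D0 (j, k) (D0 (i, j) s) = D0 (i, k) s" if "s \<in> S i" using c(1) that by (rule compose_eqD)
  show "D1 (j, k) (D1 (i, j) u) = D1 (i, k) u" if "u \<in> L i" using c(2) that by (rule compose_eqD)
qed

sublocale st: directed_cocone I r S D0 \<iota>0
proof
  show "directed_poset I r" by (rule dir)
  fix i j s assume "(i, j) \<in> r" "s \<in> S i"
  then show "D0 (i, j) s \<in> S j" "\<iota>0 j (D0 (i, j) s) = \<iota>0 i s"
    using whdts_mapD(3)[OF D_map] cocone_compat(1)[OF cocone, of "(i, j)"] by auto
next
  fix i j k s assume "(i, j) \<in> r" "(j, k) \<in> r" "s \<in> S i"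
  then show "D0 (j, k) (D0 (i, j) s) = D0 (i, k) s" by (rule D_comp)
next
  fix i j s s' assume "i \<in> I" "j \<in> I" "s \<in> S i" "s' \<in> S j" "\<iota>0 i s = \<iota>0 j s'"
  then show "((i, s), (j, s')) \<in> diagram_eq (poset_cat I r) S D0"
    using conc unfolding concrete_colimit_def by simp
qed

sublocale ac: directed_cocone I r L D1 \<iota>1
proof
  show "directed_poset I r" by (rule dir)
  fix i j s assume "(i, j) \<in> r" "s \<in> L i"
  then show "D1 (i, j) s \<in> L j" "\<iota>1 j (D1 (i, j) s) = \<iota>1 i s"
    using whdts_mapD(4)[OF D_map] cocone_compat(2)[OF cocone, of "(i, j)"] by auto
next
  fix i j k s assume "(i, j) \<in> r" "(j, k) \<in> r" "s \<in> L i"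
  then show "D1 (j, k) (D1 (i, j) s) = D1 (i, k) s" by (rule D_comp)
next
  fix i j s s' assume "i \<in> I" "j \<in> I" "s \<in> L i" "s' \<in> L j" "\<iota>1 i s = \<iota>1 j s'"
  then show "((i, s), (j, s')) \<in> diagram_eq (poset_cat I r) L D1"
    using conc unfolding concrete_colimit_def by simp
qed

lemma T_on: "i \<in> I \<Longrightarrow> T i \<subseteq> transitions_on (S i) (L i)"
  using WHDTS_transitions_on[OF D_obj_WHDTS] by simp

lemma tmap_stage:
  assumes "(i, j) \<in> r" "t \<in> T i"
  shows "tmap (\<iota>0 j) (\<iota>1 j) (tmap (D0 (i, j)) (D1 (i, j)) t) = tmap (\<iota>0 i) (\<iota>1 i) t"
  unfolding tmap_tmap
  using subsetD[OF T_on[OF directed_posetD(1)[OF dir assms(1)]] assms(2)]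
    st.compat[OF assms(1)] ac.compat[OF assms(1)]
  by (rule tmap_cong)

lemma trans_image_mono:
  assumes "(i, j) \<in> r"
  shows "tmap (\<iota>0 i) (\<iota>1 i) ` T i \<subseteq> tmap (\<iota>0 j) (\<iota>1 j) ` T j"
  using tmap_stage[OF assms] whdts_mapD(6)[OF D_map[OF assms]] by (metis image_eqI image_subsetI)

lemma joint_trans_eq: "joint_trans \<iota> = (\<Union>i\<in>I. tmap (\<iota>0 i) (\<iota>1 i) ` T i)"
  by (simp add: joint_trans_def)

text \<open>Lifts chosen separately need not match: the end states of a lifted transition may differ
  from the chosen lifts of its end states. They agree in the colimit, hence also at a later stage
  whose map to the colimit is injective on everything chosen.\<close>

lemma finite_section:
  assumes Y0: "finite Y0" "Y0 \<subseteq> states c" and Y1: "finite Y1" "Y1 \<subseteq> actions c"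
    and X: "finite X" "X \<subseteq> joint_trans \<iota>" "X \<subseteq> transitions_on Y0 Y1"
  shows "\<exists>l\<in>I. \<exists>p0 p1. (\<forall>x\<in>Y0. p0 x \<in> S l \<and> \<iota>0 l (p0 x) = x) \<and>
    (\<forall>x\<in>Y1. p1 x \<in> L l \<and> \<iota>1 l (p1 x) = x) \<and> tmap p0 p1 ` X \<subseteq> T l"
proof -
  obtain k0 where k0: "k0 \<in> I" "Y0 \<subseteq> \<iota>0 k0 ` S k0"
    using finite_subset_directed_Union[OF dir st.image_mono_stage Y0(1)] Y0(2) conc
    unfolding concrete_colimit_def poset_cat_simps by (meson order_trans)
  obtain k1 where k1: "k1 \<in> I" "Y1 \<subseteq> \<iota>1 k1 ` L k1"
    using finite_subset_directed_Union[OF dir ac.image_mono_stage Y1(1)] Y1(2) conc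
    unfolding concrete_colimit_def poset_cat_simps by (meson order_trans)
  obtain k2 where k2: "k2 \<in> I" "X \<subseteq> tmap (\<iota>0 k2) (\<iota>1 k2) ` T k2"
    using finite_subset_directed_Union[OF dir trans_image_mono X(1)] X(2)
    unfolding joint_trans_eq by meson
  obtain k where k: "k \<in> I" "(k0, k) \<in> r" "(k1, k) \<in> r" "(k2, k) \<in> r"
    using directed_upper_bound[OF dir, of "{k0, k1, k2}"] k0(1) k1(1) k2(1) by auto
  have Y0k: "Y0 \<subseteq> \<iota>0 k ` S k" using k0(2) st.image_mono_stage[OF k(2)] by (rule order_trans)
  have Y1k: "Y1 \<subseteq> \<iota>1 k ` L k" using k1(2) ac.image_mono_stage[OF k(3)] by (rule order_trans)
  have Xk: "X \<subseteq> tmap (\<iota>0 k) (\<iota>1 k) ` T k" using k2(2) trans_image_mono[OF k(4)] by (rule order_trans)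
  define q0 where "q0 = inv_into (S k) (\<iota>0 k)"
  define q1 where "q1 = inv_into (L k) (\<iota>1 k)"
  define tt where "tt = inv_into (T k) (tmap (\<iota>0 k) (\<iota>1 k))"
  have q0: "q0 x \<in> S k" "\<iota>0 k (q0 x) = x" if "x \<in> Y0" for x
    using subsetD[OF Y0k that] by (simp_all add: q0_def inv_into_into f_inv_into_f)
  have q1: "q1 x \<in> L k" "\<iota>1 k (q1 x) = x" if "x \<in> Y1" for x
    using subsetD[OF Y1k that] by (simp_all add: q1_def inv_into_into f_inv_into_f)
  have tt: "tt t \<in> T k" "tmap (\<iota>0 k) (\<iota>1 k) (tt t) = t" if "t \<in> X" for t
    unfolding tt_def using subsetD[OF Xk that] by (rule inv_into_into, rule f_inv_into_f)
  have ttS: "tt t \<in> transitions_on (S k) (L k)" if "t \<in> X" for t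
    using subsetD[OF T_on[OF k(1)] tt(1)[OF that]] .
  \<comment> \<open>The chosen lifts of elements together with the end states and letters of the
    lifted transitions, so that injectivity can compare the two.\<close>
  define A0 where "A0 = q0 ` Y0 \<union> (\<Union>t\<in>X. {fst (tt t), snd (snd (tt t))})"
  define A1 where "A1 = q1 ` Y1 \<union> (\<Union>t\<in>X. set (fst (snd (tt t))))"
  have fin: "finite A0" "finite A1" using Y0(1) Y1(1) X(1) by (simp_all add: A0_def A1_def)
  have A0: "A0 \<subseteq> S k" using q0(1) ttS by (fastforce simp: A0_def transitions_on_def)
  have A1: "A1 \<subseteq> L k" using q1(1) ttS by (fastforce simp: A1_def transitions_on_def)
  obtain l0 where l0: "(k, l0) \<in> r" "inj_on (\<iota>0 l0) (D0 (k, l0) ` A0)"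
    using st.stage_inj[OF k(1) fin(1) A0] by blast
  obtain l1 where l1: "(k, l1) \<in> r" "inj_on (\<iota>1 l1) (D1 (k, l1) ` A1)"
    using ac.stage_inj[OF k(1) fin(2) A1] by blast
  obtain l where l: "(l0, l) \<in> r" "(l1, l) \<in> r" "l \<in> I"
    using directed_posetD(5)[OF dir] directed_posetD(2)[OF dir l0(1)] directed_posetD(2)[OF dir l1(1)]
        by blast
  have kl: "(k, l) \<in> r" using directed_posetD(4)[OF dir l0(1) l(1)] .
  have inj0: "inj_on (\<iota>0 l) (D0 (k, l) ` A0)" using st.stage_inj_mono[OF l0(2) A0 l0(1) l(1)] .
  have inj1: "inj_on (\<iota>1 l) (D1 (k, l) ` A1)" using ac.stage_inj_mono[OF l1(2) A1 l1(1) l(2)] .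
  define p0 where "p0 x = D0 (k, l) (q0 x)" for x
  define p1 where "p1 x = D1 (k, l) (q1 x)" for x
  have p0: "p0 x \<in> S l" "\<iota>0 l (p0 x) = x" "p0 x \<in> D0 (k, l) ` A0" if "x \<in> Y0" for x
    unfolding p0_def using st.F_in[OF kl] st.compat[OF kl] q0[OF that] that by (simp_all add: A0_def)
  have p1: "p1 x \<in> L l" "\<iota>1 l (p1 x) = x" "p1 x \<in> D1 (k, l) ` A1" if "x \<in> Y1" for x
    unfolding p1_def using ac.F_in[OF kl] ac.compat[OF kl] q1[OF that] that by (simp_all add: A1_def)
  have "tmap p0 p1 t \<in> T l" if t: "t \<in> X" for t
  proof -
    have tY: "t \<in> transitions_on Y0 Y1" using X(3) t by (rule subsetD)
    have a: "tmap p0 p1 t \<in> transitions_on (D0 (k, l) ` A0) (D1 (k, l) ` A1)"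
      using tY by (rule tmap_in_transitions_on) (use p0(3) p1(3) in auto)
    have "tt t \<in> transitions_on A0 A1"
      using ttS[OF t] t by (cases "tt t") (force simp: transitions_on_def A0_def A1_def)
    then have b: "tmap (D0 (k, l)) (D1 (k, l)) (tt t) \<in> transitions_on (D0 (k, l) ` A0) (D1 (k, l) ` A1)"
      by (rule tmap_in_transitions_on) simp_all
    have "tmap (\<iota>0 l) (\<iota>1 l) (tmap p0 p1 t) = t"
      unfolding tmap_tmap using tY p0(2) p1(2) by (rule tmap_ident)
    moreover have "tmap (\<iota>0 l) (\<iota>1 l) (tmap (D0 (k, l)) (D1 (k, l)) (tt t)) = t"
      using tmap_stage[OF kl tt(1)[OF t]] tt(2)[OF t] by simp
    \<comment> \<open>Both transitions lie over carriers on which the map to the colimit is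
      injective, and both map to \<open>t\<close>. The one on the right belongs to stage
      \<open>l\<close>, so the one on the left does too.\<close>
    ultimately have "tmap p0 p1 t = tmap (D0 (k, l)) (D1 (k, l)) (tt t)"
      by (intro tmap_inj[OF inj0 inj1 a b]) simp
    then show ?thesis using whdts_mapD(6)[OF D_map[OF kl] tt(1)[OF t]] by simp
  qed
  then show ?thesis
    using l(3) p0(1,2) p1(1,2) by (intro bexI[of _ l] exI[of _ p0] exI[of _ p1]) auto
qed

lemma closed_joint_trans: "hdts_closed (joint_trans \<iota>)"
  unfolding hdts_closed_def
proof (intro conjI allI impI)
  fix \<alpha> us \<beta> \<sigma>
  assume t: "(\<alpha>, us, \<beta>) \<in> joint_trans \<iota>" and len: "length us \<ge> 2" and perm: "\<sigma> permutes {..<length us}"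
  obtain i t' where i: "i \<in> I" "t' \<in> T i" "tmap (\<iota>0 i) (\<iota>1 i) t' = (\<alpha>, us, \<beta>)"
    using t unfolding joint_trans_eq by force
  obtain a u b where t': "t' = (a, u, b)" by (metis prod_cases3)
  have u: "us = map (\<iota>1 i) u" "\<alpha> = \<iota>0 i a" "\<beta> = \<iota>0 i b" using i(3) t' by auto
  have "(a, permute_list \<sigma> u, b) \<in> T i"
    using i(2) hdts_closed_permute[OF WHDTS_closed[OF D_obj_WHDTS]] i(1) len perm u t' by simp
  moreover have "tmap (\<iota>0 i) (\<iota>1 i) (a, permute_list \<sigma> u, b) = (\<alpha>, permute_list \<sigma> us, \<beta>)"
    using perm u by (simp add: permute_list_map)
  ultimately show "(\<alpha>, permute_list \<sigma> us, \<beta>) \<in> joint_trans \<iota>"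
    unfolding joint_trans_eq by (intro UN_I[OF i(1)] image_eqI[of _ _ "(a, permute_list \<sigma> u, b)"])
        (simp_all only:)
next
  fix \<alpha> us \<beta> \<nu>1 \<nu>2 p q
  assume *: "3 \<le> length us" "1 \<le> p" "1 \<le> q" "p + q < length us"
    "(\<alpha>, us, \<beta>) \<in> joint_trans \<iota>" "(\<alpha>, take p us, \<nu>1) \<in> joint_trans \<iota>"
        "(\<nu>1, drop p us, \<beta>) \<in> joint_trans \<iota>"
    "(\<alpha>, take (p + q) us, \<nu>2) \<in> joint_trans \<iota>" "(\<nu>2, drop (p + q) us, \<beta>) \<in> joint_trans \<iota>"
  \<comment> \<open>The five premises of the coherence instance, over its four states and the
    letters of \<open>us\<close>, are the finite data to be lifted together.\<close>
  define X where "X = {(\<alpha>, us, \<beta>), (\<alpha>, take p us, \<nu>1), (\<nu>1, drop p us, \<beta>),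
    (\<alpha>, take (p + q) us, \<nu>2), (\<nu>2, drop (p + q) us, \<beta>)}"
  define Y0 where "Y0 = {\<alpha>, \<beta>, \<nu>1, \<nu>2}"
  have "joint_trans \<iota> \<subseteq> transitions_on (states c) (actions c)"
    using joint_trans_subset[OF cocone] WHDTS_transitions_on[OF Obj_CTS_WHDTS[OF cocone_obj[OF cocone]]]
    by (rule order_trans)
  then have sub: "Y0 \<subseteq> states c" "set us \<subseteq> actions c"
    using *(5,6,8) unfolding Y0_def by (auto simp: transitions_on_def subset_iff)
  have XY: "X \<subseteq> transitions_on Y0 (set us)"
    using *(1-4) set_take_subset set_drop_subset unfolding X_def Y0_def
        by (auto simp: transitions_on_def dest: in_set_takeD in_set_dropD)
  have "X \<subseteq> joint_trans \<iota>" using * unfolding X_def by simp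
  from finite_section[OF _ sub(1) _ sub(2) _ this XY] obtain l p0 p1 where l: "l \<in> I"
    "\<And>x. x \<in> Y0 \<Longrightarrow> p0 x \<in> S l \<and> \<iota>0 l (p0 x) = x"
    "\<And>x. x \<in> set us \<Longrightarrow> p1 x \<in> L l \<and> \<iota>1 l (p1 x) = x" "tmap p0 p1 ` X \<subseteq> T l"
    by (auto simp: X_def Y0_def)
  let ?t = "(\<nu>1, take q (drop p us), \<nu>2)"
  \<comment> \<open>Closure is pulled back along the section, so the axiom applies to the original
    words and no lifted \<open>take\<close> or \<open>drop\<close> has to be computed.\<close>
  have "hdts_closed (tmap p0 p1 -` T l)"
    using l(1) by (intro hdts_closed_vimage WHDTS_closed[of _ \<Sigma>] D_obj_WHDTS) simp
  note closed = hdts_closed_coherence[OF this *(1-4), of \<alpha> \<beta>]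
  have "X \<subseteq> tmap p0 p1 -` T l" using l(4) by blast
  then have "?t \<in> tmap p0 p1 -` T l"
    unfolding X_def insert_subset by (intro closed) (elim conjE, assumption)+
  then have T: "tmap p0 p1 ?t \<in> T l" by simp
  have "?t \<in> transitions_on Y0 (set us)"
    using *(1-4) by (auto simp: transitions_on_def Y0_def dest: in_set_takeD in_set_dropD)
  then have "tmap (\<iota>0 l) (\<iota>1 l) (tmap p0 p1 ?t) = ?t"
    unfolding tmap_tmap by (rule tmap_ident) (use l(2,3) in auto)
  then show "?t \<in> joint_trans \<iota>"
    unfolding joint_trans_eq using T
        by (intro UN_I[OF l(1)] image_eqI[of _ _ "tmap p0 p1 ?t"]) (simp_all only:)
qed

lemma transitions_colimit: "transitions c \<subseteq> joint_trans \<iota>"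
  using conc hull_same[of hdts_closed, OF closed_joint_trans] unfolding concrete_colimit_def by simp

end

section \<open>Hom functors and directed colimits of sets\<close>

lemma Comp_in_hom: "category C \<Longrightarrow> f \<in> hom C x y \<Longrightarrow> g \<in> hom C y z \<Longrightarrow> Comp C g f \<in> hom C x z"
  unfolding category_def hom_def by auto

lemma Comp_assoc:
  "category C \<Longrightarrow> f \<in> hom C x y \<Longrightarrow> g \<in> hom C y z \<Longrightarrow> h \<in> hom C z w \<Longrightarrow>
    Comp C h (Comp C g f) = Comp C (Comp C h g) f"
  unfolding category_def hom_def by auto

lemma hom_Set_cat: "x \<in> hom Set_cat A B \<longleftrightarrow> (\<exists>f\<in>A \<rightarrow>\<^sub>E B. x = (A, f, B))"
  by (cases x) (auto simp: hom_def Set_cat_def)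

lemma Comp_Set_cat: "Comp Set_cat (B, g, E) (A, f, B') = (A, compose A g f, E)"
  by (simp add: Set_cat_def)

lemma farr_hom_functor:
  "g \<in> hom C x y \<Longrightarrow>
     farr (hom_functor C K) g = (hom C K x, \<lambda>f\<in>hom C K x. Comp C g f, hom C K y)"
  by (auto simp: hom_functor_def hom_def)

text \<open>In sets, a directed cocone is a colimit once it is jointly surjective
  (\<open>lift\<close>) and elements of one stage with equal image merge later
  (\<open>merge\<close>). For a hom functor both become conditions on arrows out of
  \<open>K\<close>, which is where finiteness of \<open>K\<close> acts.\<close>

lemma hom_functor_colimit:
  assumes C: "category C" and dir: "directed_poset I r" and D: "is_functor (poset_cat I r) C D"
    and cocone: "is_cocone (poset_cat I r) C D c \<iota>"
    and lift: "\<And>f. f \<in> hom C K c \<Longrightarrow> \<exists>i\<in>I. \<exists>g\<in>hom C K (fobj D i). Comp C (\<iota> i) g = f"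
    and merge: "\<And>i g g'. i \<in> I \<Longrightarrow> g \<in> hom C K (fobj D i) \<Longrightarrow> g' \<in> hom C K (fobj D i) \<Longrightarrow>
      Comp C (\<iota> i) g = Comp C (\<iota> i) g' \<Longrightarrow>
      \<exists>j. (i, j) \<in> r \<and> Comp C (farr D (i, j)) g = Comp C (farr D (i, j)) g'"
  shows "is_colimit (poset_cat I r) Set_cat (functor_comp (hom_functor C K) D)
    (fobj (hom_functor C K) c) (\<lambda>i. farr (hom_functor C K) (\<iota> i))"
proof -
  let ?H = "\<lambda>i. hom C K (fobj D i)"
  have \<iota>: "\<iota> i \<in> hom C (fobj D i) c" if "i \<in> I" for i
    using cocone that unfolding is_cocone_def by simp
  have Dr: "farr D (i, j) \<in> hom C (fobj D i) (fobj D j)" if "(i, j) \<in> r" for i j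
    using D that unfolding is_functor_def poset_cat_simps by (metis fst_conv snd_conv)
  have compat: "Comp C (\<iota> j) (farr D (i, j)) = \<iota> i" if "(i, j) \<in> r" for i j
    using cocone that unfolding is_cocone_def poset_cat_simps by (metis fst_conv snd_conv)
  have compat': "Comp C (\<iota> j) (Comp C (farr D (i, j)) g) = Comp C (\<iota> i) g"
    if "(i, j) \<in> r" "g \<in> ?H i" for i j g
    using Comp_assoc[OF C that(2) Dr[OF that(1)] \<iota>] compat[OF that(1)] directed_posetD(2)[OF dir that(1)]
    by simp
  have f\<iota>: "farr (hom_functor C K) (\<iota> i) = (?H i, \<lambda>f\<in>?H i. Comp C (\<iota> i) f, hom C K c)" if "i \<in> I" for i
    using farr_hom_functor[OF \<iota>[OF that]] .
  have fD: "farr (hom_functor C K) (farr D (i, j)) =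
      (?H i, \<lambda>f\<in>?H i. Comp C (farr D (i, j)) f, ?H j)" if "(i, j) \<in> r" for i j
    using farr_hom_functor[OF Dr[OF that]] .
  have fobj: "fobj (functor_comp (hom_functor C K) D) i = ?H i" "fobj (hom_functor C K) c = hom C K c"
      for i
    by (simp_all add: functor_comp_def hom_functor_def)
  have farr: "farr (functor_comp (hom_functor C K) D) f = farr (hom_functor C K) (farr D f)" for f
    by (simp add: functor_comp_def)
  have cocone_H: "is_cocone (poset_cat I r) Set_cat (functor_comp (hom_functor C K) D) (hom C K c)
      (\<lambda>i. farr (hom_functor C K) (\<iota> i))"
    unfolding is_cocone_def poset_cat_simps fobj farr
  proof (intro conjI ballI)
    show "hom C K c \<in> Obj Set_cat" by (simp add: Set_cat_def)
    fix i assume i: "i \<in> I"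
    then show "farr (hom_functor C K) (\<iota> i) \<in> hom Set_cat (?H i) (hom C K c)"
      using Comp_in_hom[OF C _ \<iota>[OF i]] unfolding f\<iota>[OF i] hom_Set_cat by auto
  next
    fix f assume f: "f \<in> r"
    obtain i j where ij: "f = (i, j)" by (cases f)
    have r: "(i, j) \<in> r" "i \<in> I" "j \<in> I" using f ij directed_posetD(1,2)[OF dir] by auto
    have "compose (?H i) (\<lambda>f\<in>?H j. Comp C (\<iota> j) f) (\<lambda>f\<in>?H i. Comp C (farr D (i, j)) f) =
        (\<lambda>f\<in>?H i. Comp C (\<iota> i) f)"
      using Comp_in_hom[OF C _ Dr[OF r(1)]] compat'[OF r(1)]
          by (auto simp: compose_def restrict_def fun_eq_iff)
    then show "Comp Set_cat (farr (hom_functor C K) (\<iota> (snd f))) (farr (hom_functor C K) (farr D f)) =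
        farr (hom_functor C K) (\<iota> (fst f))"
      unfolding ij fst_conv snd_conv f\<iota>[OF r(2)] f\<iota>[OF r(3)] fD[OF r(1)] Comp_Set_cat by simp
  qed
  show ?thesis
    unfolding is_colimit_def fobj
  proof (intro conjI allI impI)
    fix E \<iota>' assume cE: "is_cocone (poset_cat I r) Set_cat (functor_comp (hom_functor C K) D) E \<iota>'"
    have "\<exists>f\<in>?H i \<rightarrow>\<^sub>E E. \<iota>' i = (?H i, f, E)" if "i \<in> I" for i
      using cE that unfolding is_cocone_def poset_cat_simps fobj hom_Set_cat by blast
    then obtain \<kappa> where \<kappa>: "\<And>i. i \<in> I \<Longrightarrow> \<kappa> i \<in> ?H i \<rightarrow>\<^sub>E E \<and> \<iota>' i = (?H i, \<kappa> i, E)"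
      by metis
    have \<kappa>r: "\<kappa> j (Comp C (farr D (i, j)) g) = \<kappa> i g" if r: "(i, j) \<in> r" and g: "g \<in> ?H i" for i j g
    proof -
      have I: "i \<in> I" "j \<in> I" using directed_posetD(1,2)[OF dir r] by auto
      have "Comp Set_cat (\<iota>' j) (farr (hom_functor C K) (farr D (i, j))) = \<iota>' i"
        using cE r unfolding is_cocone_def poset_cat_simps farr by (metis fst_conv snd_conv)
      then have "compose (?H i) (\<kappa> j) (\<lambda>f\<in>?H i. Comp C (farr D (i, j)) f) = \<kappa> i"
        using \<kappa>[OF I(1)] \<kappa>[OF I(2)] unfolding fD[OF r] by (simp add: Comp_Set_cat)
      from compose_eqD[OF this g] show ?thesis using g by simp
    qed
    \<comment> \<open>Arrows into different stages are first moved to a common stage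
      \<open>k\<close>, where \<open>merge\<close> applies.\<close>
    have ker: "\<kappa> i g = \<kappa> j g'"
      if ij: "i \<in> I" "g \<in> ?H i" "j \<in> I" "g' \<in> ?H j" "Comp C (\<iota> i) g = Comp C (\<iota> j) g'" for i g j g'
    proof -
      obtain k where k: "k \<in> I" "(i, k) \<in> r" "(j, k) \<in> r" using directed_posetD(5)[OF dir ij(1,3)]
          by blast
      let ?g = "Comp C (farr D (i, k)) g" and ?g' = "Comp C (farr D (j, k)) g'"
      have gk: "?g \<in> ?H k" "?g' \<in> ?H k"
        using Comp_in_hom[OF C ij(2) Dr[OF k(2)]] Comp_in_hom[OF C ij(4) Dr[OF k(3)]] .
      have "Comp C (\<iota> k) ?g = Comp C (\<iota> k) ?g'"
        using compat'[OF k(2) ij(2)] compat'[OF k(3) ij(4)] ij(5) by simp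
      from merge[OF k(1) gk this] obtain l where
        l: "(k, l) \<in> r" "Comp C (farr D (k, l)) ?g = Comp C (farr D (k, l)) ?g'" by blast
      have "\<kappa> i g = \<kappa> l (Comp C (farr D (k, l)) ?g)"
        using \<kappa>r[OF k(2) ij(2)] \<kappa>r[OF l(1) gk(1)] by simp
      also have "\<dots> = \<kappa> j g'"
        using \<kappa>r[OF k(3) ij(4)] \<kappa>r[OF l(1) gk(2)] l(2) by simp
      finally show ?thesis .
    qed
    have cover: "hom C K c \<subseteq> (\<Union>i\<in>I. (\<lambda>g. Comp C (\<iota> i) g) ` ?H i)"
      using lift by blast
    have "\<exists>h. (\<forall>i\<in>I. \<forall>g\<in>?H i. Comp C (\<iota> i) g \<in> hom C K c \<longrightarrow> h (Comp C (\<iota> i) g) = \<kappa> i g) \<and>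
        h \<in> extensional (hom C K c)"
      by (rule ex_descend[OF cover]) (rule ker)
    then obtain h where h: "\<And>i g. i \<in> I \<Longrightarrow> g \<in> ?H i \<Longrightarrow> h (Comp C (\<iota> i) g) = \<kappa> i g"
      "h \<in> extensional (hom C K c)"
      using Comp_in_hom[OF C _ \<iota>] by blast
    have hE: "h \<in> hom C K c \<rightarrow>\<^sub>E E"
    proof (rule PiE_I)
      fix f assume "f \<in> hom C K c"
      then obtain i g where "i \<in> I" "g \<in> ?H i" "f = Comp C (\<iota> i) g" using lift by blast
      then show "h f \<in> E" using h(1) \<kappa> by auto
    qed (use h(2) in \<open>simp add: extensional_def\<close>)
    show "\<exists>!k. k \<in> hom Set_cat (hom C K c) E \<and>
        (\<forall>i\<in>Obj (poset_cat I r). Comp Set_cat k (farr (hom_functor C K) (\<iota> i)) = \<iota>' i)"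
    proof (rule ex1I[of _ "(hom C K c, h, E)"], intro conjI ballI)
      show "(hom C K c, h, E) \<in> hom Set_cat (hom C K c) E" using hE by (simp add: hom_Set_cat)
      fix i assume "i \<in> Obj (poset_cat I r)"
      then have i: "i \<in> I" by simp
      have "compose (?H i) h (\<lambda>f\<in>?H i. Comp C (\<iota> i) f) = \<kappa> i"
      proof
        fix x show "compose (?H i) h (\<lambda>f\<in>?H i. Comp C (\<iota> i) f) x = \<kappa> i x"
          using h(1)[OF i] \<kappa>[OF i] by (auto simp: compose_def restrict_def PiE_def extensional_def)
      qed
      then show "Comp Set_cat (hom C K c, h, E) (farr (hom_functor C K) (\<iota> i)) = \<iota>' i"
        unfolding f\<iota>[OF i] Comp_Set_cat using \<kappa>[OF i] by simp
    next
      fix k assume k: "k \<in> hom Set_cat (hom C K c) E \<and>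
        (\<forall>i\<in>Obj (poset_cat I r). Comp Set_cat k (farr (hom_functor C K) (\<iota> i)) = \<iota>' i)"
      then obtain k' where k': "k' \<in> hom C K c \<rightarrow>\<^sub>E E" "k = (hom C K c, k', E)"
        unfolding hom_Set_cat by blast
      have "k' f = h f" if "f \<in> hom C K c" for f
      proof -
        obtain i g where i: "i \<in> I" "g \<in> ?H i" "f = Comp C (\<iota> i) g" using lift \<open>f \<in> hom C K c\<close> by blast
        have "Comp Set_cat k (farr (hom_functor C K) (\<iota> i)) = \<iota>' i" using k i(1) by simp
        then have "compose (?H i) k' (\<lambda>f\<in>?H i. Comp C (\<iota> i) f) = \<kappa> i"
          unfolding k'(2) f\<iota>[OF i(1)] Comp_Set_cat using \<kappa>[OF i(1)] by simp
        from compose_eqD[OF this i(2)] show ?thesis using i h(1) by simp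
      qed
      then have "k' = h" by (rule PiE_ext[OF k'(1) hE])
      then show "k = (hom C K c, h, E)" using k'(2) by simp
    qed
  qed (rule cocone_H)
qed

section \<open>Finite generation and finite presentability\<close>

text \<open>Finiteness is asked of a generating set of transitions only, because maps out of a
  system are tested on generators.\<close>

definition finitely_generated :: "('s, 'l, 'x) whdts \<Rightarrow> bool" where
  "finitely_generated X \<longleftrightarrow> finite (states X) \<and> finite (actions X) \<and>
     (\<exists>T. finite T \<and> transitions X = hdts_closed hull T)"

context directed_cts
begin

text \<open>A section over the image under \<open>f\<close> of the states, actions and generating
  transitions is composed with \<open>f\<close>. Closedness of the transitions at the stage extends
  the lift from generators to all transitions of \<open>K\<close>.\<close>

lemma lift_finitely_generated:
  assumes K: "K \<in> Obj (CTS \<Sigma>)" and fg: "finitely_generated K" and f: "f \<in> hom (CTS \<Sigma>) K c"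
  shows "\<exists>i\<in>I. \<exists>g\<in>hom (CTS \<Sigma>) K (fobj D i). Comp (CTS \<Sigma>) (\<iota> i) g = f"
proof -
  obtain B where B: "finite B" "transitions K = hdts_closed hull B"
    using fg unfolding finitely_generated_def by blast
  have KW: "K \<in> Obj (WHDTS \<Sigma>)" using Obj_CTS_WHDTS[OF K] .
  have fm: "whdts_map K c (on_states f) (on_actions f)" "src f = K" "tgt f = c"
    using f by (simp_all add: hom_CTS hom_WHDTS)
  have BK: "B \<subseteq> transitions K" unfolding B(2) by (rule hull_subset)
  have BS: "B \<subseteq> transitions_on (states K) (actions K)"
    using BK WHDTS_transitions_on[OF KW] by (rule order_trans)
  define Y0 Y1 X where "Y0 = on_states f ` states K" and "Y1 = on_actions f ` actions K"
    and "X = tmap (on_states f) (on_actions f) ` B"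
  have "\<exists>l\<in>I. \<exists>p0 p1. (\<forall>x\<in>Y0. p0 x \<in> S l \<and> \<iota>0 l (p0 x) = x) \<and>
      (\<forall>x\<in>Y1. p1 x \<in> L l \<and> \<iota>1 l (p1 x) = x) \<and> tmap p0 p1 ` X \<subseteq> T l"
  proof (rule finite_section)
    show "finite Y0" "finite Y1" using fg by (simp_all add: finitely_generated_def Y0_def Y1_def)
    show "finite X" using B(1) by (simp add: X_def)
    show "Y0 \<subseteq> states c" "Y1 \<subseteq> actions c" using whdts_mapD(3,4)[OF fm(1)] by (auto simp: Y0_def Y1_def)
    have "X \<subseteq> transitions c"
      unfolding X_def using whdts_mapD(6)[OF fm(1) subsetD[OF BK]] by (rule image_subsetI)
    then show "X \<subseteq> joint_trans \<iota>" using transitions_colimit by (rule order_trans)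
    show "X \<subseteq> transitions_on Y0 Y1"
      unfolding X_def Y0_def Y1_def
      by (rule image_subsetI, rule tmap_in_transitions_on[OF subsetD[OF BS]]) simp_all
  qed
  then obtain l p0 p1 where l: "l \<in> I"
    and q: "\<forall>x\<in>Y0. p0 x \<in> S l \<and> \<iota>0 l (p0 x) = x" "\<forall>x\<in>Y1. p1 x \<in> L l \<and> \<iota>1 l (p1 x) = x"
    and pX: "tmap p0 p1 ` X \<subseteq> T l"
    by blast
  have p0: "p0 (on_states f x) \<in> S l \<and> \<iota>0 l (p0 (on_states f x)) = on_states f x" if "x \<in> states K" for x
    using q(1) that by (simp add: Y0_def)
  have p1: "p1 (on_actions f x) \<in> L l \<and> \<iota>1 l (p1 (on_actions f x)) = on_actions f x" if "x \<in> actions K"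
      for x
    using q(2) that by (simp add: Y1_def)
  define g where "g = \<lparr>src = K, tgt = fobj D l, on_states = compose (states K) p0 (on_states f),
    on_actions = compose (actions K) p1 (on_actions f)\<rparr>"
  have \<iota>m: "whdts_map (fobj D l) c (\<iota>0 l) (\<iota>1 l)" "src (\<iota> l) = fobj D l" "tgt (\<iota> l) = c"
    using cocone_map[OF cocone] l by simp_all
  have DW: "fobj D l \<in> Obj (WHDTS \<Sigma>)" using D_obj_WHDTS l by simp
  have "tmap (on_states g) (on_actions g) t = tmap p0 p1 (tmap (on_states f) (on_actions f) t)"
    if "t \<in> transitions_on (states K) (actions K)" for t
    unfolding tmap_tmap using that by (rule tmap_cong) (simp_all add: g_def compose_eq)
  then have "tmap (on_states g) (on_actions g) ` B \<subseteq> T l"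
    using pX subsetD[OF BS] unfolding X_def by (simp add: image_subset_iff)
  then have "tmap (on_states g) (on_actions g) ` transitions K \<subseteq> T l"
    unfolding B(2) by (rule hull_tmap_closed) (rule WHDTS_closed[OF DW])
  \<comment> \<open>\<open>\<iota>1 l\<close> preserves labels and takes the lifted action back to
    its image under \<open>f\<close>, which has the original label.\<close>
  moreover have "label (fobj D l) (p1 (on_actions f u)) = label K u" if "u \<in> actions K" for u
    using whdts_mapD(5)[OF \<iota>m(1), of "p1 (on_actions f u)"] p1[OF that] whdts_mapD(5)[OF fm(1) that]
        by simp
  ultimately have gm: "whdts_map K (fobj D l) (on_states g) (on_actions g)"
    using p0 p1 unfolding whdts_map_iff by (simp add: g_def compose_def)
  then have g: "g \<in> hom (CTS \<Sigma>) K (fobj D l)"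
    using K KW DW D_obj l by (simp add: hom_CTS hom_WHDTS g_def)
  have "whdts_map K c (compose (states K) (\<iota>0 l) (on_states g)) (compose (actions K) (\<iota>1 l)
      (on_actions g))"
    by (rule whdts_map_compose[OF WHDTS_transitions_on[OF KW] gm \<iota>m(1)])
  from whdts_map_ext[OF this fm(1)] have "Comp (CTS \<Sigma>) (\<iota> l) g = f"
    using p0 p1 \<iota>m fm by (intro whdts_arr_eqI) (simp_all add: g_def compose_eq)
  then show ?thesis using l g by blast
qed

text \<open>Equality of arrows out of \<open>K\<close> is equality on its finitely many states and
  actions, and each of these finitely many equations holds from some stage on.\<close>

lemma merge_finitely_generated:
  assumes fg: "finitely_generated K" and i: "i \<in> I"
    and g: "g \<in> hom (CTS \<Sigma>) K (fobj D i)" and g': "g' \<in> hom (CTS \<Sigma>) K (fobj D i)"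
    and eq: "Comp (CTS \<Sigma>) (\<iota> i) g = Comp (CTS \<Sigma>) (\<iota> i) g'"
  shows "\<exists>j. (i, j) \<in> r \<and> Comp (CTS \<Sigma>) (farr D (i, j)) g = Comp (CTS \<Sigma>) (farr D (i, j)) g'"
proof -
  have gm: "whdts_map K (fobj D i) (on_states g) (on_actions g)" "src g = K"
    "whdts_map K (fobj D i) (on_states g') (on_actions g')" "src g' = K"
    using g g' by (simp_all add: hom_CTS hom_WHDTS)
  have c: "compose (states K) (\<iota>0 i) (on_states g) = compose (states K) (\<iota>0 i) (on_states g')"
    "compose (actions K) (\<iota>1 i) (on_actions g) = compose (actions K) (\<iota>1 i) (on_actions g')"
    using arg_cong[OF eq, of on_states] arg_cong[OF eq, of on_actions] gm by simp_all
  let ?P0 = "(\<lambda>s. (on_states g s, on_states g' s)) ` states K"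
  let ?P1 = "(\<lambda>s. (on_actions g s, on_actions g' s)) ` actions K"
  have "\<exists>j. (i, j) \<in> r \<and> (\<forall>(x, y)\<in>?P0. D0 (i, j) x = D0 (i, j) y)"
    using fg compose_eqD[OF c(1)] whdts_mapD(3)[OF gm(1)] whdts_mapD(3)[OF gm(3)]
    by (intro st.stage_eq[OF i]) (auto simp: finitely_generated_def compose_eq)
  then obtain j0 where j0: "(i, j0) \<in> r"
      "\<And>s. s \<in> states K \<Longrightarrow> D0 (i, j0) (on_states g s) = D0 (i, j0) (on_states g' s)"
    by auto
  have "\<exists>j. (i, j) \<in> r \<and> (\<forall>(x, y)\<in>?P1. D1 (i, j) x = D1 (i, j) y)"
    using fg compose_eqD[OF c(2)] whdts_mapD(4)[OF gm(1)] whdts_mapD(4)[OF gm(3)]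
    by (intro ac.stage_eq[OF i]) (auto simp: finitely_generated_def compose_eq)
  then obtain j1 where j1: "(i, j1) \<in> r"
      "\<And>s. s \<in> actions K \<Longrightarrow> D1 (i, j1) (on_actions g s) = D1 (i, j1) (on_actions g' s)"
    by auto
  obtain j where j: "(j0, j) \<in> r" "(j1, j) \<in> r"
    using directed_posetD(5)[OF dir] directed_posetD(2)[OF dir j0(1)] directed_posetD(2)[OF dir j1(1)]
        by blast
  have ij: "(i, j) \<in> r" using directed_posetD(4)[OF dir j0(1) j(1)] .
  have e0: "D0 (i, j) (on_states g s) = D0 (i, j) (on_states g' s)" if "s \<in> states K" for s
    using st.F_comp[OF j0(1) j(1) whdts_mapD(3)[OF gm(1) that]]
      st.F_comp[OF j0(1) j(1) whdts_mapD(3)[OF gm(3) that]] j0(2)[OF that] by simp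
  have e1: "D1 (i, j) (on_actions g s) = D1 (i, j) (on_actions g' s)" if "s \<in> actions K" for s
    using ac.F_comp[OF j1(1) j(2) whdts_mapD(4)[OF gm(1) that]]
      ac.F_comp[OF j1(1) j(2) whdts_mapD(4)[OF gm(3) that]] j1(2)[OF that] by simp
  have "Comp (CTS \<Sigma>) (farr D (i, j)) g = Comp (CTS \<Sigma>) (farr D (i, j)) g'"
    using e0 e1 gm by (auto simp: compose_def restrict_def fun_eq_iff)
  then show ?thesis using ij by blast
qed

end

lemma finitely_generated_imp_presentable:
  fixes K :: "('u, 'u, 'x) whdts"
  assumes U: "universe TYPE('u)" and K: "K \<in> Obj (CTS \<Sigma>)" and fg: "finitely_generated K"
  shows "finitely_presentable TYPE('u) (CTS \<Sigma>) K"
  unfolding finitely_presentable_def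
proof (intro conjI allI impI)
  fix I :: "'u set" and r and D :: "('u, 'u \<times> 'u, ('u, 'u, 'x) whdts, ('u, 'u,
      'x) whdts_arr) cat_functor"
    and c \<iota>
  assume a: "small TYPE('u) I" "directed_poset I r" "is_functor (poset_cat I r) (CTS \<Sigma>) D"
    "is_colimit (poset_cat I r) (CTS \<Sigma>) D c \<iota>"
  interpret directed_cts \<Sigma> I r D c \<iota> by unfold_locales (rule U a)+
  show "is_colimit (poset_cat I r) Set_cat (functor_comp (hom_functor (CTS \<Sigma>) K) D)
      (fobj (hom_functor (CTS \<Sigma>) K) c) (\<lambda>i. farr (hom_functor (CTS \<Sigma>) K) (\<iota> i))"
    by (rule hom_functor_colimit[OF category_CTS a(2,3) cocone])
      (fact lift_finitely_generated[OF K fg] merge_finitely_generated[OF fg])+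
qed (rule K)

section \<open>Cubical transition systems as directed colimits of finitely generated ones\<close>

text \<open>The letters of a transition have distinct directions, so its word is at most as long as
  the number of directions; this bounds the transitions.\<close>

lemma finite_cube: "finite (states (cube xs))" "finite (actions (cube xs))"
    "finite (transitions (cube xs))"
proof -
  show st: "finite (states (cube xs))"
    using finite_lists_length_eq[of "UNIV :: bool set" "length xs"] by (simp add: cube_simps)
  have "actions (cube xs) = (\<lambda>i. (xs ! i, Suc i)) ` {..<length xs}" by (auto simp: cube_simps)
  then show ac: "finite (actions (cube xs))" by simp
  let ?A = "actions (cube xs)"
  have "length us \<le> card ?A" if "set us \<subseteq> ?A" "distinct (map snd us)" for us
    using that card_mono[OF ac that(1)] by (simp add: distinct_map flip: distinct_card)
  then have "transitions (cube xs) \<subseteq>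
      states (cube xs) \<times> {us. set us \<subseteq> ?A \<and> length us \<le> card ?A} \<times> states (cube xs)"
    by (auto simp: cube_def Let_def)
  then show "finite (transitions (cube xs))"
    using st finite_lists_length_le[OF ac] by (meson finite_SigmaI finite_subset)
qed

section \<open>Finite subsystems of a cubical system\<close>

locale cts_presentation =
  fixes \<Sigma> :: "'x set" and X :: "('u, 'u, 'x) whdts" and N :: "'u set"
  assumes U: "universe TYPE('u)" and X: "X \<in> Obj (CTS \<Sigma>)" and N: "infinite N"
begin

lemma X_WHDTS: "X \<in> Obj (WHDTS \<Sigma>)"
  using Obj_CTS_WHDTS[OF X] .

lemma X_gen: "cube_generated \<Sigma> X"
  using X by (simp add: Obj_CTS[OF U])

type_synonym 'a index = "'a set \<times> 'a set \<times> ('a, 'a) trans set"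

abbreviation "iS i \<equiv> fst i"
abbreviation "iL i \<equiv> fst (snd i)"
abbreviation "iT i \<equiv> snd (snd i)"

definition sub :: "'u index \<Rightarrow> ('u, 'u, 'x) whdts" where
  "sub i = generated (iS i) (iL i) (label X) (iT i)"

text \<open>Triples record generators instead of closed transition sets, so the order is inclusion
  of finite sets and upper bounds are componentwise unions. Distinct triples may present the same
  subsystem. Generation by cubes is demanded of each one to keep the diagram inside
  \<open>CTS\<close>.\<close>

definition idx :: "'u index set" where
  "idx = {(S, L, T). S \<in> Fpow (states X) \<and> L \<in> Fpow (actions X) \<and> T \<in> Fpow (transitions X) \<and>
     T \<subseteq> transitions_on S L \<and> cube_generated \<Sigma> (sub (S, L, T))}"

definition le :: "'u index \<Rightarrow> 'u index \<Rightarrow> bool" where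
  le_iff: "le i j \<longleftrightarrow> iS i \<subseteq> iS j \<and> iL i \<subseteq> iL j \<and> iT i \<subseteq> iT j"

lemma sub_simps [simp]:
  "states (sub i) = iS i" "actions (sub i) = iL i" "label (sub i) = restrict (label X) (iL i)"
  "transitions (sub i) = hdts_closed hull iT i"
  by (simp_all add: sub_def)

lemma idxD:
  assumes "i \<in> idx"
  shows "finite (iS i)" "iS i \<subseteq> states X" "finite (iL i)" "iL i \<subseteq> actions X" "finite (iT i)"
    "iT i \<subseteq> transitions X" "iT i \<subseteq> transitions_on (iS i) (iL i)" "cube_generated \<Sigma> (sub i)"
  using assms by (auto simp: idx_def Fpow_def)

lemma idxI:
  assumes "finite (iS i)" "iS i \<subseteq> states X" "finite (iL i)" "iL i \<subseteq> actions X" "finite (iT i)"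
    "iT i \<subseteq> transitions X" "iT i \<subseteq> transitions_on (iS i) (iL i)" "cube_generated \<Sigma> (sub i)"
  shows "i \<in> idx"
  using assms by (cases i) (auto simp: idx_def Fpow_def)

text \<open>Smallness is what permits the triples to be coded by elements of \<open>'u\<close>, as
  an index set requires.\<close>

lemma small_idx: "small TYPE('u) idx"
proof -
  have SL: "small TYPE('u) (states X)" "small TYPE('u) (actions X)"
    using X_WHDTS by (simp_all add: Obj_WHDTS)
  have "transitions X \<subseteq> states X \<times> lists (actions X) \<times> states X"
    using WHDTS_transitions_on[OF X_WHDTS] by (auto simp: transitions_on_def)
  then have "small TYPE('u) (transitions X)"
    by (rule small_mono[rotated]) (intro small_Sigma[OF U] small_lists[OF U] SL)
  then have "small TYPE('u) (Fpow (states X) \<times> Fpow (actions X) \<times> Fpow (transitions X))"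
    by (intro small_Sigma[OF U] small_Fpow[OF U] SL)
  then show ?thesis by (rule small_mono) (auto simp: idx_def)
qed

lemma sub_incl:
  assumes "le i j" and "iT i \<subseteq> transitions_on (iS i) (iL i)" and "weak_hdts \<Sigma> (sub j)"
  shows "whdts_map (sub i) (sub j) (\<lambda>s\<in>iS i. s) (\<lambda>u\<in>iL i. u)"
proof -
  have "tmap (\<lambda>s\<in>iS i. s) (\<lambda>u\<in>iL i. u) t = t" if "t \<in> iT i" for t
    using subsetD[OF assms(2) that] by (rule tmap_ident) simp_all
  then have "tmap (\<lambda>s\<in>iS i. s) (\<lambda>u\<in>iL i. u) ` iT i \<subseteq> iT j" using assms(1) by (auto simp: le_iff)
  then have "tmap (\<lambda>s\<in>iS i. s) (\<lambda>u\<in>iL i. u) ` iT i \<subseteq> transitions (sub j)"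
    using hull_subset[of "iT j" hdts_closed] by simp
  then show ?thesis
    unfolding sub_def[of i]
    by (intro whdts_map_generated[OF assms(3)]) (use assms(1) in \<open>auto simp: le_iff\<close>)
qed

text \<open>The componentwise union is covered by its two parts, hence generated by cubes.\<close>

lemma idx_upper:
  assumes i: "i \<in> idx" and j: "j \<in> idx"
  shows "\<exists>k\<in>idx. le i k \<and> le j k"
proof -
  define k where "k = (iS i \<union> iS j, iL i \<union> iL j, iT i \<union> iT j)"
  have le: "le i k" "le j k" by (auto simp: le_iff k_def)
  have kS: "iT k \<subseteq> transitions_on (iS k) (iL k)"
    using idxD(7)[OF i] idxD(7)[OF j] transitions_on_mono[of "iS i" "iS k" "iL i" "iL k"]
      transitions_on_mono[of "iS j" "iS k" "iL j" "iL k"] le by (auto simp: le_iff k_def)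
  have ksub: "iS k \<subseteq> states X" "iL k \<subseteq> actions X" "iT k \<subseteq> transitions X"
    using idxD(2,4,6)[OF i] idxD(2,4,6)[OF j] by (auto simp: k_def)
  have w: "weak_hdts \<Sigma> (sub k)"
    using generated_sub_in_WHDTS[OF X_WHDTS ksub(1,2) kS] by (simp add: Obj_WHDTS sub_def)
  note incl = sub_incl[OF le(1) idxD(7)[OF i] w] sub_incl[OF le(2) idxD(7)[OF j] w]
  have "cube_generated \<Sigma> (sub k)"
  proof (rule cube_generated_if_covered[where T = "iT k"])
    fix u assume "u \<in> actions (sub k)"
    then have "u \<in> (\<lambda>u\<in>iL i. u) ` actions (sub i) \<or> u \<in> (\<lambda>u\<in>iL j. u) ` actions (sub j)"
      by (auto simp: k_def)
    then show "\<exists>(Z :: ('u, 'u, 'x) whdts) f0 f1.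
        whdts_map Z (sub k) f0 f1 \<and> cube_generated \<Sigma> Z \<and> u \<in> f1 ` actions Z"
      using incl idxD(8)[OF i] idxD(8)[OF j] by blast
  next
    fix t assume t: "t \<in> iT k"
    have *: "t \<in> tmap (\<lambda>s\<in>iS l. s) (\<lambda>u\<in>iL l. u) ` transitions (sub l)" if "t \<in> iT l" "l \<in> idx" for l
    proof -
      have "tmap (\<lambda>s\<in>iS l. s) (\<lambda>u\<in>iL l. u) t = t"
        using subsetD[OF idxD(7)[OF that(2)] that(1)] by (rule tmap_ident) simp_all
      moreover have "t \<in> transitions (sub l)" using that(1) by (simp add: hull_inc)
      ultimately show ?thesis by (metis imageI)
    qed
    have "t \<in> iT i \<or> t \<in> iT j" using t by (simp add: k_def)
    then show "\<exists>(Z :: ('u, 'u, 'x) whdts) f0 f1.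
        whdts_map Z (sub k) f0 f1 \<and> cube_generated \<Sigma> Z \<and> t \<in> tmap f0 f1 ` transitions Z"
    proof
      assume "t \<in> iT i"
      from incl(1) idxD(8)[OF i] *[OF this i] show ?thesis by (intro exI conjI)
    next
      assume "t \<in> iT j"
      from incl(2) idxD(8)[OF j] *[OF this j] show ?thesis by (intro exI conjI)
    qed
  qed simp
  then have "k \<in> idx"
    using idxD(1,3,5)[OF i] idxD(1,3,5)[OF j] ksub kS by (intro idxI) (simp_all add: k_def)
  then show ?thesis using le by blast
qed

text \<open>The image of a cube is finite, and it is generated by cubes since the cube itself covers
  it. Such indices reach every state, every action and every generating transition of
  \<open>X\<close>.\<close>

lemma cube_idx:
  assumes f: "cube_map \<Sigma> X xs f0 f1"
  shows "(f0 ` states (cube xs), f1 ` actions (cube xs), tmap f0 f1 ` transitions (cube xs)) \<in> idx"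
proof (rule idxI; (unfold fst_conv snd_conv)?)
  let ?S = "f0 ` states (cube xs)" and ?L = "f1 ` actions (cube xs)"
      and ?T = "tmap f0 f1 ` transitions (cube xs)"
  have fm: "whdts_map (cube xs) X f0 f1" and xs: "set xs \<subseteq> \<Sigma>" using f by (simp_all add: cube_map_def)
  show fin: "finite ?S" "finite ?L" "finite ?T" using finite_cube[of xs] by simp_all
  show sub: "?S \<subseteq> states X" "?L \<subseteq> actions X" "?T \<subseteq> transitions X"
    using whdts_mapD(3,4,6)[OF fm] by (auto intro!: image_subsetI)
  show on: "?T \<subseteq> transitions_on ?S ?L"
  proof (rule image_subsetI)
    fix t assume "t \<in> transitions (cube xs)"
    then have "t \<in> transitions_on (states (cube xs)) (actions (cube xs))"
      using cube_transitions_on by (rule rev_subsetD)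
    then show "tmap f0 f1 t \<in> transitions_on ?S ?L" by (rule tmap_in_transitions_on) (rule subset_refl)+
  qed
  have "?T \<subseteq> hdts_closed hull ?T" by (rule hull_subset)
  then have map: "whdts_map (cube xs) (sub (?S, ?L, ?T)) f0 f1"
    using whdts_mapD(1,2,5)[OF fm] unfolding whdts_map_iff by (auto simp: PiE_iff)
  show "cube_generated \<Sigma> (sub (?S, ?L, ?T))"
  proof (rule cube_generated_if_covered[where T = ?T])
    fix u assume "u \<in> actions (sub (?S, ?L, ?T))"
    then have "u \<in> f1 ` actions (cube xs)" by simp
    with map cube_generated_cube[OF xs] show "\<exists>(Z :: (bool list, 'x \<times> nat, 'x) whdts) f0 f1.
        whdts_map Z (sub (?S, ?L, ?T)) f0 f1 \<and> cube_generated \<Sigma> Z \<and> u \<in> f1 ` actions Z"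
      by (intro exI conjI)
  next
    fix t assume "t \<in> ?T"
    with map cube_generated_cube[OF xs] show "\<exists>(Z :: (bool list, 'x \<times> nat, 'x) whdts) f0 f1.
        whdts_map Z (sub (?S, ?L, ?T)) f0 f1 \<and> cube_generated \<Sigma> Z \<and> t \<in> tmap f0 f1 ` transitions Z"
      by (intro exI conjI)
  qed simp
qed

text \<open>Names in \<open>N\<close> for the elements of a finite set. They bound the number of finitely generated
  systems: those on arbitrary finite subsets of \<open>'u\<close> do not form a small set.\<close>

definition name :: "'u set \<Rightarrow> 'u \<Rightarrow> 'u" where
  "name A = (SOME f. inj_on f A \<and> f ` A \<subseteq> N)"

definition unname :: "'u set \<Rightarrow> 'u \<Rightarrow> 'u" where
  "unname A = inv_into A (name A)"

lemma name:
  assumes "finite A"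
  shows "inj_on (name A) A" "name A ` A \<subseteq> N"
proof -
  obtain e :: "nat \<Rightarrow> 'u" where e: "inj e" "range e \<subseteq> N" using infinite_countable_subset[OF N] by blast
  obtain f :: "'u \<Rightarrow> nat" where "inj_on f A" using finite_imp_inj_to_nat_seg[OF assms] by blast
  then have "inj_on (e \<circ> f) A \<and> (e \<circ> f) ` A \<subseteq> N"
    using e by (auto intro: comp_inj_on inj_on_subset)
  then have "inj_on (name A) A \<and> name A ` A \<subseteq> N" unfolding name_def
    by (rule someI[where P = "\<lambda>f. inj_on f A \<and> f ` A \<subseteq> N"])
  then show "inj_on (name A) A" "name A ` A \<subseteq> N" by simp_all
qed

lemma unname [simp]: "finite A \<Longrightarrow> x \<in> A \<Longrightarrow> unname A (name A x) = x"
  using name(1) by (simp add: unname_def)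

text \<open>The subsystem \<open>sub i\<close> moved onto names from \<open>N\<close>. Labels are
  read through \<open>unname\<close>, which inverts the naming on a finite carrier.\<close>

definition copy :: "'u index \<Rightarrow> ('u, 'u, 'x) whdts" where
  "copy i = generated (name (iS i) ` iS i) (name (iL i) ` iL i) (\<lambda>v. label X (unname (iL i) v))
     (tmap (name (iS i)) (name (iL i)) ` iT i)"

lemma copy_simps [simp]:
  "states (copy i) = name (iS i) ` iS i" "actions (copy i) = name (iL i) ` iL i"
  by (simp_all add: copy_def)

lemma copy_WHDTS:
  assumes i: "i \<in> idx"
  shows "copy i \<in> Obj (WHDTS \<Sigma>)"
  unfolding copy_def
proof (rule generated_in_WHDTS)
  show "(\<lambda>v. label X (unname (iL i) v)) ` name (iL i) ` iL i \<subseteq> \<Sigma>"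
    using idxD(3,4)[OF i] WHDTS_label[OF X_WHDTS] by auto
  show "tmap (name (iS i)) (name (iL i)) ` iT i \<subseteq>
      transitions_on (name (iS i) ` iS i) (name (iL i) ` iL i)"
    by (rule image_subsetI, rule tmap_in_transitions_on[OF subsetD[OF idxD(7)[OF i]]]) simp_all
  show "small TYPE('u) (name (iS i) ` iS i)" "small TYPE('u) (name (iL i) ` iL i)"
    using idxD(1,3)[OF i] by (simp_all add: small_finite[OF U])
qed

lemma copy_map:
  assumes i: "i \<in> idx"
  shows "whdts_map (sub i) (copy i) (\<lambda>s\<in>iS i. name (iS i) s) (\<lambda>u\<in>iL i. name (iL i) u)"
proof -
  have "tmap (\<lambda>s\<in>iS i. name (iS i) s) (\<lambda>u\<in>iL i. name (iL i) u) t = tmap (name (iS i)) (name (iL i)) t"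
    if "t \<in> iT i" for t
    using subsetD[OF idxD(7)[OF i] that] by (rule tmap_cong) simp_all
  then have "tmap (\<lambda>s\<in>iS i. name (iS i) s) (\<lambda>u\<in>iL i. name (iL i) u) ` iT i \<subseteq> transitions (copy i)"
    by (auto simp: copy_def intro!: image_subsetI hull_inc)
  moreover have "weak_hdts \<Sigma> (copy i)" using copy_WHDTS[OF i] by (simp add: Obj_WHDTS)
  ultimately show ?thesis
    unfolding sub_def[of i]
    by (intro whdts_map_generated[of \<Sigma>]) (use idxD(3)[OF i] in \<open>auto simp: copy_def\<close>)
qed

text \<open>The renaming map covers the copy, so generation by cubes passes along it without appeal
  to its inverse.\<close>

lemma copy_CTS:
  assumes i: "i \<in> idx"
  shows "copy i \<in> Obj (CTS \<Sigma>)"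
proof -
  have "cube_generated \<Sigma> (copy i)"
  proof (rule cube_generated_if_covered[where T = "tmap (name (iS i)) (name (iL i)) ` iT i"])
    fix u assume "u \<in> actions (copy i)"
    then have "u \<in> (\<lambda>u\<in>iL i. name (iL i) u) ` actions (sub i)" by simp
    with copy_map[OF i] idxD(8)[OF i] show "\<exists>(Z :: ('u, 'u, 'x) whdts) f0 f1.
        whdts_map Z (copy i) f0 f1 \<and> cube_generated \<Sigma> Z \<and> u \<in> f1 ` actions Z"
      by (intro exI conjI)
  next
    fix t assume "t \<in> tmap (name (iS i)) (name (iL i)) ` iT i"
    then obtain t' where t': "t' \<in> iT i" "t = tmap (name (iS i)) (name (iL i)) t'" by (rule imageE)
    have "t = tmap (\<lambda>s\<in>iS i. name (iS i) s) (\<lambda>u\<in>iL i. name (iL i) u) t'"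
      unfolding t'(2) using subsetD[OF idxD(7)[OF i] t'(1)] by (rule tmap_cong) simp_all
    moreover have "t' \<in> transitions (sub i)" using t'(1) by (simp add: hull_inc)
    ultimately have "t \<in> tmap (\<lambda>s\<in>iS i. name (iS i) s) (\<lambda>u\<in>iL i. name (iL i) u) ` transitions (sub i)"
      by (rule image_eqI)
    with copy_map[OF i] idxD(8)[OF i] show "\<exists>(Z :: ('u, 'u, 'x) whdts) f0 f1.
        whdts_map Z (copy i) f0 f1 \<and> cube_generated \<Sigma> Z \<and> t \<in> tmap f0 f1 ` transitions Z"
      by (intro exI conjI)
  qed (simp add: copy_def)
  then show ?thesis using copy_WHDTS[OF i] by (simp add: Obj_CTS[OF U])
qed

lemma copy_finitely_generated: "i \<in> idx \<Longrightarrow> finitely_generated (copy i)"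
  unfolding finitely_generated_def using idxD(1,3,5)[of i]
  by (auto simp: copy_def intro!: exI[of _ "tmap (name (iS i)) (name (iL i)) ` iT i"])

definition copy_arr :: "'u index \<Rightarrow> 'u index \<Rightarrow> ('u, 'u, 'x) whdts_arr" where
  "copy_arr i j = \<lparr>src = copy i, tgt = copy j,
     on_states = (\<lambda>x\<in>name (iS i) ` iS i. name (iS j) (unname (iS i) x)),
     on_actions = (\<lambda>x\<in>name (iL i) ` iL i. name (iL j) (unname (iL i) x))\<rparr>"

definition copy_incl :: "'u index \<Rightarrow> ('u, 'u, 'x) whdts_arr" where
  "copy_incl i = \<lparr>src = copy i, tgt = X,
     on_states = (\<lambda>x\<in>name (iS i) ` iS i. unname (iS i) x),
     on_actions = (\<lambda>x\<in>name (iL i) ` iL i. unname (iL i) x)\<rparr>"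

lemma tmap_copy:
  assumes i: "i \<in> idx" and t: "t \<in> iT i"
    and f: "\<And>s. s \<in> iS i \<Longrightarrow> f0 (name (iS i) s) = g0 s" "\<And>s. s \<in> iL i \<Longrightarrow> f1 (name (iL i) s) = g1 s"
  shows "tmap f0 f1 (tmap (name (iS i)) (name (iL i)) t) = tmap g0 g1 t"
  unfolding tmap_tmap using subsetD[OF idxD(7)[OF i] t] f by (rule tmap_cong)

lemma copy_arr_hom:
  assumes i: "i \<in> idx" and j: "j \<in> idx" and le: "le i j"
  shows "copy_arr i j \<in> hom (CTS \<Sigma>) (copy i) (copy j)"
proof -
  have "whdts_map (copy i) (copy j) (on_states (copy_arr i j)) (on_actions (copy_arr i j))"
    unfolding copy_def[of i]
  proof (rule whdts_map_generated[of \<Sigma>])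
    show "weak_hdts \<Sigma> (copy j)" using copy_WHDTS[OF j] by (simp add: Obj_WHDTS)
    show "on_states (copy_arr i j) \<in> name (iS i) ` iS i \<rightarrow>\<^sub>E states (copy j)"
      "on_actions (copy_arr i j) \<in> name (iL i) ` iL i \<rightarrow>\<^sub>E actions (copy j)"
      using le idxD(1,3)[OF i] by (auto simp: copy_arr_def le_iff)
    show "label (copy j) (on_actions (copy_arr i j) u) = label X (unname (iL i) u)"
      if "u \<in> name (iL i) ` iL i" for u
    proof -
      obtain v where v: "v \<in> iL i" "u = name (iL i) v" using \<open>u \<in> name (iL i) ` iL i\<close> by (rule imageE)
      have "v \<in> iL j" using v(1) le by (auto simp: le_iff)
      moreover from this have "name (iL j) v \<in> name (iL j) ` iL j" by (rule imageI)
      ultimately show ?thesis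
        using v \<open>u \<in> name (iL i) ` iL i\<close> idxD(3)[OF i] idxD(3)[OF j] by (simp add: copy_arr_def copy_def)
    qed
    have "tmap (on_states (copy_arr i j)) (on_actions (copy_arr i j)) (tmap (name (iS i)) (name
        (iL i)) t) =
        tmap (name (iS j)) (name (iL j)) t" if "t \<in> iT i" for t
      using i that by (rule tmap_copy) (simp_all add: copy_arr_def idxD(1,3)[OF i])
    then have "tmap (on_states (copy_arr i j)) (on_actions (copy_arr i j)) `
        tmap (name (iS i)) (name (iL i)) ` iT i = tmap (name (iS j)) (name (iL j)) ` iT i"
      unfolding image_image by (rule image_cong[OF refl])
    also have "\<dots> \<subseteq> tmap (name (iS j)) (name (iL j)) ` iT j"
      using le by (intro image_mono) (simp add: le_iff)
    also have "\<dots> \<subseteq> transitions (copy j)" by (simp add: copy_def hull_subset)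
    finally show "tmap (on_states (copy_arr i j)) (on_actions (copy_arr i j)) `
        tmap (name (iS i)) (name (iL i)) ` iT i \<subseteq> transitions (copy j)" .
  qed
  then show ?thesis
    using copy_CTS[OF i] copy_CTS[OF j] copy_WHDTS[OF i] copy_WHDTS[OF j]
    by (simp add: hom_CTS hom_WHDTS copy_arr_def)
qed

text \<open>\<open>unname B\<close> cancels \<open>name B\<close> on elements of \<open>A\<close>,
  since these lie in \<open>B\<close>. The arbitrary \<open>f\<close> serves two cases: a further
  naming, for functoriality, and the identity, for compatibility with the maps into
  \<open>X\<close>.\<close>

lemma name_compose:
  assumes "finite A" "finite B" "A \<subseteq> B"
  shows "compose (name A ` A) (\<lambda>x\<in>name B ` B. f (unname B x)) (\<lambda>x\<in>name A ` A. name B (unname A x)) =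
    (\<lambda>x\<in>name A ` A. f (unname A x))"
proof
  fix x
  show "compose (name A ` A) (\<lambda>x\<in>name B ` B. f (unname B x)) (\<lambda>x\<in>name A ` A. name B (unname A x)) x =
    (\<lambda>x\<in>name A ` A. f (unname A x)) x"
  proof (cases "x \<in> name A ` A")
    case True
    then obtain s where s: "s \<in> A" "x = name A s" by (rule imageE)
    then have "name B s \<in> name B ` B" using assms(3) by blast
    then show ?thesis using True s assms by (simp add: compose_eq subset_iff)
  qed (simp add: compose_def)
qed

lemma copy_arr_compose:
  assumes "i \<in> idx" "j \<in> idx" "le i j"
  shows "Comp (CTS \<Sigma>) (copy_arr j k) (copy_arr i j) = copy_arr i k"
    and "Comp (CTS \<Sigma>) (copy_incl j) (copy_arr i j) = copy_incl i"
  using name_compose[of "iS i" "iS j" "name (iS k)"] name_compose[of "iL i" "iL j" "name (iL k)"]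
    name_compose[of "iS i" "iS j" "\<lambda>x. x"] name_compose[of "iL i" "iL j" "\<lambda>x. x"]
    idxD(1,3)[OF assms(1)] idxD(1,3)[OF assms(2)] assms(3)
  by (simp_all add: copy_arr_def copy_incl_def le_iff)

lemma copy_incl_map:
  assumes i: "i \<in> idx"
  shows "whdts_map (copy i) X (on_states (copy_incl i)) (on_actions (copy_incl i))"
  unfolding copy_def[of i]
proof (rule whdts_map_generated[of \<Sigma>])
  show "weak_hdts \<Sigma> X" using X_WHDTS by (simp add: Obj_WHDTS)
  show "on_states (copy_incl i) \<in> name (iS i) ` iS i \<rightarrow>\<^sub>E states X"
    "on_actions (copy_incl i) \<in> name (iL i) ` iL i \<rightarrow>\<^sub>E actions X"
    using idxD(1-4)[OF i] by (auto simp: copy_incl_def)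
  show "label X (on_actions (copy_incl i) u) = label X (unname (iL i) u)"
    if "u \<in> name (iL i) ` iL i" for u
    using that by (simp add: copy_incl_def)
  have "tmap (on_states (copy_incl i)) (on_actions (copy_incl i)) (tmap (name (iS i)) (name (iL i)) t) =
      tmap (\<lambda>s. s) (\<lambda>u. u) t" if "t \<in> iT i" for t
    using i that by (rule tmap_copy) (simp_all add: copy_incl_def idxD(1,3)[OF i])
  then show "tmap (on_states (copy_incl i)) (on_actions (copy_incl i)) `
      tmap (name (iS i)) (name (iL i)) ` iT i \<subseteq> transitions X"
    using idxD(6)[OF i] by (auto intro!: image_subsetI simp: tmap_def)
qed

text \<open>A directed poset has to be nonempty; this index ensures it even when \<open>X\<close>
  has no states.\<close>

lemma empty_idx: "({}, {}, {}) \<in> idx"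
proof (rule idxI)
  have "hdts_closed hull {} \<subseteq> hdts_closed hull cube_trans \<Sigma> (sub ({}, {}, {}))"
    by (rule hull_mono) simp
  then show "cube_generated \<Sigma> (sub ({}, {}, {}))" by (simp add: cube_generated_def)
qed simp_all

text \<open>Confining all carriers to \<open>N\<close> is what lets one small family serve every
  \<open>X\<close>.\<close>

lemma ex_presentation:
  "\<exists>(I :: 'u set) r D \<iota>. small TYPE('u) I \<and> directed_poset I r \<and> is_functor (poset_cat I r) (CTS \<Sigma>) D \<and>
     (\<forall>i\<in>I. fobj D i \<in> Obj (CTS \<Sigma>) \<and> finitely_generated (fobj D i) \<and>
        states (fobj D i) \<subseteq> N \<and> actions (fobj D i) \<subseteq> N) \<and>
     is_colimit (poset_cat I r) (CTS \<Sigma>) D X \<iota>"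
proof -
  \<comment> \<open>The index set has to consist of elements of \<open>'u\<close>, so the triples
    are coded by an injection with decoding \<open>d\<close>.\<close>
  obtain e :: "'u index \<Rightarrow> 'u" where e: "inj_on e idx" using small_imp_inj[OF small_idx] .
  define I where "I = e ` idx"
  define d where "d = inv_into idx e"
  have d: "d x \<in> idx" if "x \<in> I" for x using that by (simp add: I_def d_def inv_into_into)
  have de: "d (e i) = i" if "i \<in> idx" for i using that e by (simp add: d_def)
  have d_inj: "x = y" if "x \<in> I" "y \<in> I" "d x = d y" for x y
    using that e by (auto simp: I_def d_def)
  have eI: "e i \<in> I" if "i \<in> idx" for i using that by (simp add: I_def)
  define r where "r = {(x, y). x \<in> I \<and> y \<in> I \<and> le (d x) (d y)}"
  have dir: "directed_poset I r"
    unfolding directed_poset_def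
  proof (intro conjI ballI)
    show "r \<subseteq> I \<times> I" "refl_on I r" by (auto simp: r_def refl_on_def le_iff)
    show "trans r" by (auto simp: r_def trans_def le_iff)
    show "antisym r"
    proof (rule antisymI)
      fix x y assume "(x, y) \<in> r" "(y, x) \<in> r"
      then show "x = y" by (intro d_inj) (auto simp: r_def le_iff prod_eq_iff)
    qed
    show "I \<noteq> {}" using empty_idx by (auto simp: I_def)
    fix x y assume "x \<in> I" "y \<in> I"
    then obtain k where "k \<in> idx" "le (d x) k" "le (d y) k" using idx_upper d by blast
    then show "\<exists>k\<in>I. (x, k) \<in> r \<and> (y, k) \<in> r"
      using \<open>x \<in> I\<close> \<open>y \<in> I\<close> eI de by (intro bexI[of _ "e k"]) (auto simp: r_def)
  qed
  define D :: "('u, 'u \<times> 'u, ('u, 'u, 'x) whdts, ('u, 'u, 'x) whdts_arr) cat_functor" where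
    "D = \<lparr>fobj = \<lambda>x. copy (d x), farr = \<lambda>(x, y). copy_arr (d x) (d y)\<rparr>"
  define \<iota> where "\<iota> x = copy_incl (d x)" for x
  have Ds: "fobj D x = copy (d x)" "farr D (x, y) = copy_arr (d x) (d y)" for x y
    by (simp_all add: D_def)
  have rD: "x \<in> I" "y \<in> I" "d x \<in> idx" "d y \<in> idx" "le (d x) (d y)" if "(x, y) \<in> r" for x y
    using that d by (auto simp: r_def)
  have func: "is_functor (poset_cat I r) (CTS \<Sigma>) D"
    unfolding is_functor_def poset_cat_simps
  proof (intro conjI ballI impI)
    fix x assume x: "x \<in> I"
    then show "fobj D x \<in> Obj (CTS \<Sigma>)" using copy_CTS d by (simp add: Ds)
    show "farr D (x, x) = Ident (CTS \<Sigma>) (fobj D x)"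
      unfolding Ds using idxD(1,3)[OF d[OF x]]
      by (auto simp: copy_arr_def restrict_def fun_eq_iff)
  next
    fix f assume f: "f \<in> r"
    obtain x y where xy: "f = (x, y)" by (cases f)
    note fr = rD[OF f[unfolded xy]]
    show "farr D f \<in> hom (CTS \<Sigma>) (fobj D (fst f)) (fobj D (snd f))"
      using copy_arr_hom[OF fr(3-5)] by (simp add: xy Ds)
    fix g assume g: "g \<in> r" and fg: "snd f = fst g"
    obtain z where z: "g = (y, z)" using fg xy by (cases g) auto
    show "farr D (fst f, snd g) = Comp (CTS \<Sigma>) (farr D g) (farr D f)"
      unfolding xy z fst_conv snd_conv Ds by (rule copy_arr_compose(1)[OF fr(3-5), symmetric])
  qed
  interpret cts_diagram \<Sigma> "poset_cat I r" D
    by unfold_locales (rule U, rule category_poset_cat[OF dir], rule func)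
  have cocone: "is_cocone (poset_cat I r) (CTS \<Sigma>) D X \<iota>"
    unfolding is_cocone_def poset_cat_simps
  proof (intro conjI ballI)
    show "X \<in> Obj (CTS \<Sigma>)" by (rule X)
    fix x assume x: "x \<in> I"
    show "\<iota> x \<in> hom (CTS \<Sigma>) (fobj D x) X"
      using copy_incl_map[OF d[OF x]] copy_CTS[OF d[OF x]] copy_WHDTS[OF d[OF x]] X X_WHDTS
      by (simp add: hom_CTS hom_WHDTS \<iota>_def Ds copy_incl_def)
  next
    fix f assume f: "f \<in> r"
    obtain x y where xy: "f = (x, y)" by (cases f)
    show "Comp (CTS \<Sigma>) (\<iota> (snd f)) (farr D f) = \<iota> (fst f)"
      unfolding xy fst_conv snd_conv Ds \<iota>_def
      by (rule copy_arr_compose(2)) (rule rD[OF f[unfolded xy]])+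
  qed
  have upper: "\<exists>k\<in>I. (x, k) \<in> r \<and> (y, k) \<in> r" if "x \<in> I" "y \<in> I" for x y
    using directed_posetD(5)[OF dir that] .
  have \<iota>0: "on_states (\<iota> x) (name (iS (d x)) s) = s" if "x \<in> I" "s \<in> iS (d x)" for x s
    using that idxD(1)[OF d[OF that(1)]] by (simp add: \<iota>_def copy_incl_def)
  have \<iota>1: "on_actions (\<iota> x) (name (iL (d x)) s) = s" if "x \<in> I" "s \<in> iL (d x)" for x s
    using that idxD(3)[OF d[OF that(1)]] by (simp add: \<iota>_def copy_incl_def)
  have "concrete_colimit X \<iota>"
    unfolding concrete_colimit_def poset_cat_simps
  proof (intro conjI ballI impI subsetI)
    fix s assume "s \<in> states X"
    from cube_idx[OF cube_Nil_map[OF this]] obtain i where i: "i \<in> idx" "s \<in> iS i"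
      by (auto simp: cube_simps)
    then have "on_states (\<iota> (e i)) (name (iS i) s) = s" using \<iota>0[OF eI[OF i(1)]] de[OF i(1)] by simp
    then show "s \<in> (\<Union>x\<in>I. on_states (\<iota> x) ` S x)"
      using i eI[OF i(1)] de[OF i(1)]
      by (intro UN_I[of "e i"] image_eqI[of _ _ "name (iS i) s"]) (simp_all add: Ds)
  next
    fix u assume "u \<in> actions X"
    then obtain xs f0 f1 u' where "cube_map \<Sigma> X xs f0 f1" "u' \<in> actions (cube xs)" "u = f1 u'"
      using X_gen unfolding cube_generated_def cube_acts_def by blast
    with cube_idx[OF this(1)] obtain i where i: "i \<in> idx" "u \<in> iL i" by auto
    then have "on_actions (\<iota> (e i)) (name (iL i) u) = u" using \<iota>1[OF eI[OF i(1)]] de[OF i(1)] by simp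
    then show "u \<in> (\<Union>x\<in>I. on_actions (\<iota> x) ` L x)"
      using i eI[OF i(1)] de[OF i(1)]
      by (intro UN_I[of "e i"] image_eqI[of _ _ "name (iL i) u"]) (simp_all add: Ds)
  next
    fix t assume "t \<in> transitions X"
    moreover have "transitions X \<subseteq> hdts_closed hull cube_trans \<Sigma> X"
      using X_gen by (simp add: cube_generated_def)
    ultimately have t: "t \<in> hdts_closed hull cube_trans \<Sigma> X" by (rule rev_subsetD)
    \<comment> \<open>It is enough to reach the generating transitions, and those of one cube all
      belong to the index formed by its image.\<close>
    have "cube_trans \<Sigma> X \<subseteq> joint_trans \<iota>"
    proof
      fix t assume "t \<in> cube_trans \<Sigma> X"
      then obtain xs f0 f1 where f: "cube_map \<Sigma> X xs f0 f1" "t \<in> tmap f0 f1 ` transitions (cube xs)"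
        unfolding cube_trans_def by blast
      from cube_idx[OF f(1)] f(2) obtain i where i: "i \<in> idx" "t \<in> iT i" by auto
      have "tmap (on_states (\<iota> (e i))) (on_actions (\<iota> (e i))) (tmap (name (iS i)) (name (iL i)) t) =
          tmap (\<lambda>s. s) (\<lambda>u. u) t"
        using i by (rule tmap_copy) (use \<iota>0[OF eI[OF i(1)]] \<iota>1[OF eI[OF i(1)]] de[OF i(1)] in simp_all)
      then have "t = tmap (on_states (\<iota> (e i))) (on_actions (\<iota> (e i))) (tmap (name (iS i)) (name
          (iL i)) t)"
        by (simp add: tmap_def split: prod.splits)
      moreover have "tmap (name (iS i)) (name (iL i)) t \<in> T (e i)"
        using i de[OF i(1)] by (simp add: Ds copy_def hull_inc)
      ultimately show "t \<in> joint_trans \<iota>"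
        unfolding joint_trans_def poset_cat_simps using eI[OF i(1)] by (intro UN_I[of "e i"] image_eqI)
    qed
    from subsetD[OF hull_mono[OF this] t] show "t \<in> hdts_closed hull joint_trans \<iota>" .
  next
    fix x y s s' assume xy: "x \<in> I" "y \<in> I" and s: "s \<in> S x" "s' \<in> S y"
      and eq: "on_states (\<iota> x) s = on_states (\<iota> y) s'"
    obtain k where k: "(x, k) \<in> r" "(y, k) \<in> r" using upper[OF xy] by blast
    have c: "((x, s), (k, D0 (x, k) s)) \<in> diagram_eq (poset_cat I r) S D0"
      "((y, s'), (k, D0 (y, k) s')) \<in> diagram_eq (poset_cat I r) S D0"
      using diagram_eq_step[of "(x, k)" "poset_cat I r" s S D0]
        diagram_eq_step[of "(y, k)" "poset_cat I r" s' S D0] k s by simp_all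
    \<comment> \<open>Both sides are the name at \<open>k\<close> of the same element of
      \<open>X\<close>, so the two elements meet at any common upper stage and one zigzag through
      \<open>k\<close> joins them.\<close>
    have "D0 (x, k) s = D0 (y, k) s'"
      using s eq by (simp add: Ds copy_arr_def \<iota>_def copy_incl_def)
    with c(1) show "((x, s), (y, s')) \<in> diagram_eq (poset_cat I r) S D0"
      using transD[OF trans_diagram_eq _ symD[OF sym_diagram_eq c(2)]] by simp
  next
    fix x y s s' assume xy: "x \<in> I" "y \<in> I" and s: "s \<in> L x" "s' \<in> L y"
      and eq: "on_actions (\<iota> x) s = on_actions (\<iota> y) s'"
    obtain k where k: "(x, k) \<in> r" "(y, k) \<in> r" using upper[OF xy] by blast
    have c: "((x, s), (k, D1 (x, k) s)) \<in> diagram_eq (poset_cat I r) L D1"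
      "((y, s'), (k, D1 (y, k) s')) \<in> diagram_eq (poset_cat I r) L D1"
      using diagram_eq_step[of "(x, k)" "poset_cat I r" s L D1]
        diagram_eq_step[of "(y, k)" "poset_cat I r" s' L D1] k s by simp_all
    have "D1 (x, k) s = D1 (y, k) s'"
      using s eq by (simp add: Ds copy_arr_def \<iota>_def copy_incl_def)
    with c(1) show "((x, s), (y, s')) \<in> diagram_eq (poset_cat I r) L D1"
      using transD[OF trans_diagram_eq _ symD[OF sym_diagram_eq c(2)]] by simp
  qed (rule cocone)
  then have "is_colimit (poset_cat I r) (CTS \<Sigma>) D X \<iota>" by (rule concrete_colimit_is_colimit)
  moreover have "small TYPE('u) I" unfolding I_def by (rule small_image[OF small_idx])
  moreover have "fobj D x \<in> Obj (CTS \<Sigma>) \<and> finitely_generated (fobj D x) \<and>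
      states (fobj D x) \<subseteq> N \<and> actions (fobj D x) \<subseteq> N" if "x \<in> I" for x
    using copy_CTS copy_finitely_generated d[OF that] name(2) idxD(1,3)[OF d[OF that]] by (simp add: Ds)
  ultimately show ?thesis using dir func by blast
qed

end

section \<open>A small generating family\<close>

text \<open>A system of this kind is determined by finite sets of states, actions, labelled actions
  and generators, all drawn from small sets. Smallness of \<open>\<Sigma>\<close> bounds the
  possible labellings.\<close>

lemma small_finitely_generated:
  fixes \<Sigma> :: "'x set" and N :: "'u set"
  assumes U: "universe TYPE('u)" and \<Sigma>: "small TYPE('u) \<Sigma>" and N: "small TYPE('u) N"
  shows "small TYPE('u) {X \<in> Obj (WHDTS \<Sigma> :: ('u, 'x) whdts_cat). finitely_generated X \<and>
    states X \<subseteq> N \<and> actions X \<subseteq> N}"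
proof -
  \<comment> \<open>Labels are passed as a finite graph, so that they range over the finite subsets
    of \<open>N \<times> \<Sigma>\<close>; \<open>SOME\<close> reads the unique label back.\<close>
  define gen :: "'u set \<times> 'u set \<times> ('u \<times> 'x) set \<times> ('u, 'u) trans set \<Rightarrow> ('u, 'u, 'x) whdts"
    where "gen = (\<lambda>(S, L, l, T). generated S L (\<lambda>u. SOME x. (u, x) \<in> l) T)"
  let ?P = "Fpow N \<times> Fpow N \<times> Fpow (N \<times> \<Sigma>) \<times> Fpow (N \<times> lists N \<times> N)"
  have "X \<in> gen ` ?P"
    if X: "X \<in> Obj (WHDTS \<Sigma>)" "finitely_generated X" "states X \<subseteq> N" "actions X \<subseteq> N" for X
  proof -
    obtain T where T: "finite T" "transitions X = hdts_closed hull T"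
      and fin: "finite (states X)" "finite (actions X)"
      using X(2) unfolding finitely_generated_def by blast
    define l where "l = (\<lambda>u. (u, label X u)) ` actions X"
    have lab: "label X \<in> actions X \<rightarrow>\<^sub>E \<Sigma>" using WHDTS_label[OF X(1)] .
    have "T \<subseteq> transitions_on (states X) (actions X)"
      using order_trans[OF hull_subset[of T hdts_closed]] T(2) WHDTS_transitions_on[OF X(1)] by simp
    then have TN: "T \<subseteq> N \<times> lists N \<times> N" using X(3,4) by (fastforce simp: transitions_on_def)
    have "restrict (\<lambda>u. SOME x. (u, x) \<in> l) (actions X) = label X"
      using lab by (auto simp: l_def restrict_def fun_eq_iff image_iff PiE_def extensional_def)
    then have "X = gen (states X, actions X, l, T)"
      using T(2) by (simp add: gen_def generated_def)
    moreover have "(states X, actions X, l, T) \<in> ?P"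
      using fin T(1) TN X(3,4) lab by (auto simp: Fpow_def l_def)
    ultimately show ?thesis by (rule image_eqI)
  qed
  then show ?thesis
    by (intro small_mono[OF small_image[of _ ?P gen]] small_Sigma[OF U] small_Fpow[OF U]
        small_lists[OF U] N \<Sigma>) auto
qed

lemma locally_finitely_presentable_CTS:
  fixes \<Sigma> :: "'x set"
  assumes U: "universe TYPE('u)" and \<Sigma>: "small TYPE('u) \<Sigma>"
  shows "locally_finitely_presentable TYPE('u) (CTS \<Sigma> :: ('u, 'x) whdts_cat)"
proof -
  obtain e :: "nat \<Rightarrow> 'u" where e: "inj e" using infinite_countable_subset[OF universe_infinite[OF U]]
      by blast
  \<comment> \<open>A countable set of names fixed before any system is considered, so that the
    family \<open>G\<close> does not depend on the system to be presented.\<close>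
  define N where "N = range e"
  have N: "infinite N" "small TYPE('u) N"
    unfolding N_def using e small_image[OF small_nat[OF U]] by (auto dest: finite_imageD)
  define G :: "('u, 'u, 'x) whdts set" where
    "G = {K \<in> Obj (CTS \<Sigma>). finitely_generated K \<and> states K \<subseteq> N \<and> actions K \<subseteq> N}"
  have "small TYPE('u) G"
    by (rule small_mono[OF small_finitely_generated[OF U \<Sigma> N(2)]]) (auto simp: G_def Obj_CTS_WHDTS)
  moreover have "finitely_presentable TYPE('u) (CTS \<Sigma>) K" if "K \<in> G" for K
    using finitely_generated_imp_presentable[OF U, of K \<Sigma>] that by (simp add: G_def)
  moreover have "\<exists>(I :: 'u set) r D \<iota>. small TYPE('u) I \<and> directed_poset I r \<and>
      is_functor (poset_cat I r) (CTS \<Sigma>) D \<and> (\<forall>i\<in>I. fobj D i \<in> G) \<and>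
      is_colimit (poset_cat I r) (CTS \<Sigma>) D X \<iota>" if "X \<in> Obj (CTS \<Sigma>)" for X
  proof -
    interpret cts_presentation \<Sigma> X N by unfold_locales (rule U that N(1))+
    show ?thesis using ex_presentation by (simp add: G_def)
  qed
  ultimately show ?thesis
    unfolding locally_finitely_presentable_def using category_CTS cocomplete_CTS[OF U] by blast
qed

theorem corollary3p15:
  fixes \<Sigma> :: "'x set"
  assumes "universe TYPE('u)"
    and "\<Sigma> \<noteq> {}"
    and "small TYPE('u) \<Sigma>"
  shows "coreflective_subcategory (CTS \<Sigma> :: ('u, 'x) whdts_cat) (WHDTS \<Sigma>) \<and>
         locally_finitely_presentable TYPE('u) (CTS \<Sigma> :: ('u, 'x) whdts_cat)"
  using coreflective_CTS[OF assms(1)] locally_finitely_presentable_CTS[OF assms(1,3)] by (rule conjI)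

end
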